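(* Let $(W,S)$ be a finite Coxeter system with Hiller Schubert calculus as in the context, let $J\subseteq S$, $w\in W$, and let $w_{\max}$ be the unique maximum-length element of $wW_J$. Consider the inclusion $R:=\big(\Bbbk[V]/(\Bbbk[V]^W_+)\big)^{W_J}\hookrightarrow \hat R:=\Bbbk[V]/(\Bbbk[V]^W_+)$. Then: (i) $\mathcal{E}(w_{\max})\subseteq W^J$; (ii) the ideal $I_{w_{\max}}$ of $\hat R$ is generated by its contraction $I_{w_{\max}}\cap R$; (iii) $I_{w_{\max}}\cap R=I_{wW_J}$; (iv) the set $\bigcup_{v\in\mathcal{E}(w_{\max})}\{S_u: u\ge v,\ \mathrm{Des}(u)=\mathrm{Des}(v)\}$ both generates $I_{w_{\max}}$ as an ideal of $\hat R$ and generates $I_{wW_J}$ as an ideal of $R$.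
   Context: $W$ acts on its reflection representation $V$ over a subfield $\Bbbk\subseteq\mathbb{R}$, $\Bbbk[V]=\mathrm{Sym}(V^\star)$. A root system $\Phi\subset V^\star$ is a $W$-stable set of functionals $\pm\alpha$ whose kernels are exactly the reflecting hyperplanes; a chamber is fixed, $\Phi^+$ are the roots positive on it, $S$ the reflections in its walls, $\alpha_s$ the positive root vanishing on the hyperplane of $s$. $\partial_s f=(f-s(f))/\alpha_s$, $\partial_u=\partial_{s_{i_1}}\cdots\partial_{s_{i_\ell}}$ for a reduced word of $u$. With $w_0$ the longest element, $S_{w_0}=\frac1{|W|}\prod_{\alpha\in\Phi^+}\alpha$ and $S_w=\partial_{w^{-1}w_0}S_{w_0}$; their images (also denoted $S_w$) form a basis of $\hat R$. $\le$ is Bruhat order, $\mathrm{Des}(u)=\{s\in S:\ell(us)<\ell(u)\}$, $W_J=\langle J\rangle$, $W^J=\{u:\mathrm{Des}(u)\cap J=\varnothing\}$ the minimal-length coset representatives; $\{S_u:u\in W^J\}$ is a $\Bbbk$-basis of $R$. $\mathcal{E}(y)$ is the set of Bruhat-minimal elements of $\{u\in W:u\not\le y\}$. For $y\in W$, $I_y:=\Bbbk\text{-span of }\{S_u:u\in W,\ u\not\le y\}\subseteq\hat R$. For cosets, $uW_J\le wW_J$ means $u_{\min}\le w_{\min}$ where $w_{\min}$ is the representative of $wW_J$ in $W^J$; $I_{wW_J}:=\Bbbk\text{-span of }\{S_u:u\in W^J,\ uW_J\not\le wW_J\}\subseteq R$. The contraction of an ideal $\hat I$ of $\hat R$ is $\hat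 I\cap R$. *)

theory Defs
  imports
    "HOL-Analysis.Cartesian_Space"
    "HOL-Library.Poly_Mapping"
    "HOL-Algebra.QuotRing"
begin

text \<open>Groups of bijections under composition, with a distinguished generating set.
  Below, \<open>inv_into UNIV w\<close> is the inverse of \<open>w\<close>.\<close>

definition word_prod :: "('a \<Rightarrow> 'a) list \<Rightarrow> 'a \<Rightarrow> 'a" where
  "word_prod ss = foldr (\<circ>) ss id"

definition is_group_of_maps :: "('a \<Rightarrow> 'a) set \<Rightarrow> bool" where
  "is_group_of_maps W \<longleftrightarrow>
     id \<in> W \<and> (\<forall>u\<in>W. \<forall>v\<in>W. u \<circ> v \<in> W) \<and> (\<forall>u\<in>W. bij u \<and> inv_into UNIV u \<in> W)"

text \<open>The congruence on words generated by the relations \<open>(s t)\<^sup>m = 1\<close> with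
  \<open>m\<close> a multiple of the order of \<open>s t\<close>; the case \<open>s = t\<close> includes \<open>s s = 1\<close>.\<close>

inductive coxeter_equiv :: "('a \<Rightarrow> 'a) set \<Rightarrow> ('a \<Rightarrow> 'a) list \<Rightarrow> ('a \<Rightarrow> 'a) list \<Rightarrow> bool"
  for S :: "('a \<Rightarrow> 'a) set" where
  rel: "s \<in> S \<Longrightarrow> t \<in> S \<Longrightarrow> (s \<circ> t) ^^ m = id \<Longrightarrow>
          coxeter_equiv S (concat (replicate m [s, t])) []"
| refl: "coxeter_equiv S xs xs"
| sym: "coxeter_equiv S xs ys \<Longrightarrow> coxeter_equiv S ys xs"
| trans: "coxeter_equiv S xs ys \<Longrightarrow> coxeter_equiv S ys zs \<Longrightarrow> coxeter_equiv S xs zs"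
| append: "coxeter_equiv S xs ys \<Longrightarrow> coxeter_equiv S us vs \<Longrightarrow> coxeter_equiv S (xs @ us) (ys @ vs)"

definition coxeter_system :: "('a \<Rightarrow> 'a) set \<Rightarrow> ('a \<Rightarrow> 'a) set \<Rightarrow> bool" where
  "coxeter_system W S \<longleftrightarrow>
     is_group_of_maps W \<and>
     (\<forall>s\<in>S. s \<noteq> id \<and> s \<circ> s = id) \<and>
     W = word_prod ` lists S \<and>
     (\<forall>xs\<in>lists S. \<forall>ys\<in>lists S. word_prod xs = word_prod ys \<longrightarrow> coxeter_equiv S xs ys)"

definition cox_length :: "('a \<Rightarrow> 'a) set \<Rightarrow> ('a \<Rightarrow> 'a) \<Rightarrow> nat" where
  "cox_length S w = (LEAST n. \<exists>ss\<in>lists S. length ss = n \<and> word_prod ss = w)"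

definition is_reduced_word :: "('a \<Rightarrow> 'a) set \<Rightarrow> ('a \<Rightarrow> 'a) \<Rightarrow> ('a \<Rightarrow> 'a) list \<Rightarrow> bool" where
  "is_reduced_word S w ss \<longleftrightarrow>
     ss \<in> lists S \<and> word_prod ss = w \<and> length ss = cox_length S w"

definition bruhat_le ::
    "('a \<Rightarrow> 'a) set \<Rightarrow> ('a \<Rightarrow> 'a) set \<Rightarrow> ('a \<Rightarrow> 'a) \<Rightarrow> ('a \<Rightarrow> 'a) \<Rightarrow> bool" where
  "bruhat_le W S u v \<longleftrightarrow>
     (u, v) \<in> {(x, x \<circ> t) | x t. x \<in> W \<and>
                  (\<exists>g\<in>W. \<exists>s\<in>S. t = g \<circ> s \<circ> inv_into UNIV g) \<and>
                  cox_length S x < cox_length S (x \<circ> t)}\<^sup>*"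

definition descents :: "('a \<Rightarrow> 'a) set \<Rightarrow> ('a \<Rightarrow> 'a) \<Rightarrow> ('a \<Rightarrow> 'a) set" where
  "descents S u = {s \<in> S. cox_length S (u \<circ> s) < cox_length S u}"

definition longest_element :: "('a \<Rightarrow> 'a) set \<Rightarrow> ('a \<Rightarrow> 'a) set \<Rightarrow> 'a \<Rightarrow> 'a" where
  "longest_element W S = (THE w. w \<in> W \<and> (\<forall>u\<in>W. cox_length S u \<le> cox_length S w))"

text \<open>The subgroup generated by \<open>J\<close>; only used for sets of involutions, so that no
  inverses are needed.\<close>

definition parabolic :: "('a \<Rightarrow> 'a) set \<Rightarrow> ('a \<Rightarrow> 'a) set" where
  "parabolic J = word_prod ` lists J"

definition parabolic_coset :: "('a \<Rightarrow> 'a) set \<Rightarrow> ('a \<Rightarrow> 'a) \<Rightarrow> ('a \<Rightarrow> 'a) set" where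
  "parabolic_coset J w = {w \<circ> u | u. u \<in> parabolic J}"

definition min_reps ::
    "('a \<Rightarrow> 'a) set \<Rightarrow> ('a \<Rightarrow> 'a) set \<Rightarrow> ('a \<Rightarrow> 'a) set \<Rightarrow> ('a \<Rightarrow> 'a) set" where
  "min_reps W S J = {u \<in> W. descents S u \<inter> J = {}}"

definition coset_min ::
    "('a \<Rightarrow> 'a) set \<Rightarrow> ('a \<Rightarrow> 'a) set \<Rightarrow> ('a \<Rightarrow> 'a) set \<Rightarrow> ('a \<Rightarrow> 'a) set \<Rightarrow> 'a \<Rightarrow> 'a" where
  "coset_min W S J A = (THE u. u \<in> A \<and> u \<in> min_reps W S J)"

definition coset_max :: "('a \<Rightarrow> 'a) set \<Rightarrow> ('a \<Rightarrow> 'a) set \<Rightarrow> 'a \<Rightarrow> 'a" where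
  "coset_max S A = (THE u. u \<in> A \<and> (\<forall>v\<in>A. cox_length S v \<le> cox_length S u))"

definition coset_le ::
    "('a \<Rightarrow> 'a) set \<Rightarrow> ('a \<Rightarrow> 'a) set \<Rightarrow> ('a \<Rightarrow> 'a) set \<Rightarrow>
      ('a \<Rightarrow> 'a) set \<Rightarrow> ('a \<Rightarrow> 'a) set \<Rightarrow> bool" where
  "coset_le W S J A B \<longleftrightarrow> bruhat_le W S (coset_min W S J A) (coset_min W S J B)"

definition essential_set ::
    "('a \<Rightarrow> 'a) set \<Rightarrow> ('a \<Rightarrow> 'a) set \<Rightarrow> ('a \<Rightarrow> 'a) \<Rightarrow> ('a \<Rightarrow> 'a) set" where
  "essential_set W S y =
     {u \<in> W. \<not> bruhat_le W S u y \<and>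
        (\<forall>v\<in>W. \<not> bruhat_le W S v y \<and> bruhat_le W S v u \<longrightarrow> v = u)}"


text \<open>Reflection groups on \<open>V = k\<^sup>n\<close>. The field \<open>k\<close> is a type with an embedding \<open>\<iota>\<close> into the
  reals, through which all signs are read off. Elements of the dual space are linear maps
  \<open>V \<Rightarrow> k\<close>.\<close>

definition real_embedding :: "('k::field \<Rightarrow> real) \<Rightarrow> bool" where
  "real_embedding \<iota> \<longleftrightarrow>
     \<iota> 1 = 1 \<and> (\<forall>x y. \<iota> (x + y) = \<iota> x + \<iota> y) \<and> (\<forall>x y. \<iota> (x * y) = \<iota> x * \<iota> y)"

abbreviation linear_map :: "('k::field ^ 'n \<Rightarrow> 'k ^ 'n) \<Rightarrow> bool" where
  "linear_map \<equiv> Vector_Spaces.linear (*s) (*s)"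

abbreviation linear_functional :: "('k::field ^ 'n \<Rightarrow> 'k) \<Rightarrow> bool" where
  "linear_functional \<equiv> Vector_Spaces.linear (*s) (*)"

definition kernel_of :: "('k::field ^ 'n \<Rightarrow> 'k) \<Rightarrow> ('k ^ 'n) set" where
  "kernel_of \<alpha> = {v. \<alpha> v = 0}"

definition fixed_space :: "('v \<Rightarrow> 'v) \<Rightarrow> 'v set" where
  "fixed_space s = {v. s v = v}"

definition is_reflection :: "('k::field ^ 'n \<Rightarrow> 'k ^ 'n) \<Rightarrow> bool" where
  "is_reflection s \<longleftrightarrow>
     linear_map s \<and> s \<circ> s = id \<and>
     (\<exists>\<alpha>. linear_functional \<alpha> \<and> \<alpha> \<noteq> (\<lambda>_. 0) \<and> fixed_space s = kernel_of \<alpha>)"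

definition reflecting_hyperplanes ::
    "('k::field ^ 'n \<Rightarrow> 'k ^ 'n) set \<Rightarrow> ('k ^ 'n) set set" where
  "reflecting_hyperplanes W = {fixed_space s | s. s \<in> W \<and> is_reflection s}"

definition is_root_system ::
    "('k::field ^ 'n \<Rightarrow> 'k ^ 'n) set \<Rightarrow> ('k ^ 'n \<Rightarrow> 'k) set \<Rightarrow> bool" where
  "is_root_system W \<Phi> \<longleftrightarrow>
     (\<forall>\<alpha>\<in>\<Phi>. linear_functional \<alpha>) \<and>
     (\<forall>w\<in>W. \<forall>\<alpha>\<in>\<Phi>. \<alpha> \<circ> inv_into UNIV w \<in> \<Phi>) \<and>
     kernel_of ` \<Phi> = reflecting_hyperplanes W \<and>
     (\<forall>\<alpha>\<in>\<Phi>. {\<beta> \<in> \<Phi>. kernel_of \<beta> = kernel_of \<alpha>} = {\<alpha>, \<lambda>v. - \<alpha> v})"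

text \<open>A chamber is a class of points off all hyperplanes for the relation of lying on the same
  side of every hyperplane; over the reals these classes are the connected components of the
  complement. A hyperplane is a wall of a chamber if it contains a point which lies strictly
  on the same side as the chamber of every other hyperplane.\<close>

definition is_chamber ::
    "('k::field \<Rightarrow> real) \<Rightarrow> ('k ^ 'n \<Rightarrow> 'k) set \<Rightarrow> ('k ^ 'n) set \<Rightarrow> bool" where
  "is_chamber \<iota> \<Phi> C \<longleftrightarrow>
     (\<exists>p. (\<forall>\<alpha>\<in>\<Phi>. \<alpha> p \<noteq> 0) \<and> C = {v. \<forall>\<alpha>\<in>\<Phi>. 0 < \<iota> (\<alpha> v) * \<iota> (\<alpha> p)})"

definition is_wall ::
    "('k::field \<Rightarrow> real) \<Rightarrow> ('k ^ 'n \<Rightarrow> 'k) set \<Rightarrow> ('k ^ 'n) set \<Rightarrow> ('k ^ 'n) set \<Rightarrow> bool" where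
  "is_wall \<iota> \<Phi> C H \<longleftrightarrow>
     H \<in> kernel_of ` \<Phi> \<and>
     (\<exists>p\<in>H. \<forall>\<alpha>\<in>\<Phi>. kernel_of \<alpha> \<noteq> H \<longrightarrow> (\<forall>v\<in>C. 0 < \<iota> (\<alpha> v) * \<iota> (\<alpha> p)))"

definition positive_roots ::
    "('k::field \<Rightarrow> real) \<Rightarrow> ('k ^ 'n \<Rightarrow> 'k) set \<Rightarrow> ('k ^ 'n) set \<Rightarrow> ('k ^ 'n \<Rightarrow> 'k) set" where
  "positive_roots \<iota> \<Phi> C = {\<alpha> \<in> \<Phi>. \<forall>v\<in>C. 0 < \<iota> (\<alpha> v)}"

definition wall_reflections ::
    "('k::field \<Rightarrow> real) \<Rightarrow> ('k ^ 'n \<Rightarrow> 'k ^ 'n) set \<Rightarrow> ('k ^ 'n \<Rightarrow> 'k) set \<Rightarrow> ('k ^ 'n) set \<Rightarrow>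
      ('k ^ 'n \<Rightarrow> 'k ^ 'n) set" where
  "wall_reflections \<iota> W \<Phi> C = {s \<in> W. is_reflection s \<and> is_wall \<iota> \<Phi> C (fixed_space s)}"

text \<open>\<open>(W, S)\<close> is a finite Coxeter system, \<open>W\<close> acts faithfully on \<open>V\<close> (and is identified with its
  image), \<open>\<Phi>\<close> is a root system, \<open>C\<close> a chamber, \<open>P\<close> the positive roots, and \<open>S\<close> consists of the
  reflections in the walls of \<open>C\<close>.\<close>

definition reflection_datum ::
    "('k::field \<Rightarrow> real) \<Rightarrow> ('k ^ 'n \<Rightarrow> 'k ^ 'n) set \<Rightarrow> ('k ^ 'n \<Rightarrow> 'k ^ 'n) set \<Rightarrow>
      ('k ^ 'n \<Rightarrow> 'k) set \<Rightarrow> ('k ^ 'n) set \<Rightarrow> ('k ^ 'n \<Rightarrow> 'k) set \<Rightarrow> bool" where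
  "reflection_datum \<iota> W S \<Phi> C P \<longleftrightarrow>
     real_embedding \<iota> \<and>
     finite W \<and> coxeter_system W S \<and> (\<forall>w\<in>W. linear_map w) \<and>
     is_root_system W \<Phi> \<and> is_chamber \<iota> \<Phi> C \<and>
     P = positive_roots \<iota> \<Phi> C \<and> S = wall_reflections \<iota> W \<Phi> C"


text \<open>The symmetric algebra of the dual of \<open>V = k\<^sup>n\<close>, as the polynomial ring in the coordinate
  functions.\<close>

type_synonym ('k, 'n) sym = "('n \<Rightarrow>\<^sub>0 nat) \<Rightarrow>\<^sub>0 'k"

definition const :: "'k::field \<Rightarrow> ('k, 'n) sym" where
  "const c = Poly_Mapping.single 0 c"

definition coord :: "'n \<Rightarrow> ('k::field, 'n) sym" where
  "coord i = Poly_Mapping.single (Poly_Mapping.single i 1) 1"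

definition lin_form :: "('k::field ^ 'n \<Rightarrow> 'k) \<Rightarrow> ('k, 'n::finite) sym" where
  "lin_form \<alpha> = (\<Sum>i\<in>UNIV. const (\<alpha> (axis i 1)) * coord i)"

definition sym_subst ::
    "('n \<Rightarrow> ('k, 'n) sym) \<Rightarrow> ('k::field, 'n::finite) sym \<Rightarrow> ('k, 'n) sym" where
  "sym_subst \<sigma> f =
     (\<Sum>m\<in>Poly_Mapping.keys f.
        const (Poly_Mapping.lookup f m) * (\<Prod>i\<in>UNIV. \<sigma> i ^ Poly_Mapping.lookup m i))"

text \<open>\<open>(w f)(v) = f (w\<^sup>-\<^sup>1 v)\<close>, i.e. the algebra automorphism extending the action on the dual.\<close>

definition act ::
    "('k::field ^ 'n \<Rightarrow> 'k ^ 'n) \<Rightarrow> ('k, 'n::finite) sym \<Rightarrow> ('k, 'n) sym" where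
  "act w = sym_subst (\<lambda>i. lin_form (\<lambda>v. inv_into UNIV w v $ i))"

definition simple_root ::
    "('k::field ^ 'n \<Rightarrow> 'k) set \<Rightarrow> ('k ^ 'n \<Rightarrow> 'k ^ 'n) \<Rightarrow> 'k ^ 'n \<Rightarrow> 'k" where
  "simple_root P s = (THE \<alpha>. \<alpha> \<in> P \<and> kernel_of \<alpha> = fixed_space s)"

definition div_diff ::
    "('k::field ^ 'n \<Rightarrow> 'k) set \<Rightarrow> ('k ^ 'n \<Rightarrow> 'k ^ 'n) \<Rightarrow> ('k, 'n::finite) sym \<Rightarrow> ('k, 'n) sym" where
  "div_diff P s f = (THE g. lin_form (simple_root P s) * g = f - act s f)"

definition div_diff_elt ::
    "('k::field ^ 'n \<Rightarrow> 'k ^ 'n) set \<Rightarrow> ('k ^ 'n \<Rightarrow> 'k) set \<Rightarrow> ('k ^ 'n \<Rightarrow> 'k ^ 'n) \<Rightarrow>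
      ('k, 'n::finite) sym \<Rightarrow> ('k, 'n) sym" where
  "div_diff_elt S P u = foldr (div_diff P) (SOME ss. is_reduced_word S u ss)"

definition schubert_poly ::
    "('k::field ^ 'n \<Rightarrow> 'k ^ 'n) set \<Rightarrow> ('k ^ 'n \<Rightarrow> 'k ^ 'n) set \<Rightarrow> ('k ^ 'n \<Rightarrow> 'k) set \<Rightarrow>
      ('k ^ 'n \<Rightarrow> 'k ^ 'n) \<Rightarrow> ('k, 'n::finite) sym" where
  "schubert_poly W S P w =
     div_diff_elt S P (inv_into UNIV w \<circ> longest_element W S)
       (const (1 / of_nat (card W)) * (\<Prod>\<alpha>\<in>P. lin_form \<alpha>))"


definition sym_ring :: "('k::field, 'n) sym ring" where
  "sym_ring = \<lparr>carrier = UNIV, mult = (*), one = 1, zero = 0, add = (+)\<rparr>"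

definition pos_invariants ::
    "('k::field ^ 'n \<Rightarrow> 'k ^ 'n) set \<Rightarrow> ('k, 'n::finite) sym set" where
  "pos_invariants W = {f. (\<forall>w\<in>W. act w f = f) \<and> Poly_Mapping.lookup f 0 = 0}"

definition coinv_ideal ::
    "('k::field ^ 'n \<Rightarrow> 'k ^ 'n) set \<Rightarrow> ('k, 'n::finite) sym set" where
  "coinv_ideal W = Idl\<^bsub>sym_ring\<^esub> (pos_invariants W)"

definition coinv_ring ::
    "('k::field ^ 'n \<Rightarrow> 'k ^ 'n) set \<Rightarrow> ('k, 'n::finite) sym set ring" where
  "coinv_ring W = sym_ring Quot coinv_ideal W"

definition coinv_class ::
    "('k::field ^ 'n \<Rightarrow> 'k ^ 'n) set \<Rightarrow> ('k, 'n::finite) sym \<Rightarrow> ('k, 'n) sym set" where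
  "coinv_class W f = coinv_ideal W +>\<^bsub>sym_ring\<^esub> f"

text \<open>The induced action of \<open>w\<close> on the quotient sends a residue class \<open>X\<close> to its image
  \<open>act w ` X\<close>.\<close>

definition parabolic_coinv_ring ::
    "('k::field ^ 'n \<Rightarrow> 'k ^ 'n) set \<Rightarrow> ('k ^ 'n \<Rightarrow> 'k ^ 'n) set \<Rightarrow>
      ('k, 'n::finite) sym set ring" where
  "parabolic_coinv_ring W J =
     (coinv_ring W)\<lparr>carrier := {X \<in> carrier (coinv_ring W). \<forall>w\<in>parabolic J. act w ` X = X}\<rparr>"

definition schubert_class ::
    "('k::field ^ 'n \<Rightarrow> 'k ^ 'n) set \<Rightarrow> ('k ^ 'n \<Rightarrow> 'k ^ 'n) set \<Rightarrow> ('k ^ 'n \<Rightarrow> 'k) set \<Rightarrow>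
      ('k ^ 'n \<Rightarrow> 'k ^ 'n) \<Rightarrow> ('k, 'n::finite) sym set" where
  "schubert_class W S P w = coinv_class W (schubert_poly W S P w)"

text \<open>Only applied to finite sets \<open>A\<close>.\<close>

definition coinv_span ::
    "('k::field ^ 'n \<Rightarrow> 'k ^ 'n) set \<Rightarrow> ('k, 'n::finite) sym set set \<Rightarrow> ('k, 'n) sym set set" where
  "coinv_span W A =
     {\<Oplus>\<^bsub>coinv_ring W\<^esub>X\<in>A. coinv_class W (const (c X)) \<otimes>\<^bsub>coinv_ring W\<^esub> X | c. True}"

definition schubert_ideal ::
    "('k::field ^ 'n \<Rightarrow> 'k ^ 'n) set \<Rightarrow> ('k ^ 'n \<Rightarrow> 'k ^ 'n) set \<Rightarrow> ('k ^ 'n \<Rightarrow> 'k) set \<Rightarrow>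
      ('k ^ 'n \<Rightarrow> 'k ^ 'n) \<Rightarrow> ('k, 'n::finite) sym set set" where
  "schubert_ideal W S P y =
     coinv_span W (schubert_class W S P ` {u \<in> W. \<not> bruhat_le W S u y})"

definition coset_schubert_ideal ::
    "('k::field ^ 'n \<Rightarrow> 'k ^ 'n) set \<Rightarrow> ('k ^ 'n \<Rightarrow> 'k ^ 'n) set \<Rightarrow> ('k ^ 'n \<Rightarrow> 'k) set \<Rightarrow>
      ('k ^ 'n \<Rightarrow> 'k ^ 'n) set \<Rightarrow> ('k ^ 'n \<Rightarrow> 'k ^ 'n) set \<Rightarrow> ('k, 'n::finite) sym set set" where
  "coset_schubert_ideal W S P J A =
     coinv_span W (schubert_class W S P `
       {u \<in> min_reps W S J. \<not> coset_le W S J (parabolic_coset J u) A})"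

definition descent_generators ::
    "('k::field ^ 'n \<Rightarrow> 'k ^ 'n) set \<Rightarrow> ('k ^ 'n \<Rightarrow> 'k ^ 'n) set \<Rightarrow> ('k ^ 'n \<Rightarrow> 'k) set \<Rightarrow>
      ('k ^ 'n \<Rightarrow> 'k ^ 'n) \<Rightarrow> ('k, 'n::finite) sym set set" where
  "descent_generators W S P y =
     (\<Union>v\<in>essential_set W S y. schubert_class W S P `
        {u \<in> W. bruhat_le W S v u \<and> descents S u = descents S v})"

end

theory Submission
  imports Defs "HOL-Computational_Algebra.Polynomial" "HOL-Algebra.Subrings"
begin

text \<open>Let \<open>\<epsilon>\<close> be the constant term and \<open>\<partial>\<^sub>z\<close> the divided difference operator of \<open>z\<close>. The functionals
  \<open>\<epsilon> \<partial>\<^sub>z\<close> cut out the coinvariant ideal and are dual to the Schubert classes. By the Leibniz rule and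
  the lifting property of the Bruhat order, the condition \<open>\<epsilon> \<partial>\<^sub>z f = 0\<close> for all \<open>z \<le> y\<close> defines an
  ideal, namely the preimage of \<open>I\<^sub>y\<close>.

  By Deodhar's criterion, an element \<open>v\<close> of the essential set of \<open>y\<close> has exactly one descent \<open>s\<close>, so with
  \<open>K = S - {s}\<close> every \<open>u \<ge> v\<close> in \<open>W\<^sup>K\<close> has the same descents as \<open>v\<close>. A Leray--Hirsch argument for \<open>W\<^sub>K\<close> shows
  that these \<open>S\<^sub>u\<close> generate the ideal spanned by all \<open>S\<^sub>z\<close> with \<open>z \<ge> v\<close>. Averaging over \<open>W\<^sub>J\<close> carries
  generation over to the invariant subring.\<close>


subsection \<open>Polynomials as functions\<close>

text \<open>All computations take place in the polynomial ring: ideals of the two quotients are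
  replaced by their preimages, and membership in a Schubert span becomes vanishing of the
  functionals \<open>eps (E z f)\<close>. Two obstacles stand before this. First, \<open>E z\<close>
  is defined through an arbitrarily chosen reduced word. Operators of two reduced words agree
  because they have the same commutators with linear forms and agree on constants. Second, duality
  needs the functional of the longest element to be nonzero on the product of the positive roots.
  All other functionals vanish there by degree, so it suffices that this product lies outside the
  coinvariant ideal; antisymmetrization detects that. The generators share their descents with
  essential elements, which lie in \<open>min_reps W S J\<close>. Hence their classes already lie in
  the invariant subring, and generation of the ideal by its contraction follows at once. Generation
  inside the subring is the harder half: coefficients from the big ring must be replaced by
  invariant ones. Averaging is linear over invariants, so it averages the coefficients and fixes the
  generators.\<close>

definition ev :: "('k::field, 'n::finite) sym \<Rightarrow> 'k ^ 'n \<Rightarrow> 'k" where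
  "ev f v = (\<Sum>m\<in>Poly_Mapping.keys f.
     Poly_Mapping.lookup f m * (\<Prod>i\<in>UNIV. (v $ i) ^ Poly_Mapping.lookup m i))"

lemma ev_superset:
  assumes "finite A" "Poly_Mapping.keys f \<subseteq> A"
  shows "ev f v = (\<Sum>m\<in>A. Poly_Mapping.lookup f m * (\<Prod>i\<in>UNIV. (v $ i) ^ Poly_Mapping.lookup m i))"
  unfolding ev_def
  by (rule sum.mono_neutral_left) (use assms in \<open>auto simp: in_keys_iff\<close>)

lemma ev_zero [simp]: "ev 0 v = 0"
  by (simp add: ev_def)

lemma ev_add [simp]: "ev (f + g) v = ev f v + ev g v"
proof -
  let ?A = "Poly_Mapping.keys f \<union> Poly_Mapping.keys g"
  have "ev h v = (\<Sum>m\<in>?A. Poly_Mapping.lookup h m * (\<Prod>i\<in>UNIV. (v $ i) ^ Poly_Mapping.lookup m i))"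
    if "h \<in> {f, g, f + g}" for h
    by (rule ev_superset) (use that Poly_Mapping.keys_add[of f g] in auto)
  then show ?thesis
    by (simp add: lookup_add algebra_simps sum.distrib)
qed

lemma ev_uminus [simp]: "ev (- f) v = - ev f v"
  using ev_add[of f "- f" v] by (simp add: eq_neg_iff_add_eq_0 add.commute)

lemma ev_diff [simp]: "ev (f - g) v = ev f v - ev g v"
  using ev_add[of f "- g" v] by simp

lemma ev_single: "ev (Poly_Mapping.single m c) v = c * (\<Prod>i\<in>UNIV. (v $ i) ^ Poly_Mapping.lookup m i)"
  by (subst ev_superset[of "{m}"]) auto

lemma ev_const [simp]: "ev (const c) v = c"
  by (simp add: const_def ev_single)

lemma ev_one [simp]: "ev 1 v = 1"
  using ev_single[of 0 1 v] by simp

lemma ev_coord [simp]: "ev (coord i) v = v $ i"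
proof -
  have "(\<Prod>j\<in>UNIV. (v $ j) ^ Poly_Mapping.lookup (Poly_Mapping.single i (1::nat)) j)
      = (\<Prod>j\<in>UNIV. if j = i then v $ i else 1)"
    by (rule prod.cong) (auto simp: lookup_single when_def)
  then show ?thesis
    by (simp add: coord_def ev_single)
qed

lemma single_sum_decomp: "f = (\<Sum>m\<in>Poly_Mapping.keys f. Poly_Mapping.single m (Poly_Mapping.lookup f m))"
  by (rule poly_mapping_eqI) (auto simp: lookup_sum lookup_single when_def sum.delta in_keys_iff)

text \<open>Monomials are reached by induction on total degree, one variable at a time, so an
  operator identity need only be tested on constants and carried through sums and multiplication by
  a coordinate.\<close>

lemma sym_induct [case_names const add coord]:
  fixes f :: "('k::field, 'n::finite) sym"
  assumes const: "\<And>c. Q (const c)"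
    and add: "\<And>f g. Q f \<Longrightarrow> Q g \<Longrightarrow> Q (f + g)"
    and coord: "\<And>i f. Q f \<Longrightarrow> Q (coord i * f)"
  shows "Q f"
proof -
  have single: "Q (Poly_Mapping.single m c)" for m c
  proof (induction "\<Sum>i\<in>UNIV. Poly_Mapping.lookup m i" arbitrary: m)
    case 0
    then have "m = 0"
      by (intro poly_mapping_eqI) auto
    then show ?case
      using const by (simp add: const_def)
  next
    case (Suc n)
    then obtain i where i: "Poly_Mapping.lookup m i \<noteq> 0"
      by (metis nat.distinct(1) sum.neutral)
    define m' where "m' = m - Poly_Mapping.single i 1"
    have m: "m = Poly_Mapping.single i 1 + m'"
      unfolding m'_def using i
      by (intro poly_mapping_eqI) (auto simp: lookup_add lookup_minus lookup_single when_def)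
    have "(\<Sum>j\<in>UNIV. Poly_Mapping.lookup (Poly_Mapping.single i (1::nat)) j) = 1"
      by (simp add: lookup_single when_def)
    then have "n = (\<Sum>j\<in>UNIV. Poly_Mapping.lookup m' j)"
      using Suc(2) by (simp add: m lookup_add sum.distrib)
    from coord[OF Suc(1)[OF this], of i] show ?case
      by (simp add: coord_def mult_single m)
  qed
  have "Q (\<Sum>m\<in>A. Poly_Mapping.single m (Poly_Mapping.lookup f m))" if "finite A" for A
    using that
  proof induction
    case empty
    show ?case using const[of 0] by (simp add: const_def)
  next
    case (insert x F)
    then show ?case using add single by simp
  qed
  from this[OF finite_keys[of f]] show ?thesis
    unfolding single_sum_decomp[of f, symmetric] .
qed

lemma ev_single_mult:
  fixes g :: "('k::field, 'n::finite) sym"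
  shows "ev (Poly_Mapping.single m c * g) v = ev (Poly_Mapping.single m c) v * ev g v"
proof -
  have "ev (Poly_Mapping.single m c * (\<Sum>n\<in>A. Poly_Mapping.single n (Poly_Mapping.lookup g n))) v
     = ev (Poly_Mapping.single m c) v * ev (\<Sum>n\<in>A. Poly_Mapping.single n (Poly_Mapping.lookup g n)) v"
    if "finite A" for A
    using that
  proof induction
    case (insert n A)
    then show ?case
      by (simp add: distrib_left mult_single) (simp add: ev_single lookup_add power_add prod.distrib)
  qed simp
  from this[OF finite_keys[of g]] show ?thesis
    unfolding single_sum_decomp[of g, symmetric] .
qed

lemma ev_mult [simp]:
  fixes f g :: "('k::field, 'n::finite) sym"
  shows "ev (f * g) v = ev f v * ev g v"
proof (induction f rule: sym_induct)
  case (const c)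
  show ?case by (simp only: const_def ev_single_mult)
next
  case (add f h)
  then show ?case by (simp add: distrib_right)
next
  case (coord i f)
  have "ev (coord i * h) v = ev (coord i) v * ev h v" for h :: "('k, 'n) sym"
    by (simp only: coord_def ev_single_mult)
  with coord show ?case by (simp add: mult.assoc)
qed

lemma ev_sum [simp]: "ev (\<Sum>x\<in>A. f x) v = (\<Sum>x\<in>A. ev (f x) v)"
  by (induction A rule: infinite_finite_induct) auto

lemma ev_prod [simp]: "ev (\<Prod>x\<in>A. f x) v = (\<Prod>x\<in>A. ev (f x) v)"
  by (induction A rule: infinite_finite_induct) auto

lemma ev_power [simp]: "ev (f ^ n) v = ev f v ^ n"
  by (induction n) auto

lemma ev_of_nat [simp]: "ev (of_nat n) v = of_nat n"
  by (induction n) auto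

text \<open>Since \<open>0 ^ 0 = 1\<close>, the empty monomial survives at the origin and every
  other one vanishes.\<close>

lemma ev_at_0: "ev f 0 = Poly_Mapping.lookup f 0"
proof -
  have *: "(\<Prod>i\<in>UNIV. (0 $ i :: 'a) ^ Poly_Mapping.lookup m i) = (if m = 0 then 1 else 0)" for m :: "'b \<Rightarrow>\<^sub>0 nat"
  proof (cases "m = 0")
    case False
    then obtain i where "Poly_Mapping.lookup m i \<noteq> 0"
      by (metis lookup_zero poly_mapping_eqI)
    then have "(0 $ i :: 'a) ^ Poly_Mapping.lookup m i = 0"
      by simp
    with False show ?thesis by (metis UNIV_I finite_class.finite_UNIV prod_zero)
  qed simp
  show ?thesis
    unfolding ev_def * by (simp add: if_distrib sum.delta in_keys_iff cong: if_cong)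
qed

section \<open>Linear functionals and substitution of linear maps\<close>

lemma functional_linear:
  fixes \<xi> :: "'k::field ^ 'n::finite \<Rightarrow> 'k"
  assumes "linear_functional \<xi>"
  shows "\<xi> (x + y) = \<xi> x + \<xi> y" "\<xi> (x - y) = \<xi> x - \<xi> y" "\<xi> (c *s x) = c * \<xi> x" "\<xi> 0 = 0"
proof -
  interpret w: Vector_Spaces.linear "(*s)" "(*)" \<xi> by fact
  show "\<xi> (x + y) = \<xi> x + \<xi> y" "\<xi> (x - y) = \<xi> x - \<xi> y" "\<xi> (c *s x) = c * \<xi> x" "\<xi> 0 = 0"
    by (auto simp: w.add w.diff w.scale w.zero)
qed

lemma linear_functional_expand:
  fixes \<alpha> :: "'k::field ^ 'n::finite \<Rightarrow> 'k"
  assumes "linear_functional \<alpha>"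
  shows "(\<Sum>i\<in>UNIV. \<alpha> (axis i 1) * v $ i) = \<alpha> v"
proof -
  interpret a: Vector_Spaces.linear "(*s)" "(*)" \<alpha> by fact
  have "\<alpha> v = \<alpha> (\<Sum>i\<in>UNIV. v $ i *s axis i 1)"
    by (simp add: basis_expansion)
  also have "\<dots> = (\<Sum>i\<in>UNIV. v $ i * \<alpha> (axis i 1))"
    by (simp add: a.sum a.scale)
  finally show ?thesis by (simp add: mult.commute)
qed

lemma ev_lin_form [simp]: "linear_functional \<alpha> \<Longrightarrow> ev (lin_form \<alpha>) v = \<alpha> v"
  by (simp add: lin_form_def linear_functional_expand)

lemma coord_eq_lin_form: "coord i = (lin_form (\<lambda>v. v $ i) :: ('k::field, 'n::finite) sym)"
proof -
  have "(lin_form (\<lambda>v. v $ i) :: ('k, 'n) sym) = (\<Sum>j\<in>UNIV. if j = i then coord i else 0)"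
    unfolding lin_form_def by (rule sum.cong) (auto simp: axis_def const_def)
  then show ?thesis by simp
qed

lemma coord_linear: "linear_functional (\<lambda>v :: 'k::field ^ 'n::finite. v $ i)"
  by unfold_locales (auto simp: algebra_simps)

lemma linear_component:
  assumes "linear_map L"
  shows "linear_functional (\<lambda>v. L v $ i)"
proof -
  interpret L: Vector_Spaces.linear "(*s)" "(*s)" L by fact
  show ?thesis
    by unfold_locales (auto simp: L.add L.scale algebra_simps)
qed

definition pullback :: "('k::field ^ 'n \<Rightarrow> 'k ^ 'n) \<Rightarrow> ('k, 'n::finite) sym \<Rightarrow> ('k, 'n) sym" where
  "pullback L = sym_subst (\<lambda>i. lin_form (\<lambda>v. L v $ i))"

lemma ev_pullback:
  assumes "linear_map L"
  shows "ev (pullback L f) v = ev f (L v)"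
  by (simp add: pullback_def sym_subst_def ev_lin_form[OF linear_component[OF assms]] ev_def[of f])

lemma act_eq_pullback: "act w = pullback (inv_into UNIV w)"
  by (simp add: act_def pullback_def)

text \<open>Substituting \<open>t ^ d i\<close> for the \<open>i\<close>-th variable with such weights \<open>d\<close> keeps the monomials of a
  polynomial apart, so that a polynomial vanishing everywhere is reduced to a univariate one.\<close>

lemma separating_weights:
  fixes M :: "('n::finite \<Rightarrow> nat) set"
  assumes "finite M" "finite A"
  shows "\<exists>d. \<forall>m\<in>M. \<forall>m'\<in>M. (\<Sum>i\<in>A. m i * d i) = (\<Sum>i\<in>A. m' i * d i) \<longrightarrow> (\<forall>i\<in>A. m i = m' i)"
  using assms(2)
proof induction
  case (insert a A)
  then obtain d where d: "\<And>m m'. m \<in> M \<Longrightarrow> m' \<in> M \<Longrightarrow>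
      (\<Sum>i\<in>A. m i * d i) = (\<Sum>i\<in>A. m' i * d i) \<Longrightarrow> (\<forall>i\<in>A. m i = m' i)"
    by blast
  \<comment> \<open>\<open>B\<close> exceeds all weighted sums over \<open>A\<close>, so with weight
    \<open>B\<close> for the new index a total is a number in base \<open>B\<close>: division and
    remainder recover the new exponent and the old sum.\<close>
  define B where "B = Suc (\<Sum>m\<in>M. \<Sum>i\<in>A. m i * d i)"
  have B: "(\<Sum>i\<in>A. m i * d i) < B" if "m \<in> M" for m
    unfolding B_def using that assms(1)
    by (metis (no_types, lifting) le_imp_less_Suc member_le_sum zero_le)
  define d' where "d' = d(a := B)"
  have d': "(\<Sum>i\<in>insert a A. m i * d' i) = m a * B + (\<Sum>i\<in>A. m i * d i)" for m
  proof -
    have "(\<Sum>i\<in>A. m i * d' i) = (\<Sum>i\<in>A. m i * d i)"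
      by (rule sum.cong) (use insert in \<open>auto simp: d'_def\<close>)
    then show ?thesis using insert by (simp add: d'_def)
  qed
  have "\<forall>i\<in>insert a A. m i = m' i"
    if m: "m \<in> M" "m' \<in> M" and eq: "(\<Sum>i\<in>insert a A. m i * d' i) = (\<Sum>i\<in>insert a A. m' i * d' i)" for m m'
  proof -
    from eq have eq: "m a * B + (\<Sum>i\<in>A. m i * d i) = m' a * B + (\<Sum>i\<in>A. m' i * d i)"
      by (simp only: d')
    have "(m a * B + (\<Sum>i\<in>A. m i * d i)) div B = m a" "(m a * B + (\<Sum>i\<in>A. m i * d i)) mod B = (\<Sum>i\<in>A. m i * d i)"
        "(m' a * B + (\<Sum>i\<in>A. m' i * d i)) div B = m' a" "(m' a * B + (\<Sum>i\<in>A. m' i * d i)) mod B = (\<Sum>i\<in>A. m' i * d i)"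
      using B[OF m(1)] B[OF m(2)] by auto
    with eq d[OF m] show ?thesis by auto
  qed
  then show ?case by blast
qed simp

lemma ev_eq_0_imp_eq_0:
  fixes f :: "('k::field, 'n::finite) sym"
  assumes inf: "infinite (UNIV :: 'k set)" and 0: "\<And>v. ev f v = 0"
  shows "f = 0"
proof (rule ccontr)
  assume "f \<noteq> 0"
  then obtain m0 where m0: "m0 \<in> Poly_Mapping.keys f"
    by (metis in_keys_iff lookup_zero poly_mapping_eqI)
  obtain d where d: "\<forall>m\<in>Poly_Mapping.lookup ` Poly_Mapping.keys f. \<forall>m'\<in>Poly_Mapping.lookup ` Poly_Mapping.keys f.
     (\<Sum>i\<in>UNIV. m i * d i) = (\<Sum>i\<in>UNIV. m' i * d i) \<longrightarrow> (\<forall>i\<in>UNIV. m i = m' i)"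
    using separating_weights[of "Poly_Mapping.lookup ` Poly_Mapping.keys f" UNIV] by auto
  define \<phi> where "\<phi> m = (\<Sum>i\<in>UNIV. Poly_Mapping.lookup m i * d i)" for m
  have inj: "m = m'" if "m \<in> Poly_Mapping.keys f" "m' \<in> Poly_Mapping.keys f" "\<phi> m = \<phi> m'" for m m'
  proof (rule poly_mapping_eqI)
    show "Poly_Mapping.lookup m i = Poly_Mapping.lookup m' i" for i
      using d[rule_format, OF imageI[OF that(1)] imageI[OF that(2)]] that(3) by (simp add: \<phi>_def)
  qed
  \<comment> \<open>This is \<open>f\<close> restricted to the curve with coordinates
    \<open>t ^ d i\<close>. Distinct monomials give distinct powers of \<open>t\<close>, so the
    coefficients of \<open>p\<close> are those of \<open>f\<close>.\<close>
  define p where "p = (\<Sum>m\<in>Poly_Mapping.keys f. Polynomial.monom (Poly_Mapping.lookup f m) (\<phi> m))"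
  have "poly p t = ev f (\<chi> i. t ^ d i)" for t
    unfolding p_def Polynomial.poly_sum Polynomial.poly_monom ev_def \<phi>_def
    by (simp add: power_sum flip: power_mult) (simp add: mult.commute)
  then have "poly p t = 0" for t
    using 0 by simp
  then have "p = 0"
    using poly_roots_finite[of p] inf by auto
  then have "Polynomial.coeff p (\<phi> m0) = 0" by simp
  moreover have "Polynomial.coeff p (\<phi> m0) = (\<Sum>m\<in>Poly_Mapping.keys f. if m = m0 then Poly_Mapping.lookup f m0 else 0)"
    unfolding p_def Polynomial.coeff_sum by (rule sum.cong) (use inj m0 in auto)
  ultimately show False
    using m0 by (simp add: in_keys_iff)
qed

lemma ev_eqI:
  fixes f g :: "('k::field, 'n::finite) sym"
  assumes "infinite (UNIV :: 'k set)" "\<And>v. ev f v = ev g v"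
  shows "f = g"
  using ev_eq_0_imp_eq_0[of "f - g"] assms by simp

section \<open>Restriction to lines and divisibility by linear forms\<close>

lemma ev_line_poly: "\<exists>p. \<forall>t. ev f (v + t *s q) = poly p t"
proof (induction f rule: sym_induct)
  case (const c)
  show ?case by (rule exI[of _ "[:c:]"]) simp
next
  case (add f g)
  then show ?case by (metis ev_add poly_add)
next
  case (coord i f)
  then obtain p where "\<forall>t. ev f (v + t *s q) = poly p t" by blast
  then show ?case by (intro exI[of _ "[:v $ i, q $ i:] * p"]) (simp add: algebra_simps)
qed

text \<open>An algebraic substitute for continuity: on a line the polynomial is univariate, and
  vanishing at all but one parameter gives infinitely many roots.\<close>

lemma ev_eq_0_line:
  fixes f :: "('k::field, 'n::finite) sym"
  assumes inf: "infinite (UNIV :: 'k set)" and 0: "\<And>t. t \<noteq> 0 \<Longrightarrow> ev f (v + t *s q) = 0"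
  shows "ev f v = 0"
proof -
  obtain p where p: "\<And>t. ev f (v + t *s q) = poly p t"
    using ev_line_poly by blast
  have "UNIV - {0} \<subseteq> {t. poly p t = 0}"
    using 0 p by auto
  then have "p = 0"
    using inf poly_roots_finite[of p] infinite_super by (metis finite.emptyI finite_insert finite_Diff2)
  then show ?thesis using p[of 0] by simp
qed

text \<open>This serves twice: with a reflection as \<open>L\<close> it gives divided differences,
  with a projection onto the kernel of \<alpha> it gives division by \<alpha>.\<close>

lemma lin_form_dvd_diff_pullback:
  fixes f :: "('k::field, 'n::finite) sym"
  assumes inf: "infinite (UNIV :: 'k set)" and a: "linear_functional \<alpha>" and L: "linear_map L"
    and Lv: "\<And>v. L v = v - \<alpha> v *s b"
  shows "\<exists>g. lin_form \<alpha> * g = f - pullback L f"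
proof (induction f rule: sym_induct)
  case (const c)
  show ?case
    by (rule exI[of _ 0]) (simp add: ev_eqI[OF inf] ev_pullback[OF L])
next
  case (add f g)
  then obtain f' g' where "lin_form \<alpha> * f' = f - pullback L f" "lin_form \<alpha> * g' = g - pullback L g"
    by blast
  then have "lin_form \<alpha> * (f' + g') = f + g - pullback L (f + g)"
    by (simp add: distrib_left) (auto intro!: ev_eqI[OF inf] simp: ev_pullback[OF L])
  then show ?case by blast
next
  case (coord i f)
  then obtain f' where f': "lin_form \<alpha> * f' = f - pullback L f" by blast
  have "\<alpha> v * ev f' v = ev f v - ev f (L v)" for v
    using arg_cong[OF f', of "\<lambda>f. ev f v"] by (simp add: a ev_pullback[OF L])
  then have "v $ i * (\<alpha> v * ev f' v) = v $ i * (ev f v - ev f (L v))" for v by simp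
  \<comment> \<open>The witness comes from splitting the difference as
    \<open>coord i * (f - pullback L f)\<close> plus
    \<open>(coord i - pullback L (coord i)) * pullback L f\<close>, where the last bracket is
    \<open>b $ i\<close> times \<alpha>.\<close>
  then have "lin_form \<alpha> * (coord i * f' + const (b $ i) * pullback L f) = coord i * f - pullback L (coord i * f)"
    by (intro ev_eqI[OF inf]) (simp add: a ev_pullback[OF L] Lv algebra_simps)
  then show ?case by blast
qed

text \<open>Off the kernel of \<alpha> one divides values. A point of the kernel is reached along a
  line leaving the kernel.\<close>

lemma lin_form_cancel:
  fixes f :: "('k::field, 'n::finite) sym"
  assumes inf: "infinite (UNIV :: 'k set)" and a: "linear_functional \<alpha>" and nz: "\<alpha> \<noteq> (\<lambda>_. 0)"
    and eq: "lin_form \<alpha> * f = lin_form \<alpha> * g"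
  shows "f = g"
proof -
  interpret a: Vector_Spaces.linear "(*s)" "(*)" \<alpha> by fact
  obtain q where q: "\<alpha> q \<noteq> 0" using nz by auto
  have off: "ev (f - g) v = 0" if "\<alpha> v \<noteq> 0" for v
    using arg_cong[OF eq, of "\<lambda>f. ev f v"] that by (simp add: a)
  have "ev (f - g) v = 0" for v
  proof (cases "\<alpha> v = 0")
    case True
    show ?thesis
      by (rule ev_eq_0_line[OF inf, of _ _ q]) (rule off, simp add: a.add a.scale True q)
  qed (rule off)
  then have "f - g = 0"
    by (rule ev_eq_0_imp_eq_0[OF inf])
  then show ?thesis by simp
qed

text \<open>Projecting along a vector \<open>b\<close> with \<open>\<alpha> b = 1\<close> lands in
  the kernel, where \<open>f\<close> vanishes. So the pullback of \<open>f\<close> is zero and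
  \<open>f\<close> equals its difference from that pullback.\<close>

lemma lin_form_dvd:
  fixes f :: "('k::field, 'n::finite) sym"
  assumes inf: "infinite (UNIV :: 'k set)" and a: "linear_functional \<alpha>" and nz: "\<alpha> \<noteq> (\<lambda>_. 0)"
    and 0: "\<And>v. \<alpha> v = 0 \<Longrightarrow> ev f v = 0"
  shows "\<exists>g. f = lin_form \<alpha> * g"
proof -
  interpret a: Vector_Spaces.linear "(*s)" "(*)" \<alpha> by fact
  obtain q where q: "\<alpha> q \<noteq> 0" using nz by auto
  define b where "b = inverse (\<alpha> q) *s q"
  have b: "\<alpha> b = 1" using q by (simp add: b_def a.scale)
  define L where "L v = v - \<alpha> v *s b" for v
  have L: "linear_map L"
    by unfold_locales (auto simp: L_def a.add a.scale algebra_simps vec_eq_iff)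
  obtain g where g: "lin_form \<alpha> * g = f - pullback L f"
    using lin_form_dvd_diff_pullback[OF inf a L L_def] by blast
  have "\<alpha> (L v) = 0" for v
    by (simp add: L_def a.diff a.scale b)
  then have "pullback L f = 0"
    by (intro ev_eqI[OF inf]) (simp add: ev_pullback[OF L] 0)
  with g show ?thesis by auto
qed

subsection \<open>Roots and reflections\<close>

abbreviation iv :: "('a \<Rightarrow> 'a) \<Rightarrow> 'a \<Rightarrow> 'a" where
  "iv w \<equiv> inv_into UNIV w"

lemma word_prod_Nil [simp]: "word_prod [] = id"
  by (simp add: word_prod_def)

lemma word_prod_Cons [simp]: "word_prod (s # ss) = s \<circ> word_prod ss"
  by (simp add: word_prod_def)

lemma word_prod_append [simp]: "word_prod (us @ vs) = word_prod us \<circ> word_prod vs"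
  by (induction us) (auto simp: comp_assoc)

locale reflection_group =
  fixes \<iota> :: "'k::field \<Rightarrow> real"
    and W S :: "('k ^ 'n::finite \<Rightarrow> 'k ^ 'n) set"
    and \<Phi> :: "('k ^ 'n \<Rightarrow> 'k) set"
    and C :: "('k ^ 'n) set"
    and P :: "('k ^ 'n \<Rightarrow> 'k) set"
  assumes datum: "reflection_datum \<iota> W S \<Phi> C P"
begin

abbreviation len :: "('k ^ 'n \<Rightarrow> 'k ^ 'n) \<Rightarrow> nat" where
  "len \<equiv> cox_length S"

abbreviation ble (infix \<open>\<preceq>\<close> 50) where
  "u \<preceq> v \<equiv> bruhat_le W S u v"

lemma embedding: "real_embedding \<iota>" and finite_W [simp]: "finite W"
  and cox: "coxeter_system W S" and W_linear: "w \<in> W \<Longrightarrow> linear_map w"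
  and roots: "is_root_system W \<Phi>" and chamber: "is_chamber \<iota> \<Phi> C"
  and P_eq: "P = positive_roots \<iota> \<Phi> C" and S_eq: "S = wall_reflections \<iota> W \<Phi> C"
  using datum by (auto simp: reflection_datum_def)

lemma iota_add: "\<iota> (x + y) = \<iota> x + \<iota> y" and iota_mult: "\<iota> (x * y) = \<iota> x * \<iota> y" and iota_1: "\<iota> 1 = 1"
  using embedding by (auto simp: real_embedding_def)

lemma iota_0 [simp]: "\<iota> 0 = 0"
  using iota_add[of 0 0] by simp

lemma iota_uminus [simp]: "\<iota> (- x) = - \<iota> x"
  using iota_add[of x "- x"] by simp

lemma iota_eq_0_iff [simp]: "\<iota> x = 0 \<longleftrightarrow> x = 0"
  using iota_mult[of x "inverse x"] iota_1 by (cases "x = 0") auto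

lemma iota_of_nat: "\<iota> (of_nat n) = real n"
  by (induction n) (auto simp: iota_add iota_1)

lemma of_nat_eq_iff' [simp]: "(of_nat m :: 'k) = of_nat n \<longleftrightarrow> m = n"
  by (metis iota_of_nat of_nat_eq_iff)

text \<open>The embedding into the reals forces characteristic zero; an infinite field is what
  allows polynomials to be compared by their values.\<close>

lemma infinite_k: "infinite (UNIV :: 'k set)"
proof
  assume "finite (UNIV :: 'k set)"
  then have "finite (range (of_nat :: nat \<Rightarrow> 'k))" by (rule rev_finite_subset) auto
  moreover have "inj (of_nat :: nat \<Rightarrow> 'k)" by (auto simp: inj_def)
  ultimately show False using finite_imageD by blast
qed

lemma id_in_W [simp]: "id \<in> W" and comp_in_W [simp]: "u \<in> W \<Longrightarrow> v \<in> W \<Longrightarrow> u \<circ> v \<in> W"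
  and iv_in_W [simp]: "u \<in> W \<Longrightarrow> iv u \<in> W" and W_bij: "u \<in> W \<Longrightarrow> bij u"
proof -
  have "is_group_of_maps W"
    using cox unfolding coxeter_system_def by blast
  then show "id \<in> W" "u \<in> W \<Longrightarrow> v \<in> W \<Longrightarrow> u \<circ> v \<in> W" "u \<in> W \<Longrightarrow> iv u \<in> W" "u \<in> W \<Longrightarrow> bij u"
    by (auto simp: is_group_of_maps_def)
qed

lemma iv_apply [simp]: "w \<in> W \<Longrightarrow> iv w (w x) = x" and apply_iv [simp]: "w \<in> W \<Longrightarrow> w (iv w x) = x"
  using W_bij[of w] by (auto simp: bij_def inj_def inv_f_f surj_f_inv_f)

lemma iv_o [simp]: "w \<in> W \<Longrightarrow> iv w \<circ> w = id" and o_iv [simp]: "w \<in> W \<Longrightarrow> w \<circ> iv w = id"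
  by auto

lemma iv_iv [simp]: "w \<in> W \<Longrightarrow> iv (iv w) = w"
  by (simp add: W_bij inv_inv_eq)

lemma iv_comp: "u \<in> W \<Longrightarrow> v \<in> W \<Longrightarrow> iv (u \<circ> v) = iv v \<circ> iv u"
  by (simp add: W_bij o_inv_distrib)

lemma iv_eqI: "w \<in> W \<Longrightarrow> w \<circ> u = id \<Longrightarrow> iv w = u"
  by (metis comp_assoc comp_id id_comp iv_o)

lemma comp_cancel_left: "w \<in> W \<Longrightarrow> w \<circ> u = w \<circ> v \<longleftrightarrow> u = v"
  by (metis comp_assoc id_comp iv_o)

lemma comp_cancel_right: "w \<in> W \<Longrightarrow> u \<circ> w = v \<circ> w \<longleftrightarrow> u = v"
  by (metis comp_assoc comp_id o_iv)

lemma simple_in_W [simp]: "s \<in> S \<Longrightarrow> s \<in> W"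
  unfolding S_eq wall_reflections_def by blast

lemma simple_refl: "s \<in> S \<Longrightarrow> is_reflection s"
  unfolding S_eq wall_reflections_def by blast

lemma simple_invol [simp]: "s \<in> S \<Longrightarrow> s \<circ> s = id"
  using cox unfolding coxeter_system_def by blast

lemma simple_simple [simp]: "s \<in> S \<Longrightarrow> s (s v) = v"
  by (metis comp_apply id_apply simple_invol)

lemma simple_neq_id: "s \<in> S \<Longrightarrow> s \<noteq> id"
  using cox unfolding coxeter_system_def by blast

lemma comp_simple_simple [simp]: "s \<in> S \<Longrightarrow> u \<circ> s \<circ> s = u"
  by (simp add: comp_assoc)

lemma simple_comp_simple [simp]: "s \<in> S \<Longrightarrow> s \<circ> (s \<circ> u) = u"
  by (simp flip: comp_assoc)

lemma iv_simple [simp]: "s \<in> S \<Longrightarrow> iv s = s"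
  by (simp add: iv_eqI)

lemma W_words: "W = word_prod ` lists S"
  using cox unfolding coxeter_system_def by blast

lemma word_prod_in_W [simp]: "ss \<in> lists S \<Longrightarrow> word_prod ss \<in> W"
  by (simp add: W_words)

lemma W_apply_linear:
  assumes "w \<in> W"
  shows "w (x + y) = w x + w y" "w (x - y) = w x - w y" "w (c *s x) = c *s w x"
proof -
  interpret w: Vector_Spaces.linear "(*s)" "(*s)" w using assms by (rule W_linear)
  show "w (x + y) = w x + w y" "w (x - y) = w x - w y" "w (c *s x) = c *s w x"
    by (auto simp: w.add w.diff w.scale)
qed

lemma root_linear: "\<alpha> \<in> \<Phi> \<Longrightarrow> linear_functional \<alpha>"
  using roots unfolding is_root_system_def by (elim conjE) (erule bspec)

lemmas root_apply_linear = functional_linear[OF root_linear]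

lemma root_iv [simp]: "w \<in> W \<Longrightarrow> \<alpha> \<in> \<Phi> \<Longrightarrow> \<alpha> \<circ> iv w \<in> \<Phi>"
  using roots unfolding is_root_system_def by blast

lemma root_o [simp]: "w \<in> W \<Longrightarrow> \<alpha> \<in> \<Phi> \<Longrightarrow> \<alpha> \<circ> w \<in> \<Phi>"
  using root_iv[of "iv w" \<alpha>] by simp

lemma root_same_kernel: "\<alpha> \<in> \<Phi> \<Longrightarrow> {\<beta> \<in> \<Phi>. kernel_of \<beta> = kernel_of \<alpha>} = {\<alpha>, \<lambda>v. - \<alpha> v}"
  using roots unfolding is_root_system_def by blast

lemma root_uminus: "\<alpha> \<in> \<Phi> \<Longrightarrow> (\<lambda>v. - \<alpha> v) \<in> \<Phi>"
  using root_same_kernel[of \<alpha>] by blast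

lemma root_kernel_eqD: "\<alpha> \<in> \<Phi> \<Longrightarrow> \<beta> \<in> \<Phi> \<Longrightarrow> kernel_of \<beta> = kernel_of \<alpha> \<Longrightarrow> \<beta> = \<alpha> \<or> \<beta> = (\<lambda>v. - \<alpha> v)"
  using root_same_kernel[of \<alpha>] by blast

lemma hyperplanes: "kernel_of ` \<Phi> = reflecting_hyperplanes W"
  using roots unfolding is_root_system_def by blast

lemma finite_roots: "finite \<Phi>"
proof -
  have "reflecting_hyperplanes W \<subseteq> fixed_space ` W"
    by (auto simp: reflecting_hyperplanes_def)
  then have "finite (kernel_of ` \<Phi>)"
    unfolding hyperplanes by (rule finite_subset) auto
  moreover have "finite {\<beta> \<in> \<Phi>. kernel_of \<beta> = H}" for H
  proof (cases "\<exists>\<alpha>\<in>\<Phi>. kernel_of \<alpha> = H")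
    case False
    then have "{\<beta> \<in> \<Phi>. kernel_of \<beta> = H} = {}" by blast
    then show ?thesis by (metis finite.emptyI)
  qed (auto simp: root_same_kernel)
  ultimately have "finite (\<Union>H\<in>kernel_of ` \<Phi>. {\<beta> \<in> \<Phi>. kernel_of \<beta> = H})" by (rule finite_UN_I)
  then show ?thesis by (rule rev_finite_subset) blast
qed

text \<open>A base point of the chamber, at which all signs of roots will be read off.\<close>

definition pt :: "'k ^ 'n" where
  "pt = (SOME p. (\<forall>\<alpha>\<in>\<Phi>. \<alpha> p \<noteq> 0) \<and> C = {v. \<forall>\<alpha>\<in>\<Phi>. 0 < \<iota> (\<alpha> v) * \<iota> (\<alpha> p)})"

lemma pt: "\<alpha> \<in> \<Phi> \<Longrightarrow> \<alpha> pt \<noteq> 0" "C = {v. \<forall>\<alpha>\<in>\<Phi>. 0 < \<iota> (\<alpha> v) * \<iota> (\<alpha> pt)}"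
  using someI_ex[OF chamber[unfolded is_chamber_def]] unfolding pt_def by blast+

lemma pt_in_C: "pt \<in> C"
proof -
  have "0 < \<iota> (\<alpha> pt) * \<iota> (\<alpha> pt)" if "\<alpha> \<in> \<Phi>" for \<alpha>
    using pt(1)[OF that] by (auto simp: zero_less_mult_iff linorder_neq_iff simp flip: iota_eq_0_iff)
  then show ?thesis by (subst pt(2)) blast
qed

text \<open>By definition of the chamber each root has on all of \<open>C\<close> the sign that it
  has at \<open>pt\<close>.\<close>

lemma P_iff: "\<alpha> \<in> P \<longleftrightarrow> \<alpha> \<in> \<Phi> \<and> 0 < \<iota> (\<alpha> pt)"
proof
  show "\<alpha> \<in> P \<Longrightarrow> \<alpha> \<in> \<Phi> \<and> 0 < \<iota> (\<alpha> pt)"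
    using pt_in_C unfolding P_eq positive_roots_def by blast
next
  assume "\<alpha> \<in> \<Phi> \<and> 0 < \<iota> (\<alpha> pt)"
  moreover have "0 < \<iota> (\<alpha> v) * \<iota> (\<alpha> pt)" if "v \<in> C" "\<alpha> \<in> \<Phi>" for v
    using that by (subst (asm) pt(2)) blast
  ultimately show "\<alpha> \<in> P"
    unfolding P_eq positive_roots_def by (auto simp: zero_less_mult_iff)
qed

lemma pos_root [simp]: "\<alpha> \<in> P \<Longrightarrow> \<alpha> \<in> \<Phi>"
  by (simp add: P_iff)

lemma finite_P [simp]: "finite P"
  using finite_roots by (rule rev_finite_subset) auto

lemma neg_pos_iff: "\<alpha> \<in> \<Phi> \<Longrightarrow> (\<lambda>v. - \<alpha> v) \<in> P \<longleftrightarrow> \<alpha> \<notin> P"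
  using pt(1)[of \<alpha>]
  by (auto simp: P_iff root_uminus linorder_not_less order_less_le simp flip: iota_eq_0_iff)

lemma root_nonzero: "\<alpha> \<in> \<Phi> \<Longrightarrow> \<alpha> \<noteq> (\<lambda>_. 0)"
  using pt(1) by auto

lemma reflection_form:
  assumes "is_reflection t" "\<gamma> \<in> \<Phi>" "fixed_space t = kernel_of \<gamma>"
  obtains b where "\<And>v. t v = v - \<gamma> v *s b" "\<gamma> b = 2"
proof -
  interpret t: Vector_Spaces.linear "(*s)" "(*s)" t
    using assms by (simp add: is_reflection_def)
  define q where "q = inverse (\<gamma> pt) *s pt"
  have q: "\<gamma> q = 1"
    using pt(1)[OF assms(2)] assms(2) by (simp add: q_def root_apply_linear)
  define b where "b = q - t q"
  have form: "t v = v - \<gamma> v *s b" for v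
  proof -
    have "v - \<gamma> v *s q \<in> kernel_of \<gamma>"
      using assms(2) q by (simp add: kernel_of_def root_apply_linear)
    then have "t (v - \<gamma> v *s q) = v - \<gamma> v *s q"
      using assms(3) by (auto simp: fixed_space_def)
    then show ?thesis
      by (simp add: t.diff t.scale b_def algebra_simps)
  qed
  have "b \<noteq> 0"
  proof
    assume "b = 0"
    then have "q \<in> fixed_space t" by (simp add: fixed_space_def b_def)
    then show False using q assms(3) by (simp add: kernel_of_def)
  qed
  have "t (t q) = q"
    using assms(1) by (metis comp_apply id_apply is_reflection_def)
  \<comment> \<open>Being an involution forces the normalization: applying \<open>t\<close> twice to
    \<open>q\<close> must give back \<open>q\<close>.\<close>
  then have "q - b - (1 - \<gamma> b) *s b = q"
    using assms(2) form[of "t q"] form[of q] by (simp add: q root_apply_linear)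
  then have "(2 - \<gamma> b) *s b = 0"
    by (simp add: algebra_simps vec_eq_iff)
  with \<open>b \<noteq> 0\<close> have "\<gamma> b = 2" by simp
  with form that show ?thesis by blast
qed

text \<open>Two reflections with the same mirror differ by a transvection, whose powers are all
  distinct in characteristic zero unless it is trivial. Finiteness of \<open>W\<close>
  decides.\<close>

lemma reflection_unique:
  assumes "is_reflection t" "is_reflection t'" "t \<in> W" "t' \<in> W" "\<gamma> \<in> \<Phi>"
    "fixed_space t = kernel_of \<gamma>" "fixed_space t' = kernel_of \<gamma>"
  shows "t = t'"
proof -
  obtain b where b: "\<And>v. t v = v - \<gamma> v *s b" "\<gamma> b = 2"
    using reflection_form assms by metis
  obtain b' where b': "\<And>v. t' v = v - \<gamma> v *s b'" "\<gamma> b' = 2"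
    using reflection_form assms by metis
  have pow: "((t \<circ> t') ^^ n) v = v + (of_nat n * \<gamma> v) *s (b - b')" for n v
  proof (induction n)
    case (Suc n)
    have "((t \<circ> t') ^^ Suc n) v = t (t' (v + (of_nat n * \<gamma> v) *s (b - b')))"
      by (simp add: Suc)
    also have "\<dots> = v + (of_nat (Suc n) * \<gamma> v) *s (b - b')"
      using assms(5) b(2) b'(2) by (simp add: b(1) b'(1) root_apply_linear vec_eq_iff algebra_simps)
    finally show ?case .
  qed simp
  have inW: "(t \<circ> t') ^^ n \<in> W" for n
  proof (induction n)
    case (Suc n)
    have "(t \<circ> t') ^^ n \<in> W" by (rule Suc)
    then have "(t \<circ> t') ^^ Suc n \<in> W" using assms by (simp del: funpow_0)
    then show ?case .
  next
    case 0
    have "(t \<circ> t') ^^ 0 \<in> W" by simp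
    then show ?case .
  qed
  have "\<not> inj (\<lambda>n. (t \<circ> t') ^^ n)"
    using inW finite_W by (metis finite_imageD finite_subset image_subset_iff infinite_UNIV_nat)
  then obtain m n where mn: "m \<noteq> n" "(t \<circ> t') ^^ m = (t \<circ> t') ^^ n"
    by (auto simp: inj_def)
  then have "(of_nat m * \<gamma> b) *s (b - b') = (of_nat n * \<gamma> b) *s (b - b')"
    using pow by (metis add_left_cancel)
  then have "((of_nat m - of_nat n) * \<gamma> b) *s (b - b') = 0"
    by (simp add: algebra_simps)
  moreover have "\<gamma> b \<noteq> 0"
    using b(2) of_nat_eq_iff'[of 2 0] by simp
  ultimately have "b = b'"
    using mn(1) by simp
  then show ?thesis using b b' by auto
qed

definition trefl :: "('k ^ 'n \<Rightarrow> 'k) \<Rightarrow> 'k ^ 'n \<Rightarrow> 'k ^ 'n" where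
  "trefl \<gamma> = (SOME t. t \<in> W \<and> is_reflection t \<and> fixed_space t = kernel_of \<gamma>)"

text \<open>The coroot is read off from the reflection itself, without choosing an invariant
  form.\<close>

definition coroot :: "('k ^ 'n \<Rightarrow> 'k) \<Rightarrow> 'k ^ 'n" where
  "coroot \<gamma> = (SOME b. (\<forall>v. trefl \<gamma> v = v - \<gamma> v *s b) \<and> \<gamma> b = 2)"

lemma trefl:
  assumes "\<gamma> \<in> \<Phi>"
  shows "trefl \<gamma> \<in> W" "is_reflection (trefl \<gamma>)" "fixed_space (trefl \<gamma>) = kernel_of \<gamma>"
proof -
  have "kernel_of \<gamma> \<in> reflecting_hyperplanes W"
    using hyperplanes assms by blast
  then have "\<exists>t. t \<in> W \<and> is_reflection t \<and> fixed_space t = kernel_of \<gamma>"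
    by (auto simp: reflecting_hyperplanes_def)
  from someI_ex[OF this, folded trefl_def]
  show "trefl \<gamma> \<in> W" "is_reflection (trefl \<gamma>)" "fixed_space (trefl \<gamma>) = kernel_of \<gamma>" by auto
qed

declare trefl(1) [simp]

lemma coroot:
  assumes "\<gamma> \<in> \<Phi>"
  shows "trefl \<gamma> v = v - \<gamma> v *s coroot \<gamma>" "\<gamma> (coroot \<gamma>) = 2"
proof -
  have "\<exists>b. (\<forall>v. trefl \<gamma> v = v - \<gamma> v *s b) \<and> \<gamma> b = 2"
    using reflection_form[OF trefl(2) _ trefl(3)] assms by metis
  from someI_ex[OF this, folded coroot_def]
  show "trefl \<gamma> v = v - \<gamma> v *s coroot \<gamma>" "\<gamma> (coroot \<gamma>) = 2" by auto
qed

lemma trefl_eqI: "t \<in> W \<Longrightarrow> is_reflection t \<Longrightarrow> fixed_space t = kernel_of \<gamma> \<Longrightarrow> \<gamma> \<in> \<Phi> \<Longrightarrow> trefl \<gamma> = t"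
  using reflection_unique trefl by metis

lemma trefl_invol: "\<gamma> \<in> \<Phi> \<Longrightarrow> trefl \<gamma> \<circ> trefl \<gamma> = id"
  using trefl(2) by (auto simp: is_reflection_def)

lemma iv_trefl: "\<gamma> \<in> \<Phi> \<Longrightarrow> iv (trefl \<gamma>) = trefl \<gamma>"
  by (simp add: iv_eqI trefl_invol)

lemma root_trefl: "\<gamma> \<in> \<Phi> \<Longrightarrow> \<gamma> \<circ> trefl \<gamma> = (\<lambda>v. - \<gamma> v)"
  by (auto simp: coroot root_apply_linear algebra_simps fun_eq_iff)

lemma trefl_conj:
  assumes "w \<in> W" "\<gamma> \<in> \<Phi>"
  shows "trefl (\<gamma> \<circ> iv w) = w \<circ> trefl \<gamma> \<circ> iv w"
proof (rule trefl_eqI)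
  let ?t = "w \<circ> trefl \<gamma> \<circ> iv w"
  show W: "?t \<in> W" and R: "\<gamma> \<circ> iv w \<in> \<Phi>" using assms by simp_all
  have "?t v = v \<longleftrightarrow> trefl \<gamma> (iv w v) = iv w v" for v
    using assms(1) by (metis apply_iv comp_apply iv_apply)
  also have "\<dots> v \<longleftrightarrow> iv w v \<in> kernel_of \<gamma>" for v
    using trefl(3)[OF assms(2)] by (auto simp: fixed_space_def)
  finally show ker: "fixed_space ?t = kernel_of (\<gamma> \<circ> iv w)"
    by (auto simp: fixed_space_def kernel_of_def)
  have "?t \<circ> ?t = w \<circ> (trefl \<gamma> \<circ> (iv w \<circ> w) \<circ> trefl \<gamma>) \<circ> iv w"
    by (simp only: comp_assoc)
  also have "\<dots> = id"
    using assms by (simp add: trefl_invol)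
  finally have "?t \<circ> ?t = id" .
  then show "is_reflection ?t"
    unfolding is_reflection_def using ker W_linear[OF W] root_linear[OF R] root_nonzero[OF R] by blast
qed

lemma coroot_eqI:
  assumes "\<gamma> \<in> \<Phi>" "\<And>v. trefl \<gamma> v = v - \<gamma> v *s b"
  shows "coroot \<gamma> = b"
proof -
  have "\<gamma> pt *s coroot \<gamma> = \<gamma> pt *s b"
    using assms(2)[of pt] coroot(1)[OF assms(1), of pt] by simp
  then show ?thesis using pt(1)[OF assms(1)] by simp
qed

lemma coroot_conj:
  assumes "w \<in> W" "\<gamma> \<in> \<Phi>"
  shows "coroot (\<gamma> \<circ> iv w) = w (coroot \<gamma>)"
  using assms by (intro coroot_eqI) (simp_all add: trefl_conj coroot(1) W_apply_linear)

lemma trefl_uminus: "\<gamma> \<in> \<Phi> \<Longrightarrow> trefl (\<lambda>v. - \<gamma> v) = trefl \<gamma>"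
  by (rule trefl_eqI) (auto simp: trefl root_uminus kernel_of_def)

subsection \<open>Simple reflections\<close>

text \<open>Each mirror carries exactly one positive root, so the definite description in
  \<open>simple_root\<close> denotes.\<close>

lemma simple_root:
  assumes "s \<in> S"
  shows "simple_root P s \<in> P" "trefl (simple_root P s) = s"
proof -
  have "fixed_space s \<in> kernel_of ` \<Phi>"
    using assms unfolding S_eq wall_reflections_def is_wall_def by blast
  then obtain \<alpha> where \<alpha>: "\<alpha> \<in> \<Phi>" "kernel_of \<alpha> = fixed_space s"
    by (metis imageE)
  define \<beta> where "\<beta> = (if \<alpha> \<in> P then \<alpha> else (\<lambda>v. - \<alpha> v))"
  have \<beta>: "\<beta> \<in> P" "kernel_of \<beta> = fixed_space s"
    using \<alpha> by (auto simp: \<beta>_def neg_pos_iff kernel_of_def)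
  have "\<exists>!\<alpha>. \<alpha> \<in> P \<and> kernel_of \<alpha> = fixed_space s"
  proof (rule ex1I[of _ \<beta>])
    fix \<delta> assume \<delta>: "\<delta> \<in> P \<and> kernel_of \<delta> = fixed_space s"
    then have "\<delta> = \<beta> \<or> \<delta> = (\<lambda>v. - \<beta> v)"
      using \<beta> by (intro root_kernel_eqD) auto
    moreover have "(\<lambda>v. - \<beta> v) \<notin> P"
      using \<beta> neg_pos_iff[of \<beta>] by simp
    ultimately show "\<delta> = \<beta>" using \<delta> by blast
  qed (use \<beta> in simp)
  from theI'[OF this, folded simple_root_def]
  have *: "simple_root P s \<in> P" "kernel_of (simple_root P s) = fixed_space s" by auto
  then show "simple_root P s \<in> P" by simp
  show "trefl (simple_root P s) = s"
    using * assms by (intro trefl_eqI) (auto simp: simple_refl)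
qed

abbreviation srt :: "('k ^ 'n \<Rightarrow> 'k ^ 'n) \<Rightarrow> 'k ^ 'n \<Rightarrow> 'k" where
  "srt s \<equiv> simple_root P s"

lemma srt_root [simp]: "s \<in> S \<Longrightarrow> srt s \<in> \<Phi>"
  by (simp add: simple_root)

lemma kernel_srt: "s \<in> S \<Longrightarrow> kernel_of (srt s) = fixed_space s"
  using trefl(3)[of "srt s"] simple_root by simp

lemma srt_simple: "s \<in> S \<Longrightarrow> srt s \<circ> s = (\<lambda>v. - srt s v)"
  using root_trefl[of "srt s"] simple_root by simp

text \<open>A wall contains a point \<open>p\<close>, fixed by \<open>s\<close>, on the chamber side
  of every other mirror. For roots not vanishing on the wall the sign is thus read off at
  \<open>p\<close>, where \<gamma> and \<open>\<gamma> \<circ> s\<close> take the same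
  value.\<close>

lemma simple_permutes_pos:
  assumes "s \<in> S" "\<gamma> \<in> P" "\<gamma> \<noteq> srt s"
  shows "\<gamma> \<circ> s \<in> P"
proof -
  obtain p where p: "p \<in> fixed_space s"
    "\<And>\<alpha>. \<alpha> \<in> \<Phi> \<Longrightarrow> kernel_of \<alpha> \<noteq> fixed_space s \<Longrightarrow> 0 < \<iota> (\<alpha> pt) * \<iota> (\<alpha> p)"
    using assms(1) pt_in_C unfolding S_eq wall_reflections_def is_wall_def by auto
  have ker: "kernel_of \<beta> \<noteq> fixed_space s" if "\<beta> \<in> \<Phi>" "\<beta> \<noteq> srt s" "\<beta> \<noteq> (\<lambda>v. - srt s v)" for \<beta>
    using root_kernel_eqD[OF srt_root[OF assms(1)] that(1)] that(2,3) kernel_srt[OF assms(1)] by blast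
  have "\<gamma> \<noteq> (\<lambda>v. - srt s v)"
    using assms neg_pos_iff[OF srt_root[OF assms(1)]] simple_root(1) by auto
  then have "kernel_of \<gamma> \<noteq> fixed_space s"
    using ker assms by simp
  then have "0 < \<iota> (\<gamma> pt) * \<iota> (\<gamma> p)"
    using p assms by simp
  then have gp: "0 < \<iota> (\<gamma> p)"
    using assms(2) by (simp add: P_iff zero_less_mult_iff)
  have *: "\<gamma> = \<beta> \<circ> s" if "\<gamma> \<circ> s = \<beta>" for \<beta>
    using that assms(1) by (metis comp_simple_simple)
  have "\<gamma> \<circ> s \<noteq> srt s"
    using *[of "srt s"] srt_simple[OF assms(1)] \<open>\<gamma> \<noteq> (\<lambda>v. - srt s v)\<close> by auto
  moreover have "\<gamma> \<circ> s \<noteq> (\<lambda>v. - srt s v)"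
    using *[of "\<lambda>v. - srt s v"] srt_simple[OF assms(1)] assms(3) by (auto simp: fun_eq_iff)
  ultimately have "kernel_of (\<gamma> \<circ> s) \<noteq> fixed_space s"
    using ker assms by simp
  then have "0 < \<iota> ((\<gamma> \<circ> s) pt) * \<iota> ((\<gamma> \<circ> s) p)"
    using p(2)[of "\<gamma> \<circ> s"] assms by simp
  moreover have "(\<gamma> \<circ> s) p = \<gamma> p"
    using p(1) by (simp add: fixed_space_def)
  ultimately have "0 < \<iota> ((\<gamma> \<circ> s) pt)"
    using gp by (simp add: zero_less_mult_iff)
  then show ?thesis using assms by (simp add: P_iff)
qed

text \<open>Follow \<gamma> through ever longer suffixes of the word. It starts positive and ends
  negative; at a letter \<open>s\<close> where the sign turns it must be the simple root of
  \<open>s\<close>, and deleting that letter amounts to multiplying by the reflection of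
  \<gamma>.\<close>

lemma exchange:
  assumes "ss \<in> lists S" "\<gamma> \<in> P" "\<gamma> \<circ> iv (word_prod ss) \<notin> P"
  shows "\<exists>us s vs. ss = us @ s # vs \<and> word_prod (us @ vs) = word_prod ss \<circ> trefl \<gamma>
     \<and> \<gamma> \<circ> iv (word_prod vs) = srt s"
  using assms
proof (induction ss)
  case Nil
  then show ?case by simp
next
  case (Cons s ss)
  then have sW: "s \<in> S" "word_prod ss \<in> W" by auto
  show ?case
  proof (cases "\<gamma> \<circ> iv (word_prod ss) \<in> P")
    case False
    from Cons.IH[OF Cons.prems(1) False]
    obtain us r vs where "ss = us @ r # vs" "word_prod (us @ vs) = word_prod ss \<circ> trefl \<gamma>"
       "\<gamma> \<circ> iv (word_prod vs) = srt r" by blast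
    then have "s # ss = (s # us) @ r # vs \<and> word_prod ((s # us) @ vs) = word_prod (s # ss) \<circ> trefl \<gamma>
        \<and> \<gamma> \<circ> iv (word_prod vs) = srt r" by (simp add: comp_assoc)
    then show ?thesis by blast
  next
    case True
    have "\<gamma> \<circ> iv (word_prod (s # ss)) \<notin> P" by (rule Cons.prems)
    then have "\<gamma> \<circ> iv (word_prod ss) \<circ> s \<notin> P"
      using sW by (simp add: iv_comp comp_assoc)
    then have eq: "\<gamma> \<circ> iv (word_prod ss) = srt s"
      using True simple_permutes_pos sW by blast
    have "word_prod ss \<circ> trefl \<gamma> \<circ> iv (word_prod ss) = s"
      using trefl_conj[of "word_prod ss" \<gamma>] eq sW \<open>\<gamma> \<in> P\<close> by (simp add: simple_root)
    then have "s \<circ> word_prod ss = word_prod ss \<circ> trefl \<gamma> \<circ> (iv (word_prod ss) \<circ> word_prod ss)"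
      by (metis comp_assoc)
    then have "s \<circ> word_prod ss = word_prod ss \<circ> trefl \<gamma>"
      using sW by simp
    then have "word_prod (s # ss) \<circ> trefl \<gamma> = word_prod ss"
      using sW by (metis comp_assoc simple_comp_simple word_prod_Cons)
    with eq have "s # ss = [] @ s # ss \<and> word_prod ([] @ ss) = word_prod (s # ss) \<circ> trefl \<gamma>
        \<and> \<gamma> \<circ> iv (word_prod ss) = srt s" by simp
    then show ?thesis by blast
  qed
qed

subsection \<open>Length\<close>

lemma reduced_word_exists:
  assumes "w \<in> W"
  obtains ss where "is_reduced_word S w ss"
proof -
  have "\<exists>n. \<exists>ss\<in>lists S. length ss = n \<and> word_prod ss = w"
    using assms W_words by auto
  from LeastI_ex[OF this] show ?thesis
    using that unfolding is_reduced_word_def cox_length_def by blast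
qed

lemma len_le: "ss \<in> lists S \<Longrightarrow> len (word_prod ss) \<le> length ss"
  unfolding cox_length_def by (rule Least_le) blast

lemma len_id [simp]: "len id = 0"
  using len_le[of "[]"] by simp

lemma len_eq_0 [simp]: "w \<in> W \<Longrightarrow> len w = 0 \<longleftrightarrow> w = id"
proof
  assume "w \<in> W" "len w = 0"
  then obtain ss where "is_reduced_word S w ss" by (metis reduced_word_exists)
  with \<open>len w = 0\<close> show "w = id" by (auto simp: is_reduced_word_def)
qed simp

lemma len_comp_le: "u \<in> W \<Longrightarrow> v \<in> W \<Longrightarrow> len (u \<circ> v) \<le> len u + len v"
proof -
  assume "u \<in> W" "v \<in> W"
  then obtain ss ts where "is_reduced_word S u ss" "is_reduced_word S v ts"
    by (metis reduced_word_exists)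
  then show ?thesis
    using len_le[of "ss @ ts"] by (simp add: is_reduced_word_def)
qed

lemma word_prod_rev: "ss \<in> lists S \<Longrightarrow> word_prod (rev ss) = iv (word_prod ss)"
  by (induction ss) (auto simp: iv_comp iv_eqI)

lemma len_iv [simp]: "w \<in> W \<Longrightarrow> len (iv w) = len w"
proof -
  have *: "len (iv w) \<le> len w" if "w \<in> W" for w
  proof -
    from that obtain ss where "is_reduced_word S w ss" by (rule reduced_word_exists)
    then show ?thesis
      using len_le[of "rev ss"] word_prod_rev[of ss] by (auto simp: is_reduced_word_def in_lists_conv_set)
  qed
  show "w \<in> W \<Longrightarrow> len (iv w) = len w"
    using *[of w] *[of "iv w"] by simp
qed

lemma len_simple: "s \<in> S \<Longrightarrow> len s = 1"
  using len_le[of "[s]"] len_eq_0[of s] simple_neq_id[of s] by (auto simp: le_Suc_eq)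

lemma len_trefl_neg:
  assumes "w \<in> W" "\<gamma> \<in> P" "\<gamma> \<circ> iv w \<notin> P"
  shows "len (w \<circ> trefl \<gamma>) < len w"
proof -
  from assms(1) obtain ss where ss: "is_reduced_word S w ss" by (rule reduced_word_exists)
  then obtain us s vs where "ss = us @ s # vs" "word_prod (us @ vs) = w \<circ> trefl \<gamma>"
    using exchange[of ss \<gamma>] assms by (auto simp: is_reduced_word_def)
  then show ?thesis
    using len_le[of "us @ vs"] ss by (auto simp: is_reduced_word_def)
qed

lemma len_trefl_pos:
  assumes "w \<in> W" "\<gamma> \<in> P" "\<gamma> \<circ> iv w \<in> P"
  shows "len w < len (w \<circ> trefl \<gamma>)"
proof -
  have "\<gamma> \<circ> iv (w \<circ> trefl \<gamma>) = (\<lambda>v. - (\<gamma> \<circ> iv w) v)"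
    using assms root_trefl[of \<gamma>] by (simp add: iv_comp iv_trefl fun_eq_iff)
  then have "\<gamma> \<circ> iv (w \<circ> trefl \<gamma>) \<notin> P"
    using neg_pos_iff[of "\<gamma> \<circ> iv w"] assms by simp
  from len_trefl_neg[OF _ _ this] show ?thesis
    using assms by (simp add: comp_assoc trefl_invol)
qed

lemma len_less_iff: "w \<in> W \<Longrightarrow> \<gamma> \<in> P \<Longrightarrow> len w < len (w \<circ> trefl \<gamma>) \<longleftrightarrow> \<gamma> \<circ> iv w \<in> P"
  using len_trefl_neg len_trefl_pos by (meson less_asym)

text \<open>The second claim ensures that the truncated subtraction in the first one is a genuine
  predecessor.\<close>

lemma len_comp_simple:
  assumes "w \<in> W" "s \<in> S"
  shows "len (w \<circ> s) = (if srt s \<circ> iv w \<in> P then Suc (len w) else len w - 1)"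
    "srt s \<circ> iv w \<notin> P \<Longrightarrow> 0 < len w"
proof -
  have "len (w \<circ> s) \<le> len w + 1" "len w \<le> len (w \<circ> s) + 1"
    using len_comp_le[of w s] len_comp_le[of "w \<circ> s" s] assms by (auto simp: len_simple)
  moreover have "srt s \<circ> iv w \<in> P \<Longrightarrow> len w < len (w \<circ> s)" "srt s \<circ> iv w \<notin> P \<Longrightarrow> len (w \<circ> s) < len w"
    using len_trefl_pos[of w "srt s"] len_trefl_neg[of w "srt s"] assms by (simp_all add: simple_root)
  ultimately show "len (w \<circ> s) = (if srt s \<circ> iv w \<in> P then Suc (len w) else len w - 1)"
    "srt s \<circ> iv w \<notin> P \<Longrightarrow> 0 < len w" by auto
qed

lemma len_comp_simple_cases:
  assumes "w \<in> W" "s \<in> S"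
  obtains "len (w \<circ> s) = Suc (len w)" "srt s \<circ> iv w \<in> P" | "len w = Suc (len (w \<circ> s))" "srt s \<circ> iv w \<notin> P"
  using len_comp_simple[OF assms] by (cases "srt s \<circ> iv w \<in> P") auto

lemma len_simple_comp_cases:
  assumes "w \<in> W" "s \<in> S"
  obtains "len (s \<circ> w) = Suc (len w)" "srt s \<circ> w \<in> P" | "len w = Suc (len (s \<circ> w))" "srt s \<circ> w \<notin> P"
proof -
  have "len (s \<circ> w) = len (iv w \<circ> s)"
    using len_iv[of "s \<circ> w"] assms by (simp add: iv_comp)
  then show ?thesis
    using that len_comp_simple_cases[of "iv w" s] assms by auto
qed

lemma trefl_comp_simple: "s \<in> S \<Longrightarrow> \<gamma> \<in> \<Phi> \<Longrightarrow> trefl (\<gamma> \<circ> s) = s \<circ> trefl \<gamma> \<circ> s"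
  using trefl_conj[of s \<gamma>] by simp

subsection \<open>Bruhat order\<close>

text \<open>The reflection of \<gamma> makes \<gamma> negative, so following \<gamma> through a word
  for that reflection meets a simple root.\<close>

lemma pos_root_conj_simple:
  assumes "\<gamma> \<in> P"
  obtains w s where "w \<in> W" "s \<in> S" "\<gamma> = srt s \<circ> w"
proof -
  obtain ss where ss: "ss \<in> lists S" "trefl \<gamma> = word_prod ss"
    using trefl(1)[of \<gamma>] W_words assms by auto
  have "\<gamma> \<circ> iv (trefl \<gamma>) \<notin> P"
    using assms neg_pos_iff[of \<gamma>] by (simp add: iv_trefl root_trefl)
  then obtain us s vs where *: "ss = us @ s # vs" "\<gamma> \<circ> iv (word_prod vs) = srt s"
    using exchange[of ss \<gamma>] ss assms by auto
  then have "\<gamma> = srt s \<circ> word_prod vs" "word_prod vs \<in> W" "s \<in> S"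
    using ss by (auto simp: comp_assoc simp flip: *(2))
  then show ?thesis using that by blast
qed

text \<open>Links the conjugates of simple reflections, by which \<open>bruhat_le\<close> is
  defined, to positive roots.\<close>

lemma reflections_eq: "{t. \<exists>g\<in>W. \<exists>s\<in>S. t = g \<circ> s \<circ> iv g} = trefl ` P"
proof
  show "{t. \<exists>g\<in>W. \<exists>s\<in>S. t = g \<circ> s \<circ> iv g} \<subseteq> trefl ` P"
  proof clarify
    fix g s assume gs: "g \<in> W" "s \<in> S"
    then have *: "trefl (srt s \<circ> iv g) = g \<circ> s \<circ> iv g"
      by (simp add: trefl_conj simple_root)
    have r: "srt s \<circ> iv g \<in> \<Phi>" using gs by simp
    show "g \<circ> s \<circ> iv g \<in> trefl ` P"
    proof (cases "srt s \<circ> iv g \<in> P")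
      case False
      then show ?thesis using trefl_uminus[OF r] neg_pos_iff[OF r] * by (metis image_eqI)
    qed (use * in force)
  qed
  show "trefl ` P \<subseteq> {t. \<exists>g\<in>W. \<exists>s\<in>S. t = g \<circ> s \<circ> iv g}"
  proof clarify
    fix \<gamma> assume "\<gamma> \<in> P"
    then obtain w s where ws: "w \<in> W" "s \<in> S" "\<gamma> = srt s \<circ> w" by (rule pos_root_conj_simple)
    then have "trefl \<gamma> = iv w \<circ> s \<circ> iv (iv w)"
      using trefl_conj[of "iv w" "srt s"] by (simp add: simple_root)
    with ws show "\<exists>g\<in>W. \<exists>s\<in>S. trefl \<gamma> = g \<circ> s \<circ> iv g" by (metis iv_in_W)
  qed
qed

text \<open>One generating step of the Bruhat order, with the length condition expressed by the sign
  of a root (see \<open>len_less_iff\<close>).\<close>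

definition bstep :: "('k ^ 'n \<Rightarrow> 'k ^ 'n) \<Rightarrow> ('k ^ 'n \<Rightarrow> 'k ^ 'n) \<Rightarrow> bool" where
  "bstep x y \<longleftrightarrow> x \<in> W \<and> (\<exists>\<gamma>\<in>P. \<gamma> \<circ> iv x \<in> P \<and> y = x \<circ> trefl \<gamma>)"

lemma bruhat_eq: "u \<preceq> v \<longleftrightarrow> bstep\<^sup>*\<^sup>* u v"
proof -
  have "{(x, x \<circ> t) | x t. x \<in> W \<and> (\<exists>g\<in>W. \<exists>s\<in>S. t = g \<circ> s \<circ> iv g) \<and> len x < len (x \<circ> t)}
      = {(x, x \<circ> t) | x t. x \<in> W \<and> t \<in> trefl ` P \<and> len x < len (x \<circ> t)}"
    by (simp flip: reflections_eq)
  also have "\<dots> = {(x, y). bstep x y}"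
    unfolding bstep_def using len_less_iff by auto
  finally show ?thesis
    unfolding bruhat_le_def by (simp add: rtranclp_rtrancl_eq)
qed

lemma bruhat_refl [simp]: "u \<preceq> u"
  by (simp add: bruhat_eq)

lemma bruhat_trans [trans]: "u \<preceq> v \<Longrightarrow> v \<preceq> w \<Longrightarrow> u \<preceq> w"
  by (simp add: bruhat_eq)

lemma bstep_len: "bstep x y \<Longrightarrow> len x < len y"
  by (auto simp: bstep_def len_less_iff)

lemma bstep_W: "bstep x y \<Longrightarrow> x \<in> W \<and> y \<in> W"
  by (auto simp: bstep_def)

lemma bruhat_W: "u \<preceq> v \<Longrightarrow> u \<in> W \<longleftrightarrow> v \<in> W"
  unfolding bruhat_eq by (induction rule: rtranclp_induct) (auto dest: bstep_W)

lemma bruhat_len: "u \<preceq> v \<Longrightarrow> u = v \<or> len u < len v"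
  unfolding bruhat_eq by (induction rule: rtranclp_induct) (auto dest: bstep_len)

lemma bruhat_antisym: "u \<preceq> v \<Longrightarrow> v \<preceq> u \<Longrightarrow> u = v"
  using bruhat_len[of u v] bruhat_len[of v u] by auto

lemma bstep_simple: "x \<in> W \<Longrightarrow> s \<in> S \<Longrightarrow> len x < len (x \<circ> s) \<Longrightarrow> bstep x (x \<circ> s)"
  unfolding bstep_def using len_less_iff[of x "srt s"] by (metis simple_root)

lemma bruhat_simple: "x \<in> W \<Longrightarrow> s \<in> S \<Longrightarrow> len x < len (x \<circ> s) \<Longrightarrow> x \<preceq> x \<circ> s"
  using bstep_simple by (auto simp: bruhat_eq)

lemma bruhat_simple': "x \<in> W \<Longrightarrow> s \<in> S \<Longrightarrow> len (x \<circ> s) < len x \<Longrightarrow> x \<circ> s \<preceq> x"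
  using bruhat_simple[of "x \<circ> s" s] by simp

text \<open>Since \<open>s\<close> permutes the positive roots other than its own, right multiplication by \<open>s\<close> preserves a
  Bruhat step along any other reflection.\<close>

lemma bstep_comp_simple:
  assumes "bstep x y" "s \<in> S" "y \<noteq> x \<circ> s"
  shows "bstep (x \<circ> s) (y \<circ> s)"
proof -
  obtain \<gamma> where g: "x \<in> W" "\<gamma> \<in> P" "\<gamma> \<circ> iv x \<in> P" "y = x \<circ> trefl \<gamma>"
    using assms(1) by (auto simp: bstep_def)
  then have "\<gamma> \<noteq> srt s"
    using assms simple_root by metis
  then have 1: "\<gamma> \<circ> s \<in> P"
    using simple_permutes_pos assms g by blast
  have 2: "\<gamma> \<circ> s \<circ> iv (x \<circ> s) = \<gamma> \<circ> iv x"
    using g assms by (simp add: iv_comp comp_assoc)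
  have 3: "y \<circ> s = x \<circ> s \<circ> trefl (\<gamma> \<circ> s)"
    using g assms by (simp add: trefl_comp_simple comp_assoc)
  show ?thesis
    unfolding bstep_def using 1 2 3 g assms by (metis comp_in_W simple_in_W)
qed

text \<open>Multiply a chain from \<open>x\<close> to \<open>y\<close> by \<open>s\<close>. Either
  every step survives and the chain ends at \<open>y \<circ> s\<close>, below \<open>y\<close>, or a
  step is multiplication by \<open>s\<close> itself, and there the original chain takes
  over.\<close>

lemma lift_up:
  assumes "x \<preceq> y" "y \<in> W" "s \<in> S" "len (y \<circ> s) < len y"
  shows "x \<circ> s \<preceq> y"
  using assms(1) unfolding bruhat_eq
proof (induction rule: converse_rtranclp_induct)
  case base
  have "y \<circ> s \<preceq> y" using bruhat_simple'[of y s] assms by simp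
  then show ?case unfolding bruhat_eq .
next
  case (step x x')
  then show ?case
    using bstep_comp_simple[of x x' s] assms by (metis converse_rtranclp_into_rtranclp)
qed

text \<open>Passing to the shorter of \<open>x\<close> and \<open>x \<circ> s\<close> is monotone.
  Both halves of the lifting property below are instances.\<close>

lemma lift_min:
  assumes "x \<preceq> y" "y \<in> W" "s \<in> S" "len (y \<circ> s) < len y"
  shows "(if len x < len (x \<circ> s) then x else x \<circ> s) \<preceq> y \<circ> s"
proof -
  define m where "m x = (if len x < len (x \<circ> s) then x else x \<circ> s)" for x
  have "m x \<preceq> y \<circ> s"
    using assms(1) unfolding bruhat_eq[of x y]
  proof (induction rule: converse_rtranclp_induct)
    case base
    have "m y = y \<circ> s" using assms by (simp add: m_def)
    then show ?case by simp
  next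
    case (step x x')
    have W: "x \<in> W" "x' \<in> W" using step bstep_W by auto
    have mx: "m x \<preceq> x \<and> m x \<preceq> x \<circ> s"
    proof (rule len_comp_simple_cases[OF W(1) assms(3)])
      assume *: "len (x \<circ> s) = Suc (len x)"
      then have "m x = x" by (simp add: m_def)
      then show ?thesis using * bruhat_simple W assms by simp
    next
      assume *: "len x = Suc (len (x \<circ> s))"
      then have "m x = x \<circ> s" by (simp add: m_def)
      then show ?thesis using * bruhat_simple' W assms by simp
    qed
    have "m x \<preceq> m x'"
    proof (cases "x' = x \<circ> s")
      case True
      have "len x < len x'" using step bstep_len by simp
      then have "m x = x" "m x' = x"
        using True assms(3) by (simp_all add: m_def)
      then show ?thesis by simp
    next
      case False
      then have "x \<circ> s \<preceq> x' \<circ> s"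
        using bstep_comp_simple step assms by (simp add: bruhat_eq r_into_rtranclp)
      moreover have "x \<preceq> x'" using step by (simp add: bruhat_eq r_into_rtranclp)
      moreover have "m x' = x' \<or> m x' = x' \<circ> s" by (simp add: m_def)
      ultimately show ?thesis using mx bruhat_trans by metis
    qed
    then show ?case using step.IH by (rule bruhat_trans)
  qed
  then show ?thesis by (simp add: m_def)
qed

lemma lift_le: "x \<preceq> y \<Longrightarrow> y \<in> W \<Longrightarrow> s \<in> S \<Longrightarrow> len (y \<circ> s) < len y \<Longrightarrow> len x < len (x \<circ> s) \<Longrightarrow> x \<preceq> y \<circ> s"
  using lift_min[of x y s] by simp

lemma lift_both: "x \<preceq> y \<Longrightarrow> y \<in> W \<Longrightarrow> s \<in> S \<Longrightarrow> len (y \<circ> s) < len y \<Longrightarrow> len (x \<circ> s) < len x \<Longrightarrow> x \<circ> s \<preceq> y \<circ> s"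
  using lift_min[of x y s] by simp

lemma bruhat_iv:
  assumes "u \<preceq> v"
  shows "iv u \<preceq> iv v"
  using assms unfolding bruhat_eq
proof (induction rule: rtranclp_induct)
  case (step y z)
  then obtain \<gamma> where g: "y \<in> W" "\<gamma> \<in> P" "\<gamma> \<circ> iv y \<in> P" "z = y \<circ> trefl \<gamma>"
    by (auto simp: bstep_def)
  have "iv z = iv y \<circ> trefl (\<gamma> \<circ> iv y)"
    using g by (simp add: iv_comp trefl_conj iv_trefl comp_assoc[symmetric])
  moreover have "\<gamma> \<circ> iv y \<circ> iv (iv y) = \<gamma>"
    using g by (simp add: comp_assoc)
  ultimately have "bstep (iv y) (iv z)"
    unfolding bstep_def using g by (metis iv_in_W)
  with step show ?case by simp
qed simp

lemma bruhat_iv_iff: "u \<in> W \<Longrightarrow> v \<in> W \<Longrightarrow> iv u \<preceq> iv v \<longleftrightarrow> u \<preceq> v"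
  using bruhat_iv[of u v] bruhat_iv[of "iv u" "iv v"] by auto

lemma len_simple_comp: "s \<in> S \<Longrightarrow> w \<in> W \<Longrightarrow> len (s \<circ> w) = len (iv w \<circ> s)"
  using len_iv[of "s \<circ> w"] by (simp add: iv_comp)

lemma lift_left:
  assumes "x \<preceq> y" "y \<in> W" "s \<in> S" "len (s \<circ> y) < len y"
  shows "s \<circ> x \<preceq> y" "len x < len (s \<circ> x) \<Longrightarrow> x \<preceq> s \<circ> y" "len (s \<circ> x) < len x \<Longrightarrow> s \<circ> x \<preceq> s \<circ> y"
proof -
  have x: "x \<in> W" using bruhat_W assms by blast
  have c: "iv x \<preceq> iv y" using bruhat_iv assms by blast
  have e: "iv x \<circ> s = iv (s \<circ> x)" "iv y \<circ> s = iv (s \<circ> y)"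
    using x assms by (simp_all add: iv_comp)
  have l: "len (iv y \<circ> s) < len (iv y)" using assms x e by simp
  show "s \<circ> x \<preceq> y"
    using lift_up[OF c _ assms(3) l] assms x by (simp add: e bruhat_iv_iff)
  show "len x < len (s \<circ> x) \<Longrightarrow> x \<preceq> s \<circ> y"
    using lift_le[OF c _ assms(3) l] assms x by (simp add: e bruhat_iv_iff)
  show "len (s \<circ> x) < len x \<Longrightarrow> s \<circ> x \<preceq> s \<circ> y"
    using lift_both[OF c _ assms(3) l] assms x by (simp add: e bruhat_iv_iff)
qed

lemma right_descent_exists:
  assumes "w \<in> W" "w \<noteq> id"
  obtains s where "s \<in> S" "len w = Suc (len (w \<circ> s))"
proof -
  from assms(1) obtain ss where ss: "is_reduced_word S w ss" by (rule reduced_word_exists)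
  then have "ss \<noteq> []" using assms by (auto simp: is_reduced_word_def)
  then obtain ts s where ts: "ss = ts @ [s]" by (metis rev_exhaust)
  then have "s \<in> S" "w \<circ> s = word_prod ts" "ts \<in> lists S"
    using ss by (auto simp: is_reduced_word_def comp_assoc)
  with ss ts len_le[of ts] have "len (w \<circ> s) < len w"
    by (auto simp: is_reduced_word_def)
  then show ?thesis
    using that \<open>s \<in> S\<close> assms(1) len_comp_simple_cases[of w s] by (metis less_Suc_eq not_less_eq)
qed

lemma left_descent_exists:
  assumes "w \<in> W" "w \<noteq> id"
  obtains s where "s \<in> S" "len w = Suc (len (s \<circ> w))"
proof -
  have "iv w \<noteq> id" using assms len_eq_0[of w] len_iv[of w] by (metis len_id)
  then obtain s where "s \<in> S" "len (iv w) = Suc (len (iv w \<circ> s))"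
    using right_descent_exists[of "iv w"] assms by auto
  then show ?thesis using that assms by (simp add: len_simple_comp)
qed

lemma id_bruhat: "w \<in> W \<Longrightarrow> id \<preceq> w"
proof (induction "len w" arbitrary: w)
  case (Suc n)
  then obtain s where "s \<in> S" "len w = Suc (len (w \<circ> s))"
    using right_descent_exists[of w] by (metis len_id nat.distinct(1))
  then show ?case
    using Suc bruhat_simple'[of w s] bruhat_trans by (metis comp_in_W lessI nat.inject simple_in_W)
qed simp

end

context reflection_group
begin

subsection \<open>Parabolic subgroups\<close>

lemma parabolic_id [simp]: "id \<in> parabolic J"
  unfolding parabolic_def by (rule image_eqI[of _ _ "[]"]) auto

lemma parabolic_comp: "a \<in> parabolic J \<Longrightarrow> b \<in> parabolic J \<Longrightarrow> a \<circ> b \<in> parabolic J"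
proof -
  assume "a \<in> parabolic J" "b \<in> parabolic J"
  then obtain ss ts where "ss \<in> lists J" "ts \<in> lists J" "a = word_prod ss" "b = word_prod ts"
    by (auto simp: parabolic_def)
  then have "ss @ ts \<in> lists J" "a \<circ> b = word_prod (ss @ ts)" by auto
  then show ?thesis unfolding parabolic_def by blast
qed

lemma parabolic_gen: "s \<in> J \<Longrightarrow> s \<in> parabolic J"
  unfolding parabolic_def by (rule image_eqI[of _ _ "[s]"]) auto

lemma parabolic_W: "J \<subseteq> S \<Longrightarrow> a \<in> parabolic J \<Longrightarrow> a \<in> W"
  unfolding parabolic_def using W_words lists_mono[of J S] by blast

lemma parabolic_iv: "J \<subseteq> S \<Longrightarrow> a \<in> parabolic J \<Longrightarrow> iv a \<in> parabolic J"
proof -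
  assume J: "J \<subseteq> S" "a \<in> parabolic J"
  then obtain ss where ss: "ss \<in> lists J" "a = word_prod ss"
    by (auto simp: parabolic_def)
  then have "word_prod (rev ss) = iv a"
    using word_prod_rev[of ss] J lists_mono[of J S] by blast
  moreover have "rev ss \<in> lists J" using ss by (auto simp: in_lists_conv_set)
  ultimately show ?thesis unfolding parabolic_def by (metis imageI)
qed

lemma parabolic_S: "parabolic S = W"
  by (simp add: parabolic_def flip: W_words)

definition coset_minimal :: "('k ^ 'n \<Rightarrow> 'k ^ 'n) set \<Rightarrow> ('k ^ 'n \<Rightarrow> 'k ^ 'n) \<Rightarrow> bool" where
  "coset_minimal J x \<longleftrightarrow> x \<in> W \<and> (\<forall>a\<in>parabolic J. len x \<le> len (x \<circ> a))"

text \<open>If appending a letter shortened the product, the exchange property would delete a letter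
  either of \<open>x\<close> or of the \<open>J\<close>-word, and each is excluded by a minimality
  assumption. For \<open>x = id\<close> this says that a shortest \<open>J\<close>-word is reduced
  in \<open>W\<close>.\<close>

lemma coset_minimal_len_word:
  assumes J: "J \<subseteq> S" and x: "coset_minimal J x" and "ss \<in> lists J"
    and min: "\<And>ts. ts \<in> lists J \<Longrightarrow> word_prod ts = word_prod ss \<Longrightarrow> length ss \<le> length ts"
  shows "len (x \<circ> word_prod ss) = len x + length ss"
  using assms(3) min
proof (induction ss rule: rev_induct)
  case Nil
  then show ?case by simp
next
  case (snoc s ss)
  have xW: "x \<in> W" using x by (simp add: coset_minimal_def)
  have sJ: "s \<in> J" "ss \<in> lists J" using snoc.prems(1) by auto
  then have sS: "s \<in> S" "ss \<in> lists S" using J lists_mono[of J S] by auto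
  define p where "p = word_prod ss"
  have pW: "p \<in> W" using sS by (simp add: p_def)
  have pJ: "p \<in> parabolic J" using sJ by (auto simp: p_def parabolic_def)
  have IH: "len (x \<circ> p) = len x + length ss"
    unfolding p_def
  proof (rule snoc.IH[OF sJ(2)])
    fix ts assume "ts \<in> lists J" "word_prod ts = word_prod ss"
    then show "length ss \<le> length ts"
      using snoc.prems(2)[of "ts @ [s]"] sJ by simp
  qed
  have goal: "x \<circ> word_prod (ss @ [s]) = x \<circ> p \<circ> s" by (simp add: p_def comp_assoc)
  have "len (x \<circ> p \<circ> s) = Suc (len (x \<circ> p))"
  proof (rule ccontr)
    assume "len (x \<circ> p \<circ> s) \<noteq> Suc (len (x \<circ> p))"
    then have neg: "srt s \<circ> iv (x \<circ> p) \<notin> P"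
      using len_comp_simple_cases[of "x \<circ> p" s] xW pW sS by (metis comp_in_W)
    from xW obtain xs where xs: "is_reduced_word S x xs" by (rule reduced_word_exists)
    then have w: "xs @ ss \<in> lists S" "word_prod (xs @ ss) = x \<circ> p" "xs \<in> lists S" "word_prod xs = x" "length xs = len x"
      using sS by (auto simp: is_reduced_word_def p_def)
    obtain us r vs where e: "xs @ ss = us @ r # vs" "word_prod (us @ vs) = x \<circ> p \<circ> s"
      using exchange[OF w(1), of "srt s"] neg w(2) sS simple_root by metis
    then obtain zs where "xs = us @ zs \<and> zs @ ss = r # vs \<or> xs @ zs = us \<and> ss = zs @ r # vs"
      by (auto simp: append_eq_append_conv2)
    \<comment> \<open>The deletion inside \<open>x\<close> produces a shorter element of the same
      coset, namely \<open>x\<close> times the conjugate of \<open>s\<close> by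
      \<open>p\<close>.\<close>
    moreover have False if "xs = us @ r # vs'" "vs = vs' @ ss" for vs'
    proof -
      have l: "us @ vs' \<in> lists S" using that w by auto
      have "word_prod (us @ vs') \<circ> p = x \<circ> (p \<circ> s \<circ> iv p) \<circ> p"
        using e(2) that pW by (simp add: p_def[symmetric] comp_assoc)
      then have "word_prod (us @ vs') = x \<circ> (p \<circ> s \<circ> iv p)"
        using comp_cancel_right[OF pW] by blast
      moreover have "p \<circ> s \<circ> iv p \<in> parabolic J"
        by (rule parabolic_comp[OF parabolic_comp[OF pJ parabolic_gen[OF sJ(1)]] parabolic_iv[OF J pJ]])
      ultimately have "len x \<le> len (word_prod (us @ vs'))"
        using x by (simp add: coset_minimal_def)
      also have "\<dots> \<le> length (us @ vs')" by (rule len_le[OF l])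
      finally show False using w(5) that by simp
    qed
    \<comment> \<open>The deletion inside the \<open>J\<close>-word, after cancelling
      \<open>x\<close>, produces a shorter \<open>J\<close>-word with the same product.\<close>
    moreover have False if "us = xs @ zs" "ss = zs @ r # vs" for zs
    proof -
      have "x \<circ> word_prod (zs @ vs) = x \<circ> word_prod (ss @ [s])"
        using e(2) that w(4) goal by (simp add: comp_assoc)
      then have "word_prod (zs @ vs) = word_prod (ss @ [s])"
        using comp_cancel_left[OF xW] by blast
      moreover have "zs @ vs \<in> lists J" using that sJ by auto
      ultimately show False using snoc.prems(2)[of "zs @ vs"] that by simp
    qed
    ultimately show False
      by (metis append.right_neutral append_Cons append_Nil append_eq_Cons_conv)
  qed
  then have "len (x \<circ> word_prod (ss @ [s])) = len x + length (ss @ [s])"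
    unfolding goal IH by simp
  then show ?case .
qed

lemma parabolic_min_word:
  assumes "a \<in> parabolic J"
  obtains ss where "ss \<in> lists J" "word_prod ss = a"
    "\<And>ts. ts \<in> lists J \<Longrightarrow> word_prod ts = word_prod ss \<Longrightarrow> length ss \<le> length ts"
proof -
  obtain ss where "ss \<in> lists J \<and> word_prod ss = a" using assms by (auto simp: parabolic_def)
  from ex_has_least_nat[of "\<lambda>ss. ss \<in> lists J \<and> word_prod ss = a", OF this, of length]
  show ?thesis using that by blast
qed

lemma coset_minimal_id: "J \<subseteq> S \<Longrightarrow> coset_minimal J id"
  by (simp add: coset_minimal_def)

lemma parabolic_reduced_word:
  assumes "J \<subseteq> S" "a \<in> parabolic J"
  obtains ss where "ss \<in> lists J" "is_reduced_word S a ss"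
proof -
  obtain ss where ss: "ss \<in> lists J" "word_prod ss = a"
    "\<And>ts. ts \<in> lists J \<Longrightarrow> word_prod ts = word_prod ss \<Longrightarrow> length ss \<le> length ts"
    using parabolic_min_word[OF assms(2)] by blast
  then have "len a = length ss"
    using coset_minimal_len_word[OF assms(1) coset_minimal_id[OF assms(1)] ss(1,3)] by simp
  then have "is_reduced_word S a ss"
    using ss assms lists_mono[of J S] by (auto simp: is_reduced_word_def)
  then show ?thesis using that ss by blast
qed

lemma coset_minimal_len:
  assumes "J \<subseteq> S" "coset_minimal J x" "a \<in> parabolic J"
  shows "len (x \<circ> a) = len x + len a"
proof -
  obtain ss where ss: "ss \<in> lists J" "word_prod ss = a"
    "\<And>ts. ts \<in> lists J \<Longrightarrow> word_prod ts = word_prod ss \<Longrightarrow> length ss \<le> length ts"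
    using parabolic_min_word[OF assms(3)] by blast
  show ?thesis
    using coset_minimal_len_word[OF assms(1,2) ss(1,3)]
      coset_minimal_len_word[OF assms(1) coset_minimal_id[OF assms(1)] ss(1,3)] ss(2) by simp
qed

lemma parabolic_descent:
  assumes "J \<subseteq> S" "a \<in> parabolic J" "a \<noteq> id"
  obtains s where "s \<in> J" "a \<circ> s \<in> parabolic J" "len a = Suc (len (a \<circ> s))"
proof -
  obtain ss where ss: "ss \<in> lists J" "is_reduced_word S a ss"
    using parabolic_reduced_word[OF assms(1,2)] .
  then have "ss \<noteq> []" using assms(3) by (auto simp: is_reduced_word_def)
  then obtain ts s where ts: "ss = ts @ [s]" by (metis rev_exhaust)
  then have s: "s \<in> J" "s \<in> S" "ts \<in> lists S" "ts \<in> lists J" "a \<circ> s = word_prod ts"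
    using ss assms(1) lists_mono[of J S] by (auto simp: is_reduced_word_def)
  then have "len (a \<circ> s) < len a"
    using len_le[of ts] ss ts by (simp add: is_reduced_word_def)
  moreover have "a \<in> W" using parabolic_W assms by blast
  ultimately have "len a = Suc (len (a \<circ> s))"
    using len_comp_simple_cases[of a s] s by (metis less_Suc_eq not_less_eq)
  moreover have "a \<circ> s \<in> parabolic J"
    using s by (auto simp: parabolic_def)
  ultimately show ?thesis using that s by blast
qed

lemma coset_minimal_exists:
  assumes "J \<subseteq> S" "w \<in> W"
  obtains x a where "coset_minimal J x" "a \<in> parabolic J" "w = x \<circ> a"
proof -
  from ex_has_least_nat[of "\<lambda>a. a \<in> parabolic J" id "\<lambda>a. len (w \<circ> a)"]
  obtain a where a: "a \<in> parabolic J" "\<And>b. b \<in> parabolic J \<Longrightarrow> len (w \<circ> a) \<le> len (w \<circ> b)"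
    by (auto simp del: comp_apply)
  have aW: "a \<in> W" using parabolic_W assms a by blast
  have "coset_minimal J (w \<circ> a)"
    unfolding coset_minimal_def using a assms aW by (simp add: parabolic_comp comp_assoc)
  moreover have "w = w \<circ> a \<circ> iv a" using aW by (simp add: comp_assoc)
  ultimately show ?thesis using that parabolic_iv[OF assms(1) a(1)] by blast
qed

text \<open>The left side tests single letters of \<open>J\<close>, the right side the whole coset.
  Length additivity bridges the gap: a nontrivial parabolic factor would contribute its own
  descent.\<close>

lemma min_reps_iff: "J \<subseteq> S \<Longrightarrow> u \<in> min_reps W S J \<longleftrightarrow> coset_minimal J u"
proof
  assume J: "J \<subseteq> S" and u: "u \<in> min_reps W S J"
  then have uW: "u \<in> W" by (simp add: min_reps_def)
  obtain x a where x: "coset_minimal J x" "a \<in> parabolic J" "u = x \<circ> a"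
    using coset_minimal_exists[OF J uW] .
  have "a = id"
  proof (rule ccontr)
    assume "a \<noteq> id"
    then obtain s where s: "s \<in> J" "a \<circ> s \<in> parabolic J" "len a = Suc (len (a \<circ> s))"
      using parabolic_descent[OF J x(2)] by blast
    then have "len (u \<circ> s) < len u"
      using coset_minimal_len[OF J x(1)] x by (simp add: comp_assoc)
    then show False using u s J by (auto simp: min_reps_def descents_def)
  qed
  then show "coset_minimal J u" using x by simp
next
  assume J: "J \<subseteq> S" and u: "coset_minimal J u"
  then have "len u \<le> len (u \<circ> s)" if "s \<in> J" for s
    using that parabolic_gen by (auto simp: coset_minimal_def)
  then show "u \<in> min_reps W S J"
    using u by (force simp: min_reps_def descents_def coset_minimal_def)
qed

lemma min_reps_W: "u \<in> min_reps W S J \<Longrightarrow> u \<in> W"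
  by (simp add: min_reps_def)

lemma min_reps_len: "J \<subseteq> S \<Longrightarrow> x \<in> min_reps W S J \<Longrightarrow> a \<in> parabolic J \<Longrightarrow> len (x \<circ> a) = len x + len a"
  using coset_minimal_len min_reps_iff by blast

lemma min_reps_exists:
  assumes "J \<subseteq> S" "w \<in> W"
  obtains x a where "x \<in> min_reps W S J" "a \<in> parabolic J" "w = x \<circ> a"
  using coset_minimal_exists[OF assms] min_reps_iff[OF assms(1)] by metis

lemma min_reps_ascent: "J \<subseteq> S \<Longrightarrow> u \<in> min_reps W S J \<Longrightarrow> s \<in> J \<Longrightarrow> len (u \<circ> s) = Suc (len u)"
  using min_reps_len[of J u s] parabolic_gen[of s J] len_simple[of s] by auto

lemma min_reps_unique:
  assumes "J \<subseteq> S" "x \<in> min_reps W S J" "y \<in> min_reps W S J" "a \<in> parabolic J" "y = x \<circ> a"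
  shows "y = x"
proof -
  have aW: "a \<in> W" using assms parabolic_W by blast
  have "x = y \<circ> iv a" using assms aW by (simp add: comp_assoc)
  then have "len x = len y + len a"
    using min_reps_len[OF assms(1,3) parabolic_iv[OF assms(1,4)]] aW by simp
  then have "len a = 0" using min_reps_len[OF assms(1,2,4)] assms(5) by simp
  then show ?thesis using aW assms(5) by simp
qed

text \<open>Letters of \<open>a\<close> are stripped from the right. They are ascents of
  \<open>u\<close>, so lifting keeps \<open>u\<close> below the remaining product.\<close>

lemma bruhat_min_rep:
  assumes "J \<subseteq> S" "u \<in> min_reps W S J" "x \<in> min_reps W S J" "a \<in> parabolic J" "u \<preceq> x \<circ> a"
  shows "u \<preceq> x"
  using assms(4,5)
proof (induction "len a" arbitrary: a rule: less_induct)
  case less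
  show ?case
  proof (cases "a = id")
    case False
    then obtain s where s: "s \<in> J" "a \<circ> s \<in> parabolic J" "len a = Suc (len (a \<circ> s))"
      using parabolic_descent[OF assms(1) less.prems(1)] by blast
    have W: "x \<circ> a \<in> W" using assms less.prems parabolic_W min_reps_W by (metis comp_in_W)
    have "len (x \<circ> a \<circ> s) < len (x \<circ> a)"
      using min_reps_len[OF assms(1,3)] less.prems s by (simp add: comp_assoc)
    moreover have "len u < len (u \<circ> s)"
      using min_reps_ascent[OF assms(1,2) s(1)] by simp
    ultimately have "u \<preceq> x \<circ> a \<circ> s"
      using lift_le[of u "x \<circ> a" s] less.prems W s assms(1) by blast
    then show ?thesis using less.hyps[of "a \<circ> s"] s by (simp add: comp_assoc)
  qed (use less.prems in simp)
qed

lemma min_rep_le: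
  assumes "J \<subseteq> S" "x \<in> min_reps W S J" "a \<in> parabolic J"
  shows "x \<preceq> x \<circ> a"
  using assms(3)
proof (induction "len a" arbitrary: a rule: less_induct)
  case less
  show ?case
  proof (cases "a = id")
    case False
    then obtain s where s: "s \<in> J" "a \<circ> s \<in> parabolic J" "len a = Suc (len (a \<circ> s))"
      using parabolic_descent[OF assms(1) less.prems(1)] by blast
    have W: "x \<circ> a \<in> W" using assms less.prems parabolic_W min_reps_W by (metis comp_in_W)
    have "len (x \<circ> a \<circ> s) < len (x \<circ> a)"
      using min_reps_len[OF assms(1,2)] less.prems s by (simp add: comp_assoc)
    then have "x \<circ> a \<circ> s \<preceq> x \<circ> a"
      using bruhat_simple' W s assms(1) by blast
    moreover have "x \<preceq> x \<circ> a \<circ> s" using less.hyps[of "a \<circ> s"] s by (simp add: comp_assoc)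
    ultimately show ?thesis by (rule bruhat_trans[rotated])
  qed simp
qed

lemma coset_min_eq:
  assumes "J \<subseteq> S" "x \<in> min_reps W S J" "a \<in> parabolic J"
  shows "coset_min W S J (parabolic_coset J (x \<circ> a)) = x"
  unfolding coset_min_def
proof (rule the_equality)
  have aW: "a \<in> W" using assms parabolic_W by blast
  have "x = x \<circ> a \<circ> iv a" using aW by (simp add: comp_assoc)
  then show "x \<in> parabolic_coset J (x \<circ> a) \<and> x \<in> min_reps W S J"
    unfolding parabolic_coset_def using assms parabolic_iv by blast
next
  fix y assume y: "y \<in> parabolic_coset J (x \<circ> a) \<and> y \<in> min_reps W S J"
  then obtain b where "b \<in> parabolic J" "y = x \<circ> (a \<circ> b)"
    by (auto simp: parabolic_coset_def comp_assoc)
  then show "y = x"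
    using min_reps_unique[OF assms(1,2)] y assms(3) parabolic_comp by blast
qed

text \<open>The lifting property applied letter by letter: an element with all of \<open>J\<close>
  as descents absorbs right multiplication by the parabolic subgroup.\<close>

lemma descents_up_closed:
  assumes "J \<subseteq> S" "y \<in> W" "\<And>s. s \<in> J \<Longrightarrow> len (y \<circ> s) < len y" "a \<in> parabolic J" "x \<preceq> y"
  shows "x \<circ> a \<preceq> y"
proof -
  have "x \<circ> word_prod ss \<preceq> y" if "ss \<in> lists J" "x \<preceq> y" for ss
    using that
  proof (induction ss arbitrary: x)
    case (Cons s ss)
    have "x \<circ> s \<preceq> y" using lift_up[OF Cons.prems assms(2) _ assms(3)] Cons.hyps assms(1) by blast
    from Cons.IH[OF this] show ?case by (simp add: comp_assoc)
  qed simp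
  then show ?thesis using assms(4,5) by (auto simp: parabolic_def)
qed

text \<open>An element of maximal length in its coset has all of \<open>J\<close> as descents, hence
  dominates the coset in Bruhat order. Antisymmetry then gives the uniqueness that the definite
  description requires.\<close>

lemma coset_max:
  assumes J: "J \<subseteq> S" and w: "w \<in> W" and y: "y = coset_max S (parabolic_coset J w)"
  shows "y \<in> W" "y \<in> parabolic_coset J w" "\<And>s. s \<in> J \<Longrightarrow> len (y \<circ> s) < len y"
    "\<And>z. z \<in> parabolic_coset J w \<Longrightarrow> z \<preceq> y"
proof -
  let ?A = "parabolic_coset J w"
  have sub: "?A \<subseteq> W" using w J parabolic_W by (auto simp: parabolic_coset_def)
  have closed: "z \<circ> a \<in> ?A" if "z \<in> ?A" "a \<in> parabolic J" for z a
  proof -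
    obtain b where "b \<in> parabolic J" "z = w \<circ> b" using \<open>z \<in> ?A\<close> by (auto simp: parabolic_coset_def)
    then have "z \<circ> a = w \<circ> (b \<circ> a)" "b \<circ> a \<in> parabolic J"
      using parabolic_comp[OF _ \<open>a \<in> parabolic J\<close>] by (auto simp: comp_assoc)
    then show ?thesis unfolding parabolic_coset_def by blast
  qed
  have trans: "\<exists>a\<in>parabolic J. z' = z \<circ> a" if zz: "z \<in> ?A" "z' \<in> ?A" for z z'
  proof -
    obtain a b where ab: "a \<in> parabolic J" "b \<in> parabolic J" "z = w \<circ> a" "z' = w \<circ> b"
      using zz by (auto simp: parabolic_coset_def)
    have "z' = z \<circ> (iv a \<circ> b)"
      using ab w parabolic_W[OF J] by (simp add: comp_assoc) (simp flip: comp_assoc)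
    then show ?thesis using parabolic_comp parabolic_iv[OF J] ab by blast
  qed
  have dom: "(\<forall>s\<in>J. len (m \<circ> s) < len m) \<and> (\<forall>z\<in>?A. z \<preceq> m)"
    if m: "m \<in> ?A" "\<forall>v\<in>?A. len v \<le> len m" for m
  proof -
    have mW: "m \<in> W" using m sub by blast
    have d: "len (m \<circ> s) < len m" if "s \<in> J" for s
      using m closed[OF m(1) parabolic_gen[OF that]] len_comp_simple_cases[OF mW, of s] that J
      by (metis lessI not_less_eq_eq subsetD)
    have "z \<preceq> m" if "z \<in> ?A" for z
      using trans[OF m(1) that] descents_up_closed[OF J mW d _ bruhat_refl] by blast
    with d show ?thesis by blast
  qed
  have "finite ?A" using sub finite_W by (rule finite_subset)
  moreover have "w \<circ> id \<in> ?A" unfolding parabolic_coset_def using parabolic_id by blast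
  ultimately have "finite (len ` ?A)" "len ` ?A \<noteq> {}" by auto
  note fin = this
  from Max_in[OF this] obtain m where m1: "m \<in> ?A" "Max (len ` ?A) = len m" by (rule imageE)
  have m2: "\<forall>v\<in>?A. len v \<le> len m"
    unfolding m1(2)[symmetric] using Max_ge[OF fin(1)] by blast
  note m = m1(1) m2
  have "y = m"
    unfolding y coset_max_def
  proof (rule the_equality)
    show "m \<in> ?A \<and> (\<forall>v\<in>?A. len v \<le> len m)" using m by blast
    show "m' = m" if "m' \<in> ?A \<and> (\<forall>v\<in>?A. len v \<le> len m')" for m'
      using dom[OF m] dom[of m'] m that bruhat_antisym by blast
  qed
  then show "y \<in> W" "y \<in> ?A" "\<And>s. s \<in> J \<Longrightarrow> len (y \<circ> s) < len y" "\<And>z. z \<in> ?A \<Longrightarrow> z \<preceq> y"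
    using m dom[OF m] sub by auto
qed

section \<open>The longest element\<close>

definition w0 :: "'k ^ 'n \<Rightarrow> 'k ^ 'n" where
  "w0 = longest_element W S"

text \<open>The longest element is the case \<open>J = S\<close>, so its existence and dominance
  come from \<open>coset_max\<close>.\<close>

lemma w0_eq: "w0 = coset_max S (parabolic_coset S id)"
  unfolding w0_def longest_element_def coset_max_def parabolic_coset_def by (simp add: parabolic_S)

lemma w0_in_W [simp]: "w0 \<in> W" and w0_max: "z \<in> W \<Longrightarrow> z \<preceq> w0"
  using coset_max[OF _ _ w0_eq] by (auto simp: parabolic_coset_def parabolic_S)

lemma w0_unique:
  assumes "z \<in> W" "\<And>s. s \<in> S \<Longrightarrow> len (z \<circ> s) < len z"
  shows "z = w0"
proof -
  have "z \<circ> (iv z \<circ> w0) \<preceq> z"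
    using assms by (intro descents_up_closed[of S]) (auto simp: parabolic_S)
  then have "w0 \<preceq> z" using assms by (simp flip: comp_assoc)
  then show ?thesis using w0_max assms bruhat_antisym by blast
qed

lemma w0_neg: "\<gamma> \<in> P \<Longrightarrow> \<gamma> \<circ> iv w0 \<notin> P"
  using len_less_iff[of w0 \<gamma>] bruhat_len[OF w0_max[of "w0 \<circ> trefl \<gamma>"]] by auto

lemma w0_neg_iff: "\<gamma> \<in> \<Phi> \<Longrightarrow> \<gamma> \<circ> w0 \<in> P \<longleftrightarrow> \<gamma> \<notin> P"
proof -
  assume g: "\<gamma> \<in> \<Phi>"
  have c: "\<gamma> \<circ> w0 \<circ> iv w0 = \<gamma>" by (simp add: comp_assoc)
  have 1: "\<gamma> \<notin> P" if "\<gamma> \<circ> w0 \<in> P"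
    using w0_neg[OF that] c by simp
  have 2: "\<gamma> \<in> P" if "\<gamma> \<circ> w0 \<notin> P"
  proof -
    have "(\<lambda>v. - (\<gamma> \<circ> w0) v) \<in> P" using neg_pos_iff[of "\<gamma> \<circ> w0"] g that by simp
    from w0_neg[OF this] have "(\<lambda>v. - \<gamma> v) \<notin> P"
      by (simp add: comp_def)
    then show ?thesis using neg_pos_iff[OF g] by blast
  qed
  from 1 2 show ?thesis by blast
qed

text \<open>Multiplication by \<open>w0\<close> on the right interchanges ascents and descents:
  right descents of \<open>u\<close> become left ascents of \<open>iv u \<circ> w0\<close>. This is
  what makes divided differences lower Schubert polynomials.\<close>

lemma schubert_index_step:
  assumes "u \<in> W" "s \<in> S"
  shows "len (u \<circ> s) < len u \<longleftrightarrow> len (iv u \<circ> w0) < len (iv (u \<circ> s) \<circ> w0)"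
proof -
  have e: "iv (u \<circ> s) \<circ> w0 = s \<circ> (iv u \<circ> w0)" using assms by (simp add: iv_comp comp_assoc)
  have "srt s \<circ> (iv u \<circ> w0) \<in> P \<longleftrightarrow> srt s \<circ> iv u \<notin> P"
    using w0_neg_iff[of "srt s \<circ> iv u"] assms by (simp add: comp_assoc)
  then show ?thesis
    unfolding e using len_comp_simple_cases[OF assms] len_simple_comp_cases[of "iv u \<circ> w0" s] assms
    by (metis comp_in_W iv_in_W lessI less_asym w0_in_W)
qed

subsection \<open>Inversions\<close>

definition invs :: "('k ^ 'n \<Rightarrow> 'k ^ 'n) \<Rightarrow> ('k ^ 'n \<Rightarrow> 'k) set" where
  "invs w = {\<gamma> \<in> P. \<gamma> \<circ> iv w \<notin> P}"

lemma finite_invs [simp]: "finite (invs w)"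
  unfolding invs_def by simp

lemma invs_simple_comp:
  assumes "s \<in> S" "w \<in> W" "srt s \<circ> w \<in> P"
  shows "invs (s \<circ> w) = insert (srt s \<circ> w) (invs w)" "srt s \<circ> w \<notin> invs w"
proof -
  have c: "srt s \<circ> w \<circ> iv w = srt s" using assms by (simp add: comp_assoc)
  then show "srt s \<circ> w \<notin> invs w"
    using assms by (simp add: invs_def simple_root)
  have eq: "\<gamma> \<circ> iv (s \<circ> w) = \<gamma> \<circ> iv w \<circ> s" for \<gamma> :: "'k ^ 'n \<Rightarrow> 'k"
    using assms by (simp add: iv_comp comp_assoc)
  have shift: "\<gamma> = \<beta> \<circ> w" if "\<gamma> \<circ> iv w = \<beta>" for \<gamma> \<beta> :: "'k ^ 'n \<Rightarrow> 'k"
    using that assms by (auto simp: comp_assoc)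
  have "\<gamma> \<circ> iv w \<circ> s \<notin> P \<longleftrightarrow> \<gamma> = srt s \<circ> w \<or> \<gamma> \<circ> iv w \<notin> P" if g: "\<gamma> \<in> P" for \<gamma>
  proof (cases "\<gamma> \<circ> iv w \<in> P")
    case True
    have "(\<lambda>v. - srt s v) \<notin> P" using neg_pos_iff[of "srt s"] simple_root assms by simp
    then have "srt s \<circ> s \<notin> P" using srt_simple assms by simp
    then show ?thesis
      using simple_permutes_pos[OF assms(1) True] shift[of \<gamma> "srt s"] True c by metis
  next
    case False
    have r: "\<gamma> \<circ> iv w \<in> \<Phi>" using g assms by simp
    have n: "(\<lambda>v. - (\<gamma> \<circ> iv w) v) \<in> P" using neg_pos_iff[OF r] False by simp
    have "(\<lambda>v. - (\<gamma> \<circ> iv w) v) \<noteq> srt s"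
    proof
      assume "(\<lambda>v. - (\<gamma> \<circ> iv w) v) = srt s"
      then have "srt s (w x) = - \<gamma> (iv w (w x))" for x by (auto simp: fun_eq_iff)
      then have "\<gamma> = (\<lambda>v. - (srt s \<circ> w) v)"
        using assms(2) by (simp add: fun_eq_iff)
      then show False using g neg_pos_iff[of "srt s \<circ> w"] assms by simp
    qed
    then have "(\<lambda>v. - (\<gamma> \<circ> iv w) v) \<circ> s \<in> P"
      by (rule simple_permutes_pos[OF assms(1) n])
    moreover have "(\<lambda>v. - (\<gamma> \<circ> iv w) v) \<circ> s = (\<lambda>v. - (\<gamma> \<circ> iv w \<circ> s) v)" by auto
    ultimately have "\<gamma> \<circ> iv w \<circ> s \<notin> P"
      using neg_pos_iff[of "\<gamma> \<circ> iv w \<circ> s"] r assms by (metis root_o simple_in_W)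
    then show ?thesis using False by blast
  qed
  then show "invs (s \<circ> w) = insert (srt s \<circ> w) (invs w)"
    unfolding invs_def eq using assms(3) by blast
qed

lemma len_le_card_invs: "w \<in> W \<Longrightarrow> len w \<le> card (invs w)"
proof (induction "len w" arbitrary: w)
  case (Suc n)
  then have "w \<noteq> id" by auto
  then obtain s where s: "s \<in> S" "len w = Suc (len (s \<circ> w))"
    using left_descent_exists Suc.prems by blast
  have w: "w = s \<circ> (s \<circ> w)" "s \<circ> w \<in> W" using s Suc.prems by simp_all
  have "srt s \<circ> (s \<circ> w) \<in> P"
    using len_simple_comp_cases[of "s \<circ> w" s] s w by (metis lessI less_asym)
  then have "card (invs w) = Suc (card (invs (s \<circ> w)))"
    using invs_simple_comp[of s "s \<circ> w"] s w by simp
  then show ?case using Suc.hyps(1)[of "s \<circ> w"] Suc.hyps(2) s w by simp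
qed simp

text \<open>An element other than \<open>w0\<close> has an ascent \<open>s\<close>, whose simple
  root is not an inversion. The bound will show that shorter operators cannot bring the product of
  the positive roots down to degree zero.\<close>

lemma len_less_card_P:
  assumes "w \<in> W" "w \<noteq> w0"
  shows "len w < card P"
proof -
  obtain s where s: "s \<in> S" "\<not> len (w \<circ> s) < len w" using w0_unique assms by blast
  then have "srt s \<circ> iv w \<in> P" using len_comp_simple_cases[OF assms(1) s(1)] by auto
  then have "invs w \<subset> P" using s simple_root(1)[of s] by (auto simp: invs_def)
  then have "card (invs w) < card P" by (simp add: psubset_card_mono)
  then show ?thesis using len_le_card_invs[OF assms(1)] by simp
qed

subsection \<open>Deodhar's criterion and essential sets\<close>

text \<open>The hypothesis says that the minimal representatives of \<open>x\<close> for all maximal parabolics are below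
  \<open>y\<close>. The induction strips a left descent of \<open>y\<close>.\<close>

lemma deodhar:
  assumes "y \<in> W" "x \<in> W"
    "\<And>r. r \<in> S \<Longrightarrow> \<exists>x'\<in>min_reps W S (S - {r}). \<exists>a\<in>parabolic (S - {r}). x = x' \<circ> a \<and> x' \<preceq> y"
  shows "x \<preceq> y"
  using assms
proof (induction "len y" arbitrary: y x rule: less_induct)
  case less
  have J: "S - {r} \<subseteq> S" for r by blast
  show ?case
  proof (cases "y = id")
    case True
    \<comment> \<open>Otherwise a descent \<open>r\<close> of \<open>x\<close> exists, while
      \<open>x' = id\<close> puts \<open>x\<close> in the parabolic subgroup without
      \<open>r\<close>. The exchange property would then put \<open>r\<close> there too, although
      its only reduced word is \<open>[r]\<close>.\<close>
    have "x = id"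
    proof (rule ccontr)
      assume "x \<noteq> id"
      then obtain r where r: "r \<in> S" "len x = Suc (len (x \<circ> r))"
        using right_descent_exists less.prems by blast
      let ?J = "S - {r}"
      obtain x' a where x': "x' \<in> min_reps W S ?J" "a \<in> parabolic ?J" "x = x' \<circ> a" "x' \<preceq> y"
        using less.prems(3)[OF r(1)] by blast
      then have "x' = id" using True bruhat_len[of x' y] by auto
      then have xJ: "x \<in> parabolic ?J" using x' by simp
      obtain ss where ss: "ss \<in> lists ?J" "is_reduced_word S x ss"
        using parabolic_reduced_word[OF J xJ] .
      have ss': "ss \<in> lists S" "word_prod ss = x" using ss by (auto simp: is_reduced_word_def)
      have "srt r \<circ> iv x \<notin> P"
        using len_comp_simple_cases[OF less.prems(2) r(1)] r(2) by (metis n_not_Suc_n nat.inject lessI less_asym)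
      then obtain us q vs where e: "ss = us @ q # vs" "word_prod (us @ vs) = x \<circ> r"
        using exchange[OF ss'(1), of "srt r"] ss' simple_root[OF r(1)] by metis
      have "us @ vs \<in> lists ?J" using e(1) ss(1) by auto
      then have "x \<circ> r \<in> parabolic ?J"
        unfolding parabolic_def e(2)[symmetric] by (rule imageI)
      then have "iv x \<circ> (x \<circ> r) \<in> parabolic ?J"
        by (rule parabolic_comp[OF parabolic_iv[OF J xJ]])
      then have rJ: "r \<in> parabolic ?J"
        using less.prems(2) by (simp flip: comp_assoc)
      obtain ts where ts: "ts \<in> lists ?J" "is_reduced_word S r ts"
        using parabolic_reduced_word[OF J rJ] .
      then have "length ts = 1" "word_prod ts = r" by (auto simp: is_reduced_word_def len_simple r)
      then have "ts = [r]" by (auto simp: length_Suc_conv)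
      then show False using ts by auto
    qed
    then show ?thesis using True by simp
  next
    case False
    then obtain s where s: "s \<in> S" "len y = Suc (len (s \<circ> y))"
      using left_descent_exists less.prems by blast
    have sy: "len (s \<circ> y) < len y" "s \<circ> y \<in> W" using s less.prems by auto
    show ?thesis
    proof (rule len_simple_comp_cases[OF less.prems(2) s(1)])
      assume up: "len (s \<circ> x) = Suc (len x)"
      have "x \<preceq> s \<circ> y"
      proof (rule less.hyps[OF sy less.prems(2)])
        fix r assume "r \<in> S"
        then obtain x' a where x': "x' \<in> min_reps W S (S - {r})" "a \<in> parabolic (S - {r})" "x = x' \<circ> a" "x' \<preceq> y"
          using less.prems(3) by blast
        have W: "x' \<in> W" "a \<in> W" using x' min_reps_W parabolic_W[OF J] by auto
        \<comment> \<open>If \<open>s\<close> lengthens \<open>x\<close>, it also lengthens the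
          minimal representative \<open>x'\<close>, so \<open>x'\<close> lifts below
          \<open>s \<circ> y\<close>.\<close>
        have "len (s \<circ> x) \<le> len (s \<circ> x') + len a"
          using len_comp_le[of "s \<circ> x'" a] W s x' by (simp add: comp_assoc)
        then have "len x' < len (s \<circ> x')"
          using up min_reps_len[OF J x'(1,2)] x'(3) by simp
        then have "x' \<preceq> s \<circ> y"
          using lift_left(2)[OF x'(4) less.prems(1) s(1) sy(1)] by blast
        then show "\<exists>x'\<in>min_reps W S (S - {r}). \<exists>a\<in>parabolic (S - {r}). x = x' \<circ> a \<and> x' \<preceq> s \<circ> y"
          using x' by blast
      qed
      moreover have "s \<circ> y \<preceq> y"
        using lift_left(1)[OF bruhat_refl less.prems(1) s(1) sy(1)] .
      ultimately show ?thesis by (rule bruhat_trans)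
    next
      assume down: "len x = Suc (len (s \<circ> x))"
      have sxW: "s \<circ> x \<in> W" using s less.prems by simp
      have "s \<circ> x \<preceq> s \<circ> y"
      proof (rule less.hyps[OF sy sxW])
        fix r assume "r \<in> S"
        let ?J = "S - {r}"
        obtain x' a where x': "x' \<in> min_reps W S ?J" "a \<in> parabolic ?J" "x = x' \<circ> a" "x' \<preceq> y"
          using less.prems(3)[OF \<open>r \<in> S\<close>] by blast
        have W: "x' \<in> W" "a \<in> W" using x' min_reps_W parabolic_W[OF J] by auto
        show "\<exists>x'\<in>min_reps W S ?J. \<exists>a\<in>parabolic ?J. s \<circ> x = x' \<circ> a \<and> x' \<preceq> s \<circ> y"
        proof (rule len_simple_comp_cases[OF W(1) s(1)])
          assume d: "len x' = Suc (len (s \<circ> x'))"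
          have "len (s \<circ> x') \<le> len (s \<circ> x' \<circ> q)" if q: "q \<in> ?J" for q
          proof -
            have "len (x' \<circ> q) = Suc (len x')" using min_reps_ascent[OF J x'(1) q] .
            moreover have "len (x' \<circ> q) \<le> 1 + len (s \<circ> (x' \<circ> q))"
              using len_comp_le[of s "s \<circ> (x' \<circ> q)"] W s q by (simp add: len_simple)
            ultimately show ?thesis using d by (simp add: comp_assoc)
          qed
          then have "s \<circ> x' \<in> min_reps W S ?J"
            using W s by (force simp: min_reps_def descents_def)
          moreover have "s \<circ> x' \<preceq> s \<circ> y"
            using lift_left(3)[OF x'(4) less.prems(1) s(1) sy(1)] d by simp
          moreover have "s \<circ> x = s \<circ> x' \<circ> a" using x'(3) by (simp add: comp_assoc)
          ultimately show ?thesis using x'(2) by blast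
        next
          \<comment> \<open>Here \<open>s \<circ> x'\<close> cannot be minimal, as lengths would add
            up to more than that of \<open>x\<close>. Since \<open>s\<close> turns only its own root
            negative among positive roots, \<open>s \<circ> x' = x' \<circ> q\<close> for some
            \<open>q\<close> in \<open>?J\<close>, and \<open>x'\<close> remains the
            representative.\<close>
          assume u: "len (s \<circ> x') = Suc (len x')" "srt s \<circ> x' \<in> P"
          have "s \<circ> x' \<notin> min_reps W S ?J"
            using min_reps_len[OF J _ x'(2)] min_reps_len[OF J x'(1,2)] u(1) down x'(3)
            by (metis comp_assoc add_Suc less_Suc_eq not_less_eq lessI)
          then obtain q where q: "q \<in> ?J" "q \<in> S" "len (s \<circ> x' \<circ> q) < len (s \<circ> x')"
            using W s by (auto simp: min_reps_def descents_def)
          have n: "srt q \<circ> iv (s \<circ> x') \<notin> P"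
            using len_comp_simple_cases[of "s \<circ> x'" q] q W s by (metis comp_in_W lessI less_asym simple_in_W)
          have p: "srt q \<circ> iv x' \<in> P"
            using len_comp_simple_cases[OF W(1) q(2)] min_reps_ascent[OF J x'(1) q(1)]
            by (metis lessI less_asym)
          have "srt q \<circ> iv x' \<circ> s \<notin> P"
            using n W s by (simp add: iv_comp comp_assoc)
          then have "srt q \<circ> iv x' = srt s"
            using simple_permutes_pos[OF s(1) p] by blast
          then have "s = x' \<circ> q \<circ> iv x'"
            using trefl_conj[OF W(1), of "srt q"] q s by (simp add: simple_root)
          then have "s \<circ> x' = x' \<circ> q \<circ> iv x' \<circ> x'" by (rule arg_cong[where f = "\<lambda>z. z \<circ> x'"])
          then have "s \<circ> x' = x' \<circ> q \<circ> (iv x' \<circ> x')" by (simp only: comp_assoc)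
          then have "s \<circ> x' = x' \<circ> q" using W by simp
          then have "s \<circ> x = x' \<circ> (q \<circ> a)"
            unfolding x'(3) by (simp flip: comp_assoc)
          moreover have "q \<circ> a \<in> parabolic ?J"
            by (rule parabolic_comp[OF parabolic_gen[OF q(1)] x'(2)])
          moreover have "x' \<preceq> s \<circ> y"
            using lift_left(2)[OF x'(4) less.prems(1) s(1) sy(1)] u by simp
          ultimately show ?thesis using x'(1) by blast
        qed
      qed
      then have "s \<circ> x \<preceq> y"
        using lift_left(1)[OF bruhat_refl less.prems(1) s(1) sy(1)] bruhat_trans by blast
      from lift_left(1)[OF this less.prems(1) s(1) sy(1)] show ?thesis
        using s by simp
    qed
  qed
qed

text \<open>Deodhar's criterion supplies a maximal parabolic for which the minimal representative of
  \<open>v\<close> is not below \<open>y\<close> either. By minimality of \<open>v\<close> that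
  representative is \<open>v\<close> itself.\<close>

lemma essential_descents:
  assumes "y \<in> W" "v \<in> essential_set W S y"
  obtains s where "s \<in> S" "descents S v = {s}"
proof -
  have v: "v \<in> W" "\<not> v \<preceq> y" "\<And>u. u \<in> W \<Longrightarrow> \<not> u \<preceq> y \<Longrightarrow> u \<preceq> v \<Longrightarrow> u = v"
    using assms(2) by (auto simp: essential_set_def)
  obtain r where r: "r \<in> S" "\<And>x' a. x' \<in> min_reps W S (S - {r}) \<Longrightarrow> a \<in> parabolic (S - {r}) \<Longrightarrow> v = x' \<circ> a \<Longrightarrow> \<not> x' \<preceq> y"
    using deodhar[OF assms(1) v(1)] v(2) by blast
  have J: "S - {r} \<subseteq> S" by blast
  obtain x' a where x': "x' \<in> min_reps W S (S - {r})" "a \<in> parabolic (S - {r})" "v = x' \<circ> a"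
    using min_reps_exists[OF J v(1)] .
  have "x' = v"
    using v(3)[of x'] r(2)[OF x'] min_rep_le[OF J x'(1,2)] x' min_reps_W by blast
  then have "descents S v \<subseteq> {r}" using x'(1) by (auto simp: min_reps_def descents_def)
  moreover have "v \<noteq> id" using id_bruhat[OF assms(1)] v(2) by blast
  then obtain s where "s \<in> S" "len v = Suc (len (v \<circ> s))" using right_descent_exists[OF v(1)] by blast
  then have "s \<in> descents S v" by (simp add: descents_def)
  ultimately have "descents S v = {r}" by blast
  then show ?thesis using that r by blast
qed

lemma essential_exists:
  assumes "u \<in> W" "\<not> u \<preceq> y"
  obtains v where "v \<in> essential_set W S y" "v \<preceq> u"
proof -
  have "\<exists>v. v \<in> essential_set W S y \<and> v \<preceq> u"
    using assms
  proof (induction "len u" arbitrary: u rule: less_induct)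
    case less
    show ?case
    proof (cases "u \<in> essential_set W S y")
      case False
      then obtain v where v: "v \<in> W" "\<not> v \<preceq> y" "v \<preceq> u" "v \<noteq> u"
        using less.prems by (auto simp: essential_set_def)
      then have "len v < len u" using bruhat_len by blast
      then show ?thesis using less.hyps v bruhat_trans by blast
    qed (use bruhat_refl in blast)
  qed
  then show ?thesis using that by blast
qed

text \<open>If \<open>s\<close> in \<open>J\<close> were a descent of \<open>u\<close>, then
  \<open>u \<circ> s\<close> would be below \<open>y\<close> by minimality of \<open>u\<close>, and
  lifting would put \<open>u\<close> below \<open>y\<close>.\<close>

lemma essential_min_reps:
  assumes J: "J \<subseteq> S" and y: "y \<in> W" "\<And>s. s \<in> J \<Longrightarrow> len (y \<circ> s) < len y"
  shows "essential_set W S y \<subseteq> min_reps W S J"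
proof
  fix u assume "u \<in> essential_set W S y"
  then have u: "u \<in> W" "\<not> u \<preceq> y" "\<And>v. v \<in> W \<Longrightarrow> \<not> v \<preceq> y \<Longrightarrow> v \<preceq> u \<Longrightarrow> v = u"
    by (auto simp: essential_set_def)
  have False if s: "s \<in> J" "len (u \<circ> s) < len u" for s
  proof -
    have sS: "s \<in> S" using s J by blast
    have "u \<circ> s \<preceq> y"
      using u(3)[of "u \<circ> s"] bruhat_simple'[OF u(1) sS s(2)] s(2) u(1) sS
      by (metis comp_in_W less_irrefl simple_in_W)
    then have "u \<circ> s \<circ> s \<preceq> y" using lift_up y s sS by blast
    then show False using u(2) sS by simp
  qed
  then show "u \<in> min_reps W S J" using u by (auto simp: min_reps_def descents_def)
qed

end

context reflection_group
begin

subsection \<open>The action on polynomials\<close>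

lemmas sym_eqI = ev_eqI[OF infinite_k]

lemma functional_comp: "w \<in> W \<Longrightarrow> linear_functional \<xi> \<Longrightarrow> linear_functional (\<xi> \<circ> w)"
  by unfold_locales (auto simp: W_apply_linear functional_linear algebra_simps)

lemma ev_act [simp]: "w \<in> W \<Longrightarrow> ev (act w f) v = ev f (iv w v)"
  by (simp add: act_eq_pullback ev_pullback W_linear)

lemma W_zero [simp]: "w \<in> W \<Longrightarrow> w 0 = 0"
  using W_apply_linear(2)[of w 0 0] by simp

lemma act_add: "w \<in> W \<Longrightarrow> act w (f + g) = act w f + act w g"
  and act_diff: "w \<in> W \<Longrightarrow> act w (f - g) = act w f - act w g"
  and act_mult: "w \<in> W \<Longrightarrow> act w (f * g) = act w f * act w g"
  and act_const: "w \<in> W \<Longrightarrow> act w (const c) = const c"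
  and act_zero: "w \<in> W \<Longrightarrow> act w 0 = 0"
  and act_sum: "w \<in> W \<Longrightarrow> act w (\<Sum>x\<in>X. h x) = (\<Sum>x\<in>X. act w (h x))"
  by (auto intro!: sym_eqI)

lemma act_id: "act id f = (f :: ('k, 'n) sym)"
  by (rule sym_eqI) simp

lemma act_comp: "u \<in> W \<Longrightarrow> v \<in> W \<Longrightarrow> act (u \<circ> v) f = act u (act v f)"
  by (rule sym_eqI) (simp add: iv_comp)

lemma act_lin_form: "w \<in> W \<Longrightarrow> linear_functional \<xi> \<Longrightarrow> act w (lin_form \<xi>) = lin_form (\<xi> \<circ> iv w)"
  by (rule sym_eqI) (simp add: functional_comp)

subsection \<open>Divided differences\<close>

abbreviation dd :: "('k ^ 'n \<Rightarrow> 'k ^ 'n) \<Rightarrow> ('k, 'n) sym \<Rightarrow> ('k, 'n) sym" where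
  "dd \<equiv> div_diff P"

lemma srt_cancel: "s \<in> S \<Longrightarrow> lin_form (srt s) * f = lin_form (srt s) * g \<Longrightarrow> f = g"
  using lin_form_cancel[OF infinite_k root_linear root_nonzero] srt_root by blast

text \<open>Makes the definite description in \<open>div_diff\<close> usable: the quotient exists by
  divisibility and is unique by cancellation.\<close>

lemma dd: "s \<in> S \<Longrightarrow> lin_form (srt s) * dd s f = f - act s f"
proof -
  assume s: "s \<in> S"
  have "s v = v - srt s v *s coroot (srt s)" for v
    using coroot(1)[of "srt s" v] s by (simp add: simple_root)
  from lin_form_dvd_diff_pullback[OF infinite_k root_linear[OF srt_root[OF s]] W_linear this]
  have "\<exists>g. lin_form (srt s) * g = f - act s f"
    using s by (simp add: act_eq_pullback)
  then have "\<exists>!g. lin_form (srt s) * g = f - act s f"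
    using srt_cancel[OF s] by metis
  from theI'[OF this] show ?thesis unfolding div_diff_def .
qed

lemma ddI: "s \<in> S \<Longrightarrow> lin_form (srt s) * g = f - act s f \<Longrightarrow> dd s f = g"
  using dd srt_cancel by metis

lemma dd_add: "s \<in> S \<Longrightarrow> dd s (f + g) = dd s f + dd s g"
  by (rule ddI) (simp_all add: distrib_left dd act_add)

lemma dd_mult: "s \<in> S \<Longrightarrow> dd s (f * g) = dd s f * g + act s f * dd s g"
proof (rule ddI)
  assume s: "s \<in> S"
  have "lin_form (srt s) * (dd s f * g + act s f * dd s g)
     = (lin_form (srt s) * dd s f) * g + act s f * (lin_form (srt s) * dd s g)"
    by (simp add: algebra_simps)
  also have "\<dots> = f * g - act s (f * g)"
    unfolding dd[OF s] using s by (simp add: act_mult algebra_simps)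
  finally show "lin_form (srt s) * (dd s f * g + act s f * dd s g) = f * g - act s (f * g)" .
qed

lemma dd_const [simp]: "s \<in> S \<Longrightarrow> dd s (const c) = 0"
  by (rule ddI) (simp_all add: act_const)

lemma dd_zero [simp]: "s \<in> S \<Longrightarrow> dd s 0 = 0"
  by (rule ddI) (simp_all add: act_zero)

lemma dd_const_mult: "s \<in> S \<Longrightarrow> dd s (const c * f) = const c * dd s f"
  by (simp add: dd_mult act_const)

lemma dd_lin_form: "s \<in> S \<Longrightarrow> linear_functional \<xi> \<Longrightarrow> dd s (lin_form \<xi>) = const (\<xi> (coroot (srt s)))"
proof (rule ddI)
  assume s: "s \<in> S" and l: "linear_functional \<xi>"
  have "s v = v - srt s v *s coroot (srt s)" for v
    using coroot(1)[of "srt s" v] s by (simp add: simple_root)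
  then show "lin_form (srt s) * const (\<xi> (coroot (srt s))) = lin_form \<xi> - act s (lin_form \<xi>)"
    using s l by (intro sym_eqI) (simp add: functional_linear root_linear)
qed

text \<open>Numerator and denominator of the divided difference both change sign under
  \<open>s\<close>.\<close>

lemma act_dd: "s \<in> S \<Longrightarrow> act s (dd s f) = dd s f"
proof -
  assume s: "s \<in> S"
  have "srt s v * ev (dd s f) v = ev f v - ev f (s v)" for v
    using arg_cong[OF dd[OF s, of f], of "\<lambda>f. ev f v"] s by (simp add: root_linear)
  note * = this
  have "srt s (s v) = - srt s v" for v
    using srt_simple[OF s] by (metis comp_apply)
  then have "srt s v * ev (dd s f) (s v) = ev f v - ev f (s v)" for v
    using *[of "s v"] s by (simp add: algebra_simps)
  then have "lin_form (srt s) * act s (dd s f) = lin_form (srt s) * dd s f"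
    using * s by (intro sym_eqI) (simp add: root_linear)
  then show ?thesis by (rule srt_cancel[OF s])
qed

lemma dd_dd [simp]: "s \<in> S \<Longrightarrow> dd s (dd s f) = 0"
  by (rule ddI) (simp_all add: act_dd)

lemma dd_eq_0_iff: "s \<in> S \<Longrightarrow> dd s f = 0 \<longleftrightarrow> act s f = f"
  using dd[of s f] ddI[of s 0 f] by auto

section \<open>Divided differences along words\<close>

abbreviation ddw :: "('k ^ 'n \<Rightarrow> 'k ^ 'n) list \<Rightarrow> ('k, 'n) sym \<Rightarrow> ('k, 'n) sym" where
  "ddw \<equiv> foldr dd"

abbreviation E :: "('k ^ 'n \<Rightarrow> 'k ^ 'n) \<Rightarrow> ('k, 'n) sym \<Rightarrow> ('k, 'n) sym" where
  "E \<equiv> div_diff_elt S P"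

lemma ddw_add: "ss \<in> lists S \<Longrightarrow> ddw ss (f + g) = ddw ss f + ddw ss g"
  by (induction ss arbitrary: f g) (auto simp: dd_add)

lemma ddw_zero: "ss \<in> lists S \<Longrightarrow> ddw ss 0 = 0"
  by (induction ss) auto

lemma ddw_const: "ss \<in> lists S \<Longrightarrow> ss \<noteq> [] \<Longrightarrow> ddw ss (const c) = 0"
  by (induction ss) (auto, metis dd_const foldr_Nil id_apply dd_zero)

lemma ddw_const_mult: "ss \<in> lists S \<Longrightarrow> ddw ss (const c * f) = const c * ddw ss f"
  by (induction ss) (auto simp: dd_const_mult)

definition chosen :: "('k ^ 'n \<Rightarrow> 'k ^ 'n) \<Rightarrow> ('k ^ 'n \<Rightarrow> 'k ^ 'n) list" where
  "chosen u = (SOME ss. is_reduced_word S u ss)"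

lemma chosen: "u \<in> W \<Longrightarrow> chosen u \<in> lists S" "u \<in> W \<Longrightarrow> word_prod (chosen u) = u"
  "u \<in> W \<Longrightarrow> length (chosen u) = len u"
proof -
  have "is_reduced_word S u (chosen u)" if "u \<in> W"
    using reduced_word_exists[OF that] someI_ex unfolding chosen_def by metis
  then show "u \<in> W \<Longrightarrow> chosen u \<in> lists S" "u \<in> W \<Longrightarrow> word_prod (chosen u) = u"
    "u \<in> W \<Longrightarrow> length (chosen u) = len u"
    by (auto simp: is_reduced_word_def)
qed

lemma E_chosen: "E u = ddw (chosen u)"
  by (simp add: div_diff_elt_def chosen_def)

text \<open>The value expected of the operator of a word of length \<open>k\<close> with product
  \<open>u\<close>: it vanishes unless the word is reduced.\<close>

definition Ek :: "('k ^ 'n \<Rightarrow> 'k ^ 'n) \<Rightarrow> nat \<Rightarrow> ('k, 'n) sym \<Rightarrow> ('k, 'n) sym" where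
  "Ek u k f = (if len u = k then E u f else 0)"

lemma invs_id: "invs id = {}"
  by (auto simp: invs_def)

text \<open>Bernstein--Gelfand--Gelfand: the commutator of a divided difference operator with multiplication by
  a linear form only involves operators for shorter words, and depends only on the product of the word.\<close>

lemma ddw_commutator:
  assumes H: "\<And>ts f. ts \<in> lists S \<Longrightarrow> length ts < n \<Longrightarrow> ddw ts f = Ek (word_prod ts) (length ts) f"
    and l: "linear_functional \<xi>"
    and "ss \<in> lists S" "length ss \<le> n" "len (word_prod ss) = length ss"
  shows "ddw ss (lin_form \<xi> * f) = lin_form (\<xi> \<circ> iv (word_prod ss)) * ddw ss f
     + (\<Sum>\<gamma>\<in>invs (word_prod ss). const (\<xi> (coroot \<gamma>)) * Ek (word_prod ss \<circ> trefl \<gamma>) (length ss - 1) f)"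
  using assms(3-5)
proof (induction ss)
  case Nil
  have "ddw [] (lin_form \<xi> * f) = lin_form (\<xi> \<circ> iv (word_prod [])) * ddw [] f
     + (\<Sum>\<gamma>\<in>invs (word_prod []). const (\<xi> (coroot \<gamma>)) * Ek (word_prod [] \<circ> trefl \<gamma>) (length [] - 1) f)"
    by (simp add: invs_id)
  then show ?case .
next
  case (Cons s ss)
  define w where "w = word_prod ss"
  have s: "s \<in> S" "ss \<in> lists S" "w \<in> W" using Cons.hyps by (auto simp: w_def)
  have "len (word_prod (s # ss)) = length (s # ss)" by (rule Cons.prems(2))
  then have sw: "len (s \<circ> w) = Suc (length ss)" by (simp add: w_def)
  then have lw: "len w = length ss" and pos: "srt s \<circ> w \<in> P"
    using len_le[OF s(2)] len_simple_comp_cases[OF s(3,1)]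
    by (metis w_def le_antisym not_less_eq_eq order_refl Suc_le_mono nat_le_linear le_SucI,
        metis w_def not_less_eq_eq order_refl le_SucI)
  \<comment> \<open>The inversion gained by prefixing \<open>s\<close>. Its term in the new sum
    arises when \<open>dd s\<close> hits the linear factor.\<close>
  define \<gamma>0 where "\<gamma>0 = srt s \<circ> w"
  have inv: "invs (s \<circ> w) = insert \<gamma>0 (invs w)" "\<gamma>0 \<notin> invs w"
    using invs_simple_comp[OF s(1,3) pos] by (auto simp: \<gamma>0_def)
  have g0: "\<gamma>0 = srt s \<circ> iv (iv w)" using s by (simp add: \<gamma>0_def)
  have cg0: "coroot \<gamma>0 = iv w (coroot (srt s))"
    unfolding g0 using s by (intro coroot_conj) auto
  have tg0: "s \<circ> w \<circ> trefl \<gamma>0 = w"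
  proof -
    have "trefl \<gamma>0 = iv w \<circ> s \<circ> w"
      unfolding g0 using trefl_conj[of "iv w" "srt s"] s by (simp add: simple_root)
    then have "s \<circ> w \<circ> trefl \<gamma>0 = s \<circ> (w \<circ> iv w) \<circ> s \<circ> w" by (simp add: comp_assoc)
    then show ?thesis using s by simp
  qed
  have IH: "ddw ss (lin_form \<xi> * f) = lin_form (\<xi> \<circ> iv w) * ddw ss f
     + (\<Sum>\<gamma>\<in>invs w. const (\<xi> (coroot \<gamma>)) * Ek (w \<circ> trefl \<gamma>) (length ss - 1) f)"
    unfolding w_def by (rule Cons.IH) (use Cons.prems(1) lw in \<open>simp_all add: w_def\<close>)
  have dd_sum: "dd s (\<Sum>\<gamma>\<in>A. const (c \<gamma>) * h \<gamma>) = (\<Sum>\<gamma>\<in>A. const (c \<gamma>) * dd s (h \<gamma>))" for A c h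
    by (induction A rule: infinite_finite_induct) (auto simp: s dd_add dd_const_mult)
  \<comment> \<open>If \<open>w \<circ> trefl \<gamma>\<close> is too short, both sides are zero.
    Otherwise prefixing \<open>s\<close> to its chosen word gives a word shorter than
    \<open>n\<close>, to which \<open>H\<close> applies.\<close>
  have step: "dd s (Ek (w \<circ> trefl \<gamma>) (length ss - 1) f) = Ek (s \<circ> w \<circ> trefl \<gamma>) (length ss) f"
    if g: "\<gamma> \<in> invs w" for \<gamma>
  proof -
    define x where "x = w \<circ> trefl \<gamma>"
    have x: "x \<in> W" "len x < length ss"
      using g s len_trefl_neg[of w \<gamma>] lw by (auto simp: x_def invs_def)
    have "dd s (Ek x (length ss - 1) f) = Ek (s \<circ> x) (length ss) f"
    proof (cases "len x = length ss - 1")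
      case True
      have "dd s (Ek x (length ss - 1) f) = ddw (s # chosen x) f"
        using True by (simp add: Ek_def E_chosen)
      also have "\<dots> = Ek (word_prod (s # chosen x)) (length (s # chosen x)) f"
        using s x chosen[OF x(1)] Cons.prems by (intro H) auto
      also have "length (s # chosen x) = length ss" using chosen(3)[OF x(1)] True x(2) by simp
      finally show ?thesis using chosen(2)[OF x(1)] by (simp add: comp_def)
    next
      case False
      have "len (s \<circ> x) \<le> 1 + len x"
        using len_comp_le[of s x] s x by (simp add: len_simple)
      then show ?thesis using False x s by (simp add: Ek_def)
    qed
    then show ?thesis by (simp add: x_def comp_assoc)
  qed
  have Ew: "ddw ss f = Ek w (length ss) f"
    using H[OF s(2)] Cons.prems by (simp add: w_def)
  have "ddw (s # ss) (lin_form \<xi> * f) = dd s (lin_form (\<xi> \<circ> iv w) * ddw ss f)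
     + (\<Sum>\<gamma>\<in>invs w. const (\<xi> (coroot \<gamma>)) * dd s (Ek (w \<circ> trefl \<gamma>) (length ss - 1) f))"
    using s by (simp add: IH dd_add dd_sum)
  also have "(\<Sum>\<gamma>\<in>invs w. const (\<xi> (coroot \<gamma>)) * dd s (Ek (w \<circ> trefl \<gamma>) (length ss - 1) f))
      = (\<Sum>\<gamma>\<in>invs w. const (\<xi> (coroot \<gamma>)) * Ek (s \<circ> w \<circ> trefl \<gamma>) (length ss) f)"
    by (rule sum.cong) (simp_all only: step)
  also have "dd s (lin_form (\<xi> \<circ> iv w) * ddw ss f)
      = const (\<xi> (coroot \<gamma>0)) * Ek (s \<circ> w \<circ> trefl \<gamma>0) (length ss) f + lin_form (\<xi> \<circ> iv w \<circ> s) * dd s (ddw ss f)"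
    using s l by (simp add: dd_mult dd_lin_form functional_comp act_lin_form cg0 tg0 flip: Ew)
  finally have "ddw (s # ss) (lin_form \<xi> * f) = lin_form (\<xi> \<circ> iv (s \<circ> w)) * ddw (s # ss) f
      + (\<Sum>\<gamma>\<in>invs (s \<circ> w). const (\<xi> (coroot \<gamma>)) * Ek (s \<circ> w \<circ> trefl \<gamma>) (length ss) f)"
    using s by (simp add: inv iv_comp algebra_simps comp_assoc del: foldr.simps comp_apply) (simp add: algebra_simps)
  then show ?case by (simp add: w_def del: comp_apply)
qed

text \<open>If the tail of a nonreduced word is reduced, it can be rewritten to start with the same
  letter \<open>s\<close>, and \<open>dd s\<close> squares to zero. Two reduced words for one
  element agree on constants and have the same commutators with coordinates, hence agree
  everywhere.\<close>

lemma ddw_eq: "ss \<in> lists S \<Longrightarrow> ddw ss f = Ek (word_prod ss) (length ss) f"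
proof (induction "length ss" arbitrary: ss f rule: less_induct)
  case less
  show ?case
  proof (cases ss)
    case Nil
    have "chosen id = []" using chosen(3)[of id] by simp
    then show ?thesis using Nil by (simp add: Ek_def E_chosen)
  next
    case (Cons s ss')
    have s: "s \<in> S" "ss' \<in> lists S" using Cons less.prems by auto
    define w where "w = word_prod ss"
    have wW: "w \<in> W" using less.prems by (simp add: w_def)
    show ?thesis
    proof (cases "len w = length ss")
      case False
      define u where "u = word_prod ss'"
      have u: "u \<in> W" "w = s \<circ> u" using s Cons by (auto simp: u_def w_def)
      have IH: "ddw ss' f = Ek u (length ss') f"
        using less.hyps[of ss'] Cons s by (simp add: u_def)
      have "dd s (ddw ss' f) = 0"
      proof (cases "len u = length ss'")
        case True
        then have lu: "len u = Suc (len (s \<circ> u))"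
          using False u Cons len_simple_comp_cases[OF u(1) s(1)] by (metis length_Cons)
        let ?ts = "s # chosen (s \<circ> u)"
        have ts: "?ts \<in> lists S" "word_prod ?ts = u" "length ?ts = length ss'"
          using chosen[of "s \<circ> u"] u s lu True by auto
        have "ddw ss' f = ddw ?ts f"
          using less.hyps[of ?ts f] ts Cons IH by simp
        then show ?thesis using s by simp
      next
        case False
        then show ?thesis using IH s by (simp add: Ek_def)
      qed
      then show ?thesis using False Cons by (simp add: Ek_def w_def)
    next
      case True
      let ?cs = "chosen w"
      have cs: "?cs \<in> lists S" "word_prod ?cs = w" "length ?cs = length ss"
        using chosen[OF wW] True by auto
      have H: "ddw ts f = Ek (word_prod ts) (length ts) f" if "ts \<in> lists S" "length ts < length ss" for ts f
        using less.hyps that by blast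
      have comm: "ddw ts (lin_form \<xi> * f) = lin_form (\<xi> \<circ> iv w) * ddw ts f
          + (\<Sum>\<gamma>\<in>invs w. const (\<xi> (coroot \<gamma>)) * Ek (w \<circ> trefl \<gamma>) (length ss - 1) f)"
        if "linear_functional \<xi>" "ts = ss \<or> ts = ?cs" for ts \<xi> f
      proof -
        have ts: "ts \<in> lists S" "length ts = length ss" "word_prod ts = w" "len (word_prod ts) = length ts"
          using that(2) cs less.prems True by (auto simp: w_def)
        show ?thesis
          using ddw_commutator[of "length ss", OF H that(1) ts(1) _ ts(4), of f] by (simp only: ts(2,3))
      qed
      have "ddw ss f = ddw ?cs f"
      proof (induction f rule: sym_induct)
        case (const c)
        have "?cs \<noteq> []" "ss \<noteq> []" using cs Cons by auto
        then show ?case using ddw_const[OF cs(1)] ddw_const[OF less.prems] by simp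
      next
        case (add f g)
        then show ?case using ddw_add[OF cs(1)] ddw_add[OF less.prems] by simp
      next
        case (coord i f)
        show ?case
          unfolding coord_eq_lin_form comm[OF coord_linear disjI1[OF HOL.refl]] comm[OF coord_linear disjI2[OF HOL.refl]] coord
          by (rule HOL.refl)
      qed
      then show ?thesis using True by (simp add: Ek_def E_chosen w_def)
    qed
  qed
qed

lemma E_id [simp]: "E id f = f"
  using ddw_eq[of "[]" f] by (simp add: Ek_def)

lemma E_add: "u \<in> W \<Longrightarrow> E u (f + g) = E u f + E u g"
  by (simp add: E_chosen ddw_add chosen)

lemma E_zero [simp]: "u \<in> W \<Longrightarrow> E u 0 = 0"
  by (simp add: E_chosen ddw_zero chosen)

lemma E_const_mult: "u \<in> W \<Longrightarrow> E u (const c * f) = const c * E u f"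
  by (simp add: E_chosen ddw_const_mult chosen)

lemma E_uminus: "u \<in> W \<Longrightarrow> E u (- f) = - E u f"
  using E_add[of u f "- f"] by (simp add: eq_neg_iff_add_eq_0 add.commute)

lemma E_diff: "u \<in> W \<Longrightarrow> E u (f - g) = E u f - E u g"
  using E_add[of u f "- g"] by (simp add: E_uminus)

lemma E_sum: "u \<in> W \<Longrightarrow> E u (\<Sum>x\<in>X. h x) = (\<Sum>x\<in>X. E u (h x))"
  by (induction X rule: infinite_finite_induct) (auto simp: E_add)

lemma E_E:
  assumes "u \<in> W" "v \<in> W"
  shows "E u (E v f) = (if len (u \<circ> v) = len u + len v then E (u \<circ> v) f else 0)"
  using ddw_eq[of "chosen u @ chosen v" f] assms chosen[of u] chosen[of v]
  by (simp add: E_chosen Ek_def)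

lemma E_simple: "s \<in> S \<Longrightarrow> E s f = dd s f"
  using ddw_eq[of "[s]" f] by (simp add: Ek_def len_simple)

lemma E_dd: "u \<in> W \<Longrightarrow> s \<in> S \<Longrightarrow> E u (dd s f) = (if len (u \<circ> s) = Suc (len u) then E (u \<circ> s) f else 0)"
  using E_E[of u s f] by (simp add: E_simple len_simple)

lemma dd_E: "u \<in> W \<Longrightarrow> s \<in> S \<Longrightarrow> dd s (E u f) = (if len (s \<circ> u) = Suc (len u) then E (s \<circ> u) f else 0)"
  using E_E[of s u f] by (simp add: E_simple len_simple)

lemma E_split_last:
  assumes "z \<in> W" "z \<noteq> id"
  obtains z' s where "z' \<in> W" "s \<in> S" "z = z' \<circ> s" "len z = Suc (len z')" "\<And>f. E z f = E z' (dd s f)"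
proof -
  obtain s where s: "s \<in> S" "len z = Suc (len (z \<circ> s))" using right_descent_exists[OF assms] .
  show ?thesis
    by (rule that[of "z \<circ> s" s]) (use s assms E_dd[of "z \<circ> s" s] in auto)
qed

subsection \<open>Constant terms of divided differences\<close>

abbreviation eps :: "('k, 'n) sym \<Rightarrow> 'k" where
  "eps f \<equiv> ev f 0"

text \<open>Leibniz for the last letter \<open>s\<close> of \<open>z\<close> leaves \<open>g\<close>
  or \<open>dd s g\<close> as second factor. Below the shortened element, both \<open>u\<close> and
  \<open>u \<circ> s\<close> stay below \<open>z\<close>, so both terms fall under the
  induction.\<close>

lemma eps_E_mult_eq_0:
  assumes "z \<in> W" "\<And>u. u \<preceq> z \<Longrightarrow> eps (E u g) = 0"
  shows "eps (E z (f * g)) = 0"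
  using assms
proof (induction "len z" arbitrary: z f g rule: less_induct)
  case less
  show ?case
  proof (cases "z = id")
    case True
    then show ?thesis using less.prems(2)[of id] by simp
  next
    case False
    then obtain z' s where z: "z' \<in> W" "s \<in> S" "z = z' \<circ> s" "len z = Suc (len z')" "\<And>f. E z f = E z' (dd s f)"
      using E_split_last[OF less.prems(1)] by blast
    have le: "z' \<preceq> z" using bruhat_simple[of z' s] z by simp
    have 1: "eps (E z' (dd s f * g)) = 0"
      using less.hyps[of z' g] z less.prems(2) bruhat_trans[OF _ le] by simp
    have "eps (E u (dd s g)) = 0" if u: "u \<preceq> z'" for u
    proof -
      have uW: "u \<in> W" using bruhat_W[OF u] z by simp
      have "u \<circ> s \<preceq> z" using lift_up[OF bruhat_trans[OF u le]] z less.prems(1) by simp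
      then show ?thesis using less.prems(2) E_dd[OF uW z(2)] by simp
    qed
    then have 2: "eps (E z' (act s f * dd s g)) = 0"
      using less.hyps[of z' "dd s g"] z by simp
    show ?thesis using z 1 2 by (simp add: dd_mult E_add)
  qed
qed

text \<open>Only the term in which every divided difference falls on \<open>g\<close> survives; the
  other factor then carries a mere group action, which preserves its constant term.\<close>

lemma eps_E_mult_leading:
  assumes "z \<in> W" "\<And>u. u \<preceq> z \<Longrightarrow> u \<noteq> z \<Longrightarrow> eps (E u g) = 0"
  shows "eps (E z (f * g)) = eps f * eps (E z g)"
  using assms
proof (induction "len z" arbitrary: z f g rule: less_induct)
  case less
  show ?case
  proof (cases "z = id")
    case True
    then show ?thesis by simp
  next
    case False
    then obtain z' s where z: "z' \<in> W" "s \<in> S" "z = z' \<circ> s" "len z = Suc (len z')" "\<And>f. E z f = E z' (dd s f)"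
      using E_split_last[OF less.prems(1)] by blast
    have le: "z' \<preceq> z" using bruhat_simple[of z' s] z by simp
    have "eps (E u g) = 0" if "u \<preceq> z'" for u
    proof (rule less.prems(2)[OF bruhat_trans[OF that le]])
      show "u \<noteq> z" using bruhat_len[OF that] z(4) by auto
    qed
    then have 1: "eps (E z' (dd s f * g)) = 0"
      using eps_E_mult_eq_0 z by blast
    have "eps (E u (dd s g)) = 0" if u: "u \<preceq> z'" "u \<noteq> z'" for u
    proof -
      have uW: "u \<in> W" using bruhat_W[OF u(1)] z by simp
      have "u \<circ> s \<preceq> z" using lift_up[OF bruhat_trans[OF u(1) le]] z less.prems(1) by simp
      moreover have "u \<circ> s \<noteq> z"
        unfolding z(3) using u(2) comp_cancel_right[OF simple_in_W[OF z(2)], of u z'] by blast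
      ultimately show ?thesis using less.prems(2) E_dd[OF uW z(2)] by simp
    qed
    then have 2: "eps (E z' (act s f * dd s g)) = eps (act s f) * eps (E z' (dd s g))"
      using less.hyps[of z' "dd s g"] z by simp
    show ?thesis using z 1 2 by (simp add: dd_mult E_add)
  qed
qed

end

subsection \<open>The coinvariant ideal\<close>

lemma sym_ring_simps [simp]:
  "carrier sym_ring = UNIV" "x \<otimes>\<^bsub>sym_ring\<^esub> y = x * y" "\<one>\<^bsub>sym_ring\<^esub> = 1" "\<zero>\<^bsub>sym_ring\<^esub> = 0"
  "x \<oplus>\<^bsub>sym_ring\<^esub> y = x + y"
  by (simp_all add: sym_ring_def)

lemma cring_sym_ring: "cring (sym_ring :: ('k::field, 'n) sym ring)"
proof (rule cringI)
  show "abelian_group (sym_ring :: ('k, 'n) sym ring)"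
    by (rule abelian_groupI) (auto simp: add_ac intro: exI[of _ "- x" for x])
  show "Group.comm_monoid (sym_ring :: ('k, 'n) sym ring)"
    by (rule comm_monoidI) (auto simp: mult_ac)
qed (simp add: distrib_right)

lemma cring_idealI:
  fixes R (structure)
  assumes "cring R" "I \<subseteq> carrier R" "\<zero> \<in> I" "\<And>x y. x \<in> I \<Longrightarrow> y \<in> I \<Longrightarrow> x \<oplus> y \<in> I"
    "\<And>r x. r \<in> carrier R \<Longrightarrow> x \<in> I \<Longrightarrow> r \<otimes> x \<in> I"
  shows "ideal I R"
proof -
  interpret cring R by fact
  show ?thesis
  proof (rule idealI)
    show "subgroup I (add_monoid R)"
    proof
      show "inv\<^bsub>add_monoid R\<^esub> x \<in> I" if "x \<in> I" for x
        using assms(5)[of "\<ominus> \<one>" x] that assms(2) l_minus[of \<one> x] by (auto simp: a_inv_def)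
    qed (use assms in auto)
    show "x \<otimes> a \<in> I" if "a \<in> I" "x \<in> carrier R" for a x
      using assms(5) that by blast
    then show "a \<otimes> x \<in> I" if "a \<in> I" "x \<in> carrier R" for a x
      using m_comm that assms(2) by (metis subsetD)
  qed (rule ring_axioms)
qed

lemma sym_idealI:
  fixes A :: "('k::field, 'n) sym set"
  assumes "0 \<in> A" "\<And>f g. f \<in> A \<Longrightarrow> g \<in> A \<Longrightarrow> f + g \<in> A" "\<And>f h. f \<in> A \<Longrightarrow> h * f \<in> A"
  shows "ideal A sym_ring"
  by (rule cring_idealI[OF cring_sym_ring]) (use assms in auto)

lemma ideal_coinv: "ideal (coinv_ideal W) sym_ring"
  unfolding coinv_ideal_def by (rule ring.genideal_ideal[OF cring.axioms(1)[OF cring_sym_ring]]) simp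

lemma coinv_ideal_pos: "f \<in> pos_invariants W \<Longrightarrow> f \<in> coinv_ideal W"
  unfolding coinv_ideal_def using ring.genideal_self[OF cring.axioms(1)[OF cring_sym_ring]] by fastforce

lemma coinv_ideal_add: "f \<in> coinv_ideal W \<Longrightarrow> g \<in> coinv_ideal W \<Longrightarrow> f + g \<in> coinv_ideal W"
  using additive_subgroup.a_closed[OF ideal.axioms(1)[OF ideal_coinv]] by fastforce

lemma coinv_ideal_mult: "f \<in> coinv_ideal W \<Longrightarrow> h * f \<in> coinv_ideal W"
  using ideal.I_l_closed[OF ideal_coinv] by fastforce

lemma coinv_ideal_zero [simp]: "0 \<in> coinv_ideal W"
  using additive_subgroup.zero_closed[OF ideal.axioms(1)[OF ideal_coinv]] by fastforce

lemma coinv_ideal_uminus: "f \<in> coinv_ideal W \<Longrightarrow> - f \<in> coinv_ideal W"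
  using coinv_ideal_mult[of f W "- 1"] by simp

lemma coinv_ideal_diff: "f \<in> coinv_ideal W \<Longrightarrow> g \<in> coinv_ideal W \<Longrightarrow> f - g \<in> coinv_ideal W"
  using coinv_ideal_add[of f W "- g"] coinv_ideal_uminus[of g W] by simp

lemma coinv_ideal_sum: "(\<And>x. x \<in> X \<Longrightarrow> f x \<in> coinv_ideal W) \<Longrightarrow> (\<Sum>x\<in>X. f x) \<in> coinv_ideal W"
  by (induction X rule: infinite_finite_induct) (auto intro: coinv_ideal_add)

lemma coinv_ideal_minimal:
  assumes "0 \<in> A" "\<And>f g. f \<in> A \<Longrightarrow> g \<in> A \<Longrightarrow> f + g \<in> A" "\<And>f h. f \<in> A \<Longrightarrow> h * f \<in> A"
    "pos_invariants W \<subseteq> A"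
  shows "coinv_ideal W \<subseteq> A"
  unfolding coinv_ideal_def
  by (rule ring.genideal_minimal[OF cring.axioms(1)[OF cring_sym_ring] sym_idealI[OF assms(1-3)] assms(4)])

context reflection_group
begin

lemma pos_invariants_iff: "f \<in> pos_invariants W \<longleftrightarrow> (\<forall>w\<in>W. act w f = f) \<and> eps f = 0"
  by (simp add: pos_invariants_def ev_at_0)

lemma E_invariant: "z \<in> W \<Longrightarrow> z \<noteq> id \<Longrightarrow> (\<And>s. s \<in> S \<Longrightarrow> act s f = f) \<Longrightarrow> E z f = 0"
  using E_split_last[of z] dd_eq_0_iff E_zero by metis

lemma coinv_ideal_act: "f \<in> coinv_ideal W \<Longrightarrow> w \<in> W \<Longrightarrow> act w f \<in> coinv_ideal W"
proof -
  assume w: "w \<in> W" and f: "f \<in> coinv_ideal W"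
  have "coinv_ideal W \<subseteq> {f. act w f \<in> coinv_ideal W}"
  proof (rule coinv_ideal_minimal)
    show "pos_invariants W \<subseteq> {f. act w f \<in> coinv_ideal W}"
    proof
      fix f assume f: "f \<in> pos_invariants W"
      then have "act w f = f" using w by (simp add: pos_invariants_iff)
      then show "f \<in> {f. act w f \<in> coinv_ideal W}" using coinv_ideal_pos[OF f] by simp
    qed
  qed (use w in \<open>auto simp: act_zero act_add act_mult intro: coinv_ideal_add coinv_ideal_mult\<close>)
  then show ?thesis using f by blast
qed

lemma act_simple_diff_coinv:
  assumes "s \<in> S" "dd s f \<in> coinv_ideal W"
  shows "act s f - f \<in> coinv_ideal W"
proof -
  have "act s f - f = (- lin_form (srt s)) * dd s f"
    using dd[OF assms(1), of f] by (simp add: algebra_simps)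
  then show ?thesis using coinv_ideal_mult[OF assms(2)] by metis
qed

lemma act_word_diff_coinv:
  assumes "\<And>s. s \<in> J \<Longrightarrow> act s f - f \<in> coinv_ideal W" "J \<subseteq> S" "w \<in> parabolic J"
  shows "act w f - f \<in> coinv_ideal W"
proof -
  have "act (word_prod ss) f - f \<in> coinv_ideal W" if "ss \<in> lists J" for ss
    using that
  proof (induction ss)
    case Nil
    have "act (word_prod []) f - f = 0" by (simp add: act_id)
    then show ?case by (metis coinv_ideal_zero)
  next
    case (Cons s ss)
    have "ss \<in> lists S" using Cons.hyps(2) lists_mono[OF assms(2)] by blast
    then have s: "s \<in> S" "word_prod ss \<in> W"
      using Cons.hyps(1) assms(2) by auto
    have IH: "act (word_prod ss) f - f \<in> coinv_ideal W" by (rule Cons.IH)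
    have "act (word_prod (s # ss)) f - f = act s (act (word_prod ss) f - f) + (act s f - f)"
      using s by (simp add: act_comp act_diff)
    moreover have "\<dots> \<in> coinv_ideal W"
      by (rule coinv_ideal_add[OF coinv_ideal_act[OF IH simple_in_W[OF s(1)]] assms(1)[OF Cons.hyps(1)]])
    ultimately show ?case by metis
  qed
  then show ?thesis using assms(3) by (auto simp: parabolic_def)
qed

lemma card_W_nz: "(of_nat (card W) :: 'k) \<noteq> 0"
proof -
  have "card W \<noteq> 0" using id_in_W finite_W by (metis card_0_eq empty_iff)
  then show ?thesis using of_nat_eq_iff'[of "card W" 0] by simp
qed

lemma parabolic_average:
  assumes J: "J \<subseteq> S" and u: "u \<in> parabolic J"
  shows "act u (\<Sum>w\<in>parabolic J. act w g) = (\<Sum>w\<in>parabolic J. act w g)"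
proof -
  have uW: "u \<in> W" using parabolic_W[OF J u] .
  have "act u (\<Sum>w\<in>parabolic J. act w g) = (\<Sum>w\<in>parabolic J. act (u \<circ> w) g)"
    unfolding act_sum[OF uW] by (rule sum.cong) (simp_all add: act_comp[OF uW parabolic_W[OF J]])
  also have "\<dots> = (\<Sum>w\<in>parabolic J. act w g)"
    by (rule sum.reindex_bij_witness[of _ "\<lambda>w. iv u \<circ> w" "\<lambda>w. u \<circ> w"])
      (use uW in \<open>simp_all add: parabolic_comp u parabolic_iv[OF J u] flip: comp_assoc\<close>)
  finally show ?thesis .
qed

lemma const_mult: "const a * const b = (const (a * b) :: ('k, 'n) sym)"
  by (rule sym_eqI) simp

lemma const_one: "const 1 = (1 :: ('k, 'n) sym)"
  by (rule sym_eqI) simp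

text \<open>Long words give the zero operator, so by descending induction every \<open>ddw ss f\<close> is in the ideal:
  if all \<open>dd s g\<close> are, then \<open>g\<close> is congruent to its average, an invariant without constant term.\<close>

lemma coinv_idealI:
  assumes "\<And>z. z \<in> W \<Longrightarrow> eps (E z f) = 0"
  shows "f \<in> coinv_ideal W"
proof -
  have "ddw ss f \<in> coinv_ideal W" if "ss \<in> lists S" for ss
    using that
  proof (induction "Suc (len w0) - length ss" arbitrary: ss rule: less_induct)
    case less
    show ?case
    proof (cases "length ss \<le> len w0")
      case False
      \<comment> \<open>A word longer than \<open>w0\<close> is not reduced, so its operator is
        zero.\<close>
      have "len (word_prod ss) \<le> len w0"
        using bruhat_len[OF w0_max[of "word_prod ss"]] less.prems by auto
      then show ?thesis using ddw_eq[OF less.prems] False by (simp add: Ek_def)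
    next
      case True
      define g where "g = ddw ss f"
      have "dd s g \<in> coinv_ideal W" if "s \<in> S" for s
        using less.hyps[of "s # ss"] less.prems that True by (simp add: g_def)
      then have d: "act w g - g \<in> coinv_ideal W" if "w \<in> W" for w
        using act_word_diff_coinv[of S g w] act_simple_diff_coinv that parabolic_S by blast
      have "eps g = 0"
        unfolding g_def ddw_eq[OF less.prems] Ek_def using assms less.prems by simp
      then have "(\<Sum>w\<in>W. act w g) \<in> pos_invariants W"
        using parabolic_average[of S] by (simp add: pos_invariants_iff parabolic_S)
      then have "(\<Sum>w\<in>W. act w g) - (\<Sum>w\<in>W. act w g - g) \<in> coinv_ideal W"
        by (rule coinv_ideal_diff[OF coinv_ideal_pos coinv_ideal_sum[OF d]])
      moreover have "const (1 / of_nat (card W)) * ((\<Sum>w\<in>W. act w g) - (\<Sum>w\<in>W. act w g - g)) = g"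
        using card_W_nz by (intro sym_eqI) (simp add: sum_subtractf)
      ultimately show ?thesis unfolding g_def using coinv_ideal_mult by metis
    qed
  qed
  from this[of "[]"] show ?thesis by simp
qed

text \<open>The common zero set is an ideal by \<open>eps_E_mult_eq_0\<close> and contains the
  invariants without constant term, since every nontrivial operator kills invariants.\<close>

lemma coinv_ideal_eq: "coinv_ideal W = {f. \<forall>z\<in>W. eps (E z f) = 0}"
proof
  show "coinv_ideal W \<subseteq> {f. \<forall>z\<in>W. eps (E z f) = 0}"
  proof (rule coinv_ideal_minimal)
    show "pos_invariants W \<subseteq> {f. \<forall>z\<in>W. eps (E z f) = 0}"
    proof clarify
      fix f z assume "f \<in> pos_invariants W" "z \<in> W"
      then show "eps (E z f) = 0"
        using E_invariant[of z f] by (cases "z = id") (auto simp: pos_invariants_iff)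
    qed
    show "h * f \<in> {f. \<forall>z\<in>W. eps (E z f) = 0}" if "f \<in> {f. \<forall>z\<in>W. eps (E z f) = 0}" for f h
      using that eps_E_mult_eq_0 bruhat_W by blast
  qed (auto simp: E_add)
  show "{f. \<forall>z\<in>W. eps (E z f) = 0} \<subseteq> coinv_ideal W"
    using coinv_idealI by blast
qed

subsection \<open>The product of the positive roots\<close>

abbreviation rootprod :: "('k, 'n) sym" where
  "rootprod \<equiv> \<Prod>\<gamma>\<in>P. lin_form \<gamma>"

lemma ev_rootprod: "ev rootprod v = (\<Prod>\<gamma>\<in>P. \<gamma> v)"
  by (simp add: root_linear)

definition alternating :: "('k, 'n) sym \<Rightarrow> bool" where
  "alternating f \<longleftrightarrow> (\<forall>s\<in>S. \<forall>v. ev f (s v) = - ev f v)"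

text \<open>A simple reflection negates its own root and permutes the remaining positive
  ones.\<close>

lemma alternating_rootprod: "alternating rootprod"
  unfolding alternating_def ev_rootprod
proof (intro ballI allI)
  fix s v assume s: "s \<in> S"
  let ?Q = "P - {srt s}"
  have P: "P = insert (srt s) ?Q" using simple_root(1)[OF s] by blast
  have maps: "\<gamma> \<circ> s \<in> ?Q" if "\<gamma> \<in> ?Q" for \<gamma>
  proof -
    have "\<gamma> \<circ> s \<noteq> srt s"
    proof
      assume "\<gamma> \<circ> s = srt s"
      then have "\<gamma> = srt s \<circ> s" using s by (metis comp_simple_simple)
      then have "\<gamma> = (\<lambda>v. - srt s v)" using srt_simple[OF s] by simp
      then show False using that neg_pos_iff[OF srt_root[OF s]] simple_root(1)[OF s] by simp
    qed
    then show ?thesis using simple_permutes_pos[OF s] that by simp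
  qed
  have "(\<Prod>\<gamma>\<in>?Q. \<gamma> (s v)) = (\<Prod>\<gamma>\<in>?Q. \<gamma> v)"
    by (rule prod.reindex_bij_witness[of _ "\<lambda>\<gamma>. \<gamma> \<circ> s" "\<lambda>\<gamma>. \<gamma> \<circ> s"]) (use maps s in \<open>auto simp: comp_assoc\<close>)
  moreover have "srt s (s v) = - srt s v" using srt_simple[OF s] by (metis comp_apply)
  ultimately show "(\<Prod>\<gamma>\<in>P. \<gamma> (s v)) = - (\<Prod>\<gamma>\<in>P. \<gamma> v)"
    by (subst (1 2) P) (simp add: prod.insert_remove)
qed

lemma alternating_word: "alternating f \<Longrightarrow> ss \<in> lists S \<Longrightarrow> ev f (word_prod ss v) = (- 1) ^ length ss * ev f v"
  by (induction ss) (auto simp: alternating_def)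

lemma alternating_W: "alternating f \<Longrightarrow> w \<in> W \<Longrightarrow> ev f (w v) = (- 1) ^ len w * ev f v"
  using alternating_word[of f "chosen w" v] chosen[of w] by simp

lemma two_nz: "(2 :: 'k) \<noteq> 0"
  using of_nat_eq_iff'[of 2 0] by simp

text \<open>Moving the mirror of \<gamma> to that of a simple reflection reduces to a point fixed by
  \<open>s\<close>, where the value equals its own negative.\<close>

lemma alternating_vanish:
  assumes "alternating f" "\<gamma> \<in> P" "\<gamma> v = 0"
  shows "ev f v = 0"
proof -
  obtain w s where w: "w \<in> W" "s \<in> S" "\<gamma> = srt s \<circ> w"
    using pos_root_conj_simple[OF assms(2)] .
  have "w v \<in> fixed_space s"
    using assms(3) w by (simp add: kernel_of_def flip: kernel_srt)
  then have "s (w v) = w v" by (simp add: fixed_space_def)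
  then have "ev f (w v) = - ev f (w v)"
    using assms(1) w by (metis alternating_def)
  then have "2 * ev f (w v) = 0" by (simp add: eq_neg_iff_add_eq_0)
  then have "ev f (w v) = 0" using two_nz by simp
  then show ?thesis using alternating_W[OF assms(1) w(1)] by simp
qed

lemma pos_roots_independent:
  assumes "\<alpha> \<in> P" "\<beta> \<in> P" "\<alpha> \<noteq> \<beta>"
  obtains q where "\<beta> q = 0" "\<alpha> q \<noteq> 0"
proof (rule ccontr)
  assume "\<not> thesis"
  with that have sub: "\<alpha> q = 0" if "\<beta> q = 0" for q using that by blast
  have "\<beta> v = 0" if "\<alpha> v = 0" for v
  proof (rule ccontr)
    assume nz: "\<beta> v \<noteq> 0"
    have "\<alpha> x = 0" for x
    proof -
      have "\<beta> (x - (\<beta> x / \<beta> v) *s v) = 0"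
        using nz assms by (simp add: root_apply_linear)
      then have "\<alpha> (x - (\<beta> x / \<beta> v) *s v) = 0" by (rule sub)
      then show ?thesis using that assms by (simp add: root_apply_linear)
    qed
    then show False using root_nonzero[of \<alpha>] assms by auto
  qed
  then have "kernel_of \<alpha> = kernel_of \<beta>" using sub by (auto simp: kernel_of_def)
  then have "\<alpha> = (\<lambda>v. - \<beta> v)" using root_kernel_eqD[of \<beta> \<alpha>] assms by auto
  then show False using neg_pos_iff[of \<beta>] assms by simp
qed

text \<open>After dividing by \<alpha>, vanishing on the mirror of \<beta> must be preserved. Off
  the mirror of \<alpha> this is immediate; on the intersection one leaves it along a line inside
  the mirror of \<beta>, which exists as the roots are not proportional.\<close>

lemma prod_roots_dvd:
  assumes "A \<subseteq> P" "\<And>\<gamma> v. \<gamma> \<in> A \<Longrightarrow> \<gamma> v = 0 \<Longrightarrow> ev f v = 0"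
  shows "\<exists>g. f = (\<Prod>\<gamma>\<in>A. lin_form \<gamma>) * g"
proof -
  have "finite A" using assms(1) finite_P by (rule finite_subset)
  then show ?thesis using assms
  proof (induction A arbitrary: f)
    case empty
    then show ?case by simp
  next
    case (insert \<alpha> A)
    have a: "\<alpha> \<in> P" "\<alpha> \<in> \<Phi>" using insert.prems by auto
    obtain g where g: "f = lin_form \<alpha> * g"
      using lin_form_dvd[OF infinite_k root_linear[OF a(2)] root_nonzero[OF a(2)]] insert.prems(2)[of \<alpha>] by auto
    have "ev g v = 0" if \<beta>: "\<beta> \<in> A" "\<beta> v = 0" for \<beta> v
    proof -
      have bP: "\<beta> \<in> P" "\<beta> \<in> \<Phi>" using \<beta> insert.prems by auto
      have mult0: "\<alpha> x * ev g x = 0" if "\<beta> x = 0" for x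
        using insert.prems(2)[of \<beta> x] \<beta> that by (simp add: g root_linear a)
      have "\<alpha> \<noteq> \<beta>" using insert.hyps \<beta> by blast
      then obtain q where q: "\<beta> q = 0" "\<alpha> q \<noteq> 0" using pos_roots_independent a bP by blast
      show ?thesis
      proof (cases "\<alpha> v = 0")
        case True
        show ?thesis
        proof (rule ev_eq_0_line[OF infinite_k, of _ _ q])
          fix t :: 'k assume "t \<noteq> 0"
          then show "ev g (v + t *s q) = 0"
            using mult0[of "v + t *s q"] q True \<beta> bP a by (simp add: root_apply_linear)
        qed
      next
        case False
        then show ?thesis using mult0[OF \<beta>(2)] by simp
      qed
    qed
    then obtain h where "g = (\<Prod>\<gamma>\<in>A. lin_form \<gamma>) * h"
      using insert.IH[of g] insert.prems(1) by blast
    then have "f = (\<Prod>\<gamma>\<in>insert \<alpha> A. lin_form \<gamma>) * h"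
      using g insert.hyps by (simp add: mult.assoc)
    then show ?case by blast
  qed
qed

lemma prod_roots_cancel:
  assumes "A \<subseteq> P" "(\<Prod>\<gamma>\<in>A. lin_form \<gamma>) * f = (\<Prod>\<gamma>\<in>A. lin_form \<gamma>) * g"
  shows "f = g"
proof -
  have "finite A" using assms(1) finite_P by (rule finite_subset)
  then show ?thesis using assms
  proof (induction A)
    case (insert \<alpha> A)
    have a: "\<alpha> \<in> \<Phi>" using insert.prems by auto
    have "lin_form \<alpha> * ((\<Prod>\<gamma>\<in>A. lin_form \<gamma>) * f) = lin_form \<alpha> * ((\<Prod>\<gamma>\<in>A. lin_form \<gamma>) * g)"
      using insert.prems(2) insert.hyps by (simp add: mult.assoc)
    then have "(\<Prod>\<gamma>\<in>A. lin_form \<gamma>) * f = (\<Prod>\<gamma>\<in>A. lin_form \<gamma>) * g"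
      by (rule lin_form_cancel[OF infinite_k root_linear[OF a] root_nonzero[OF a]])
    then show ?case using insert.IH insert.prems(1) by blast
  qed simp
qed

definition alt :: "('k, 'n) sym \<Rightarrow> ('k, 'n) sym" where
  "alt f = (\<Sum>w\<in>W. const ((- 1) ^ len w) * act w f)"

lemma ev_alt: "ev (alt f) v = (\<Sum>w\<in>W. (- 1) ^ len w * ev f (iv w v))"
  by (simp add: alt_def)

lemma alternating_alt: "alternating (alt f)"
  unfolding alternating_def ev_alt
proof (intro ballI allI)
  fix s v assume s: "s \<in> S"
  have "(\<Sum>w\<in>W. (- 1) ^ len w * ev f (iv w (s v))) = (\<Sum>w\<in>W. - ((- 1) ^ len w * ev f (iv w v)))"
  proof (rule sum.reindex_bij_witness[of _ "\<lambda>w. s \<circ> w" "\<lambda>w. s \<circ> w"])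
    fix w assume w: "w \<in> W"
    have "(- 1) ^ len (s \<circ> w) = (- ((- 1) ^ len w) :: 'k)"
      by (rule len_simple_comp_cases[OF w s]) simp_all
    then show "- ((- 1) ^ len (s \<circ> w) * ev f (iv (s \<circ> w) v)) = (- 1) ^ len w * ev f (iv w (s v))"
      using s w by (simp add: iv_comp)
  qed (use s in auto)
  then show "(\<Sum>w\<in>W. (- 1) ^ len w * ev f (iv w (s v))) = - (\<Sum>w\<in>W. (- 1) ^ len w * ev f (iv w v))"
    by (simp add: sum_negf)
qed

text \<open>Alternating polynomials are divisible by \<open>rootprod\<close>; so alternating an element of the coinvariant
  ideal gives a multiple of \<open>rootprod\<close> by a polynomial without constant term.\<close>

lemma rootprod_notin_coinv: "rootprod \<notin> coinv_ideal W"
proof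
  assume *: "rootprod \<in> coinv_ideal W"
  \<comment> \<open>Quantifying over \<open>h\<close> builds closure under multiplication into the
    set.\<close>
  let ?A = "{f. \<forall>h. \<exists>q. eps q = 0 \<and> alt (f * h) = rootprod * q}"
  have "coinv_ideal W \<subseteq> ?A"
  proof (rule coinv_ideal_minimal)
    have "eps 0 = 0 \<and> alt (0 * h) = rootprod * 0" for h by (auto intro: sym_eqI simp: ev_alt)
    then show "0 \<in> ?A" by blast
  next
    fix f g assume "f \<in> ?A" "g \<in> ?A"
    show "f + g \<in> ?A"
    proof clarify
      fix h
      obtain q r where "eps q = 0" "alt (f * h) = rootprod * q" "eps r = 0" "alt (g * h) = rootprod * r"
        using \<open>f \<in> ?A\<close> \<open>g \<in> ?A\<close> by blast
      moreover have "alt ((f + g) * h) = alt (f * h) + alt (g * h)"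
        by (rule sym_eqI) (simp add: ev_alt algebra_simps sum.distrib)
      ultimately have "eps (q + r) = 0 \<and> alt ((f + g) * h) = rootprod * (q + r)"
        by (simp add: distrib_left del: ev_prod)
      then show "\<exists>q. eps q = 0 \<and> alt ((f + g) * h) = rootprod * q" by blast
    qed
  next
    fix f g assume "f \<in> ?A"
    then have "\<exists>q. eps q = 0 \<and> alt (f * (g * h)) = rootprod * q" for h by blast
    moreover have "g * f * h = f * (g * h)" for h by (simp only: mult_ac)
    ultimately have "\<exists>q. eps q = 0 \<and> alt (g * f * h) = rootprod * q" for h by metis
    then show "g * f \<in> ?A" by blast
  next
    show "pos_invariants W \<subseteq> ?A"
    proof clarify
      fix f h assume "f \<in> pos_invariants W"
      then have f: "\<And>w. w \<in> W \<Longrightarrow> act w f = f" "eps f = 0" by (auto simp: pos_invariants_iff)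
      obtain q where q: "alt h = rootprod * q"
        using prod_roots_dvd[OF order_refl, of "alt h"] alternating_vanish[OF alternating_alt] by blast
      have "ev f (iv w v) = ev f v" if "w \<in> W" for w v
        using arg_cong[OF f(1)[OF that], of "\<lambda>f. ev f v"] that by simp
      then have "alt (f * h) = f * alt h"
        by (intro sym_eqI) (simp add: ev_alt sum_distrib_left algebra_simps)
      then have "eps (f * q) = 0 \<and> alt (f * h) = rootprod * (f * q)"
        using f(2) q by (simp add: mult_ac)
      then show "\<exists>q. eps q = 0 \<and> alt (f * h) = rootprod * q" by blast
    qed
  qed
  then obtain q where q: "eps q = 0" "alt (rootprod * 1) = rootprod * q"
    using * by blast
  have "(- 1) ^ len w * ((- 1) ^ len w * x) = (x :: 'k)" for w x
    by (cases "even (len w)") simp_all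
  \<comment> \<open>Each of the \<open>card W\<close> terms of the alternating sum equals
    \<open>rootprod\<close>, so cancellation identifies \<open>q\<close> with a nonzero
    constant.\<close>
  then have "alt (rootprod * 1) = rootprod * const (of_nat (card W))"
    by (intro sym_eqI) (simp add: ev_alt alternating_W[OF alternating_rootprod] del: ev_prod)
  with q have "q = const (of_nat (card W))"
    using prod_roots_cancel[OF order_refl, of q] by metis
  then show False using q(1) card_W_nz by simp
qed

subsection \<open>Schubert polynomials\<close>

text \<open>Vanishing of order at least \<open>k\<close> at the origin.\<close>

inductive vanishes :: "nat \<Rightarrow> ('k, 'n) sym \<Rightarrow> bool" where
  any: "vanishes 0 f"
| zero: "vanishes k 0"
| add: "vanishes k f \<Longrightarrow> vanishes k g \<Longrightarrow> vanishes k (f + g)"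
| mult: "linear_functional \<xi> \<Longrightarrow> vanishes k f \<Longrightarrow> vanishes (Suc k) (lin_form \<xi> * f)"

lemma vanishes_const_mult: "vanishes k f \<Longrightarrow> vanishes k (g * f)"
proof (induction rule: vanishes.induct)
  case (mult \<xi> k f)
  then show ?case using vanishes.mult[OF mult(1,3)] by (simp add: mult.left_commute)
qed (auto simp: distrib_left intro: vanishes.intros)

text \<open>In a product, one Leibniz term loses the linear factor; the other keeps a linear factor
  while \<open>dd s\<close> lowers the order of \<open>f\<close>. For \<open>k = 0\<close> the
  truncated difference makes the claim about \<open>f\<close> empty, which suffices.\<close>

lemma vanishes_dd: "vanishes k f \<Longrightarrow> s \<in> S \<Longrightarrow> vanishes (k - 1) (dd s f)"
proof (induction rule: vanishes.induct)
  case (mult \<xi> k f)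
  have "vanishes k (lin_form (\<xi> \<circ> s) * dd s f)"
  proof (cases k)
    case (Suc j)
    then show ?thesis using vanishes.mult[OF functional_comp[OF _ mult(1)], of s j "dd s f"] mult by simp
  qed (simp add: vanishes.any)
  then show ?case
    using mult vanishes_const_mult[OF mult(2)]
    by (simp add: dd_mult dd_lin_form act_lin_form vanishes.add)
qed (auto simp: dd_add intro: vanishes.intros)

lemma vanishes_ddw: "ss \<in> lists S \<Longrightarrow> vanishes k f \<Longrightarrow> vanishes (k - length ss) (ddw ss f)"
proof (induction ss)
  case (Cons s ss)
  then show ?case using vanishes_dd[of "k - length ss" "ddw ss f" s] by simp
qed simp

lemma vanishes_eps: "vanishes k f \<Longrightarrow> 0 < k \<Longrightarrow> eps f = 0"
  by (induction rule: vanishes.induct) (auto simp: functional_linear)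

lemma vanishes_prod: "A \<subseteq> P \<Longrightarrow> vanishes (card A) (\<Prod>\<gamma>\<in>A. lin_form \<gamma>)"
proof -
  assume A: "A \<subseteq> P"
  then have "finite A" using finite_P by (rule finite_subset)
  then show ?thesis using A
  proof induction
    case (insert \<gamma> A)
    then have "vanishes (Suc (card A)) (lin_form \<gamma> * (\<Prod>\<gamma>\<in>A. lin_form \<gamma>))"
      by (intro vanishes.mult root_linear) auto
    then show ?case using insert by simp
  qed (simp add: vanishes.any)
qed

lemma eps_E_rootprod: "z \<in> W \<Longrightarrow> z \<noteq> w0 \<Longrightarrow> eps (E z rootprod) = 0"
  using vanishes_eps[OF vanishes_ddw[OF chosen(1) vanishes_prod[OF order_refl]], of z] len_less_card_P[of z]
  by (simp add: E_chosen chosen)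

text \<open>All other functionals vanish on \<open>rootprod\<close>; if this one did too,
  \<open>rootprod\<close> would lie in the coinvariant ideal.\<close>

lemma eps_E_rootprod_w0: "eps (E w0 rootprod) \<noteq> 0"
  using rootprod_notin_coinv eps_E_rootprod by (auto simp: coinv_ideal_eq)

section \<open>Duality of Schubert polynomials and divided difference functionals\<close>

abbreviation sch :: "('k ^ 'n \<Rightarrow> 'k ^ 'n) \<Rightarrow> ('k, 'n) sym" where
  "sch \<equiv> schubert_poly W S P"

lemma sch_eq: "sch u = E (iv u \<circ> w0) (const (1 / of_nat (card W)) * rootprod)"
  by (simp add: schubert_poly_def w0_def)

text \<open>In fact \<open>sch_norm = 1\<close>, but only \<open>sch_norm \<noteq> 0\<close> matters.\<close>

definition sch_norm :: 'k where
  "sch_norm = eps (sch id)"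

lemma iv_id' [simp]: "iv id = (id :: 'k ^ 'n \<Rightarrow> 'k ^ 'n)"
  by (rule iv_eqI) simp_all

lemma sch_norm_nz: "sch_norm \<noteq> 0"
  unfolding sch_norm_def sch_eq
  using card_W_nz eps_E_rootprod_w0 by (simp add: E_const_mult)

lemma eps_sch: "u \<in> W \<Longrightarrow> u \<noteq> id \<Longrightarrow> eps (sch u) = 0"
proof -
  assume u: "u \<in> W" "u \<noteq> id"
  have "iv u \<circ> w0 \<noteq> w0"
  proof
    assume "iv u \<circ> w0 = w0"
    then have "iv u = id" using comp_cancel_right[of w0 "iv u" id] by simp
    then show False using u iv_iv[of u] by simp
  qed
  then show ?thesis
    unfolding sch_eq using eps_E_rootprod[of "iv u \<circ> w0"] u by (simp add: E_const_mult)
qed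

lemma dd_sch:
  assumes "u \<in> W" "s \<in> S"
  shows "dd s (sch u) = (if len (u \<circ> s) < len u then sch (u \<circ> s) else 0)"
proof -
  have e: "iv (u \<circ> s) \<circ> w0 = s \<circ> (iv u \<circ> w0)" using assms by (simp add: iv_comp comp_assoc)
  have "len (s \<circ> (iv u \<circ> w0)) = Suc (len (iv u \<circ> w0)) \<longleftrightarrow> len (iv u \<circ> w0) < len (s \<circ> (iv u \<circ> w0))"
    by (rule len_simple_comp_cases[of "iv u \<circ> w0" s]) (use assms in auto)
  then show ?thesis
    unfolding sch_eq e using assms schubert_index_step[OF assms] e by (simp add: dd_E)
qed

text \<open>Remove the last letter \<open>s\<close> of \<open>z\<close>. If \<open>s\<close> is a
  descent of \<open>u\<close>, it is removed from both indices; if not, \<open>dd s\<close> kills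
  \<open>sch u\<close>, and \<open>z\<close>, which has \<open>s\<close> as descent, differs from
  \<open>u\<close>.\<close>

lemma eps_E_sch: "z \<in> W \<Longrightarrow> u \<in> W \<Longrightarrow> eps (E z (sch u)) = (if z = u then sch_norm else 0)"
proof (induction "len z" arbitrary: z u rule: less_induct)
  case less
  show ?case
  proof (cases "z = id")
    case True
    then show ?thesis using eps_sch less.prems by (auto simp: sch_norm_def)
  next
    case False
    then obtain z' s where z: "z' \<in> W" "s \<in> S" "z = z' \<circ> s" "len z = Suc (len z')" "\<And>f. E z f = E z' (dd s f)"
      using E_split_last[OF less.prems(1)] by blast
    have zs: "z \<circ> s = z'" using z by simp
    show ?thesis
    proof (cases "len (u \<circ> s) < len u")
      case True
      have "z' = u \<circ> s \<longleftrightarrow> z = u" using z by auto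
      then show ?thesis
        using less.hyps[of z' "u \<circ> s"] z less.prems True by (simp add: dd_sch)
    next
      case False
      then have "z \<noteq> u" using zs z(4) by auto
      then show ?thesis using False z less.prems by (simp add: dd_sch)
    qed
  qed
qed

lemma act_sch: "J \<subseteq> S \<Longrightarrow> u \<in> min_reps W S J \<Longrightarrow> s \<in> J \<Longrightarrow> act s (sch u) = sch u"
  using dd_sch[of u s] min_reps_ascent[of J u s] dd_eq_0_iff[of s "sch u"] min_reps_W[of u J] by auto

end

context reflection_group
begin

subsection \<open>Ideals spanned by Schubert polynomials\<close>

text \<open>As the functionals \<open>eps \<circ> E z\<close> are dual to the Schubert classes up to the factor \<open>sch_norm\<close>,
  \<open>Zset U\<close> is the preimage in the polynomial ring of the span of the classes indexed by \<open>U\<close>.\<close>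

definition Zset :: "('k ^ 'n \<Rightarrow> 'k ^ 'n) set \<Rightarrow> ('k, 'n) sym set" where
  "Zset U = {f. \<forall>z\<in>W - U. eps (E z f) = 0}"

lemma Zset_saturated: "f \<in> Zset U \<Longrightarrow> g - f \<in> coinv_ideal W \<Longrightarrow> g \<in> Zset U"
  using E_diff[of _ g f] by (auto simp: Zset_def coinv_ideal_eq)

lemma eps_E_schubert_sum:
  assumes "U \<subseteq> W" "z \<in> W"
  shows "eps (E z (\<Sum>u\<in>U. const (d u) * sch u)) = (if z \<in> U then d z * sch_norm else 0)"
proof -
  have "finite U" using assms(1) finite_W by (rule finite_subset)
  have "eps (E z (\<Sum>u\<in>U. const (d u) * sch u)) = (\<Sum>u\<in>U. d u * eps (E z (sch u)))"
    using assms by (simp add: E_sum E_const_mult)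
  also have "\<dots> = (\<Sum>u\<in>U. if u = z then d z * sch_norm else 0)"
    by (rule sum.cong) (use assms in \<open>auto simp: eps_E_sch\<close>)
  also have "\<dots> = (if z \<in> U then d z * sch_norm else 0)"
    using \<open>finite U\<close> by simp
  finally show ?thesis .
qed

lemma schubert_sum_in_Zset: "U \<subseteq> W \<Longrightarrow> (\<Sum>u\<in>U. const (d u) * sch u) \<in> Zset U"
  by (auto simp: Zset_def eps_E_schubert_sum)

text \<open>By duality every functional vanishes on the difference.\<close>

lemma schubert_expansion:
  assumes "U \<subseteq> W" "f \<in> Zset U"
  shows "f - (\<Sum>u\<in>U. const (eps (E u f) / sch_norm) * sch u) \<in> coinv_ideal W"
  using assms sch_norm_nz by (auto simp: coinv_ideal_eq E_diff eps_E_schubert_sum Zset_def)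

lemma sch_in_Zset: "u \<in> U \<Longrightarrow> u \<in> W \<Longrightarrow> sch u \<in> Zset U"
  by (auto simp: Zset_def eps_E_sch)

text \<open>Ideals above the coinvariant ideal, that is, the preimages of ideals of the
  quotient.\<close>

definition sym_ideal :: "('k, 'n) sym set \<Rightarrow> bool" where
  "sym_ideal B \<longleftrightarrow> coinv_ideal W \<subseteq> B \<and> (\<forall>f\<in>B. \<forall>g\<in>B. f + g \<in> B) \<and> (\<forall>f\<in>B. \<forall>h. h * f \<in> B)"

lemma sym_ideal_diff: "sym_ideal B \<Longrightarrow> f \<in> B \<Longrightarrow> g \<in> B \<Longrightarrow> f - g \<in> B"
proof -
  assume B: "sym_ideal B" "f \<in> B" "g \<in> B"
  then have "f + (- 1) * g \<in> B" unfolding sym_ideal_def by blast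
  then show ?thesis by simp
qed

lemma sym_ideal_sum: "sym_ideal B \<Longrightarrow> (\<And>x. x \<in> X \<Longrightarrow> h x \<in> B) \<Longrightarrow> (\<Sum>x\<in>X. h x) \<in> B"
proof (induction X rule: infinite_finite_induct)
  case (insert x F)
  then show ?case by (simp add: sym_ideal_def)
qed (use coinv_ideal_zero in \<open>auto simp: sym_ideal_def\<close>)

lemma sym_ideal_Zset_subset:
  assumes B: "sym_ideal B" and "U \<subseteq> W" "\<And>u. u \<in> U \<Longrightarrow> sch u \<in> B"
  shows "Zset U \<subseteq> B"
proof
  fix f assume f: "f \<in> Zset U"
  let ?h = "\<Sum>u\<in>U. const (eps (E u f) / sch_norm) * sch u"
  have "f - ?h \<in> B" using schubert_expansion[OF assms(2) f] B unfolding sym_ideal_def by blast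
  moreover have "?h \<in> B" using B assms(3) by (intro sym_ideal_sum) (auto simp: sym_ideal_def)
  ultimately have "f - ?h + ?h \<in> B" using B unfolding sym_ideal_def by blast
  then show "f \<in> B" by simp
qed

text \<open>A reduced word can be taken in \<open>J\<close>, and each of its divided differences is
  linear over polynomials fixed by that letter.\<close>

lemma E_parabolic_invariant_mult:
  assumes "J \<subseteq> S" "\<And>s. s \<in> J \<Longrightarrow> act s h = h" "x \<in> parabolic J"
  shows "E x (h * f) = h * E x f"
proof -
  obtain ss where ss: "ss \<in> lists J" "is_reduced_word S x ss"
    using parabolic_reduced_word[OF assms(1,3)] .
  have E: "E x g = ddw ss g" for g
    using ddw_eq[of ss g] ss by (simp add: is_reduced_word_def Ek_def)
  have "ddw ss (h * f) = h * ddw ss f"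
    using ss(1)
  proof (induction ss)
    case (Cons s ss)
    then have s: "s \<in> S" "act s h = h" using assms by auto
    then have "dd s h = 0" using dd_eq_0_iff by blast
    then show ?case using Cons s by (simp add: dd_mult)
  qed simp
  then show ?thesis by (simp add: E)
qed

text \<open>Leray--Hirsch: for \<open>u \<in> W\<^sup>J\<close> and \<open>x \<in> W\<^sub>J\<close>, the product \<open>S\<^sub>u S\<^sub>x\<close> is a nonzero multiple of
  \<open>S\<^bsub>ux\<^esub>\<close> plus terms whose minimal coset representative is strictly above \<open>u\<close>.\<close>

lemma sch_coset_in_ideal:
  assumes B: "sym_ideal B" and J: "J \<subseteq> S"
    and gen: "\<And>u. u \<in> min_reps W S J \<Longrightarrow> v \<preceq> u \<Longrightarrow> sch u \<in> B"
    and "u \<in> min_reps W S J" "v \<preceq> u" "x \<in> parabolic J"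
  shows "sch (u \<circ> x) \<in> B"
  using assms(4-6)
proof (induction "len w0 - len u" arbitrary: u x rule: less_induct)
  case less
  define F where "F = sch x * sch u"
  \<comment> \<open>The error terms. Their minimal representatives are strictly above
    \<open>u\<close>, so they are covered by the descending induction on the length of
    \<open>u\<close>.\<close>
  define T where "T = {z \<in> W. u \<preceq> z \<and> (\<forall>x'\<in>parabolic J. z \<noteq> u \<circ> x')}"
  \<comment> \<open>The functional at \<open>u \<circ> x\<close> takes the value
    \<open>sch_norm\<close> squared on \<open>F\<close> and \<open>sch_norm\<close> on
    \<open>sch (u \<circ> x)\<close>, whence the coefficient. All functionals then vanish on
    \<open>G\<close>, which is in the coinvariant ideal.\<close>
  define G where "G = F - const sch_norm * sch (u \<circ> x) - (\<Sum>z\<in>T. const (eps (E z F) / sch_norm) * sch z)"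
  have uW: "u \<in> W" and xW: "x \<in> W" using less.prems min_reps_W parabolic_W[OF J] by auto
  have TW: "T \<subseteq> W" by (auto simp: T_def)
  have "eps (E z G) = 0" if z: "z \<in> W" for z
  proof -
    have G: "eps (E z G) = eps (E z F) - sch_norm * (if z = u \<circ> x then sch_norm else 0)
        - (if z \<in> T then eps (E z F) else 0)"
      using z uW xW sch_norm_nz TW
      by (simp add: G_def E_diff E_const_mult eps_E_sch eps_E_schubert_sum)
    consider "z \<in> T" | "\<not> u \<preceq> z" | x' where "x' \<in> parabolic J" "z = u \<circ> x'"
      using z by (auto simp: T_def)
    then show ?thesis
    proof cases
      case 1
      then have "z \<noteq> u \<circ> x" using less.prems(3) by (auto simp: T_def)
      then show ?thesis using 1 G by simp
    next
      case 2
      have "z \<noteq> u \<circ> x" using 2 min_rep_le[OF J less.prems(1,3)] by blast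
      moreover have "eps (E q (sch u)) = 0" if "q \<preceq> z" for q
        using that 2 bruhat_W[OF that] z uW by (auto simp: eps_E_sch)
      then have "eps (E z F) = 0" unfolding F_def using eps_E_mult_eq_0 z by blast
      ultimately show ?thesis using 2 G by (simp add: T_def)
    next
      case 3
      have x'W: "x' \<in> W" using 3 parabolic_W[OF J] by blast
      have "E z F = E u (E x' (sch u * sch x))"
        using E_E[OF uW x'W] min_reps_len[OF J less.prems(1) 3(1)] 3 by (simp add: F_def mult.commute)
      \<comment> \<open>\<open>sch u\<close> is invariant under \<open>J\<close>, so
        \<open>E x'\<close> acts on \<open>sch x\<close> alone and \<open>E u\<close> afterwards
        picks the leading term.\<close>
      also have "\<dots> = E u (E x' (sch x) * sch u)"
      proof -
        have "E x' (sch u * sch x) = sch u * E x' (sch x)"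
          by (rule E_parabolic_invariant_mult[OF J _ 3(1)]) (rule act_sch[OF J less.prems(1)])
        then show ?thesis by (simp only: mult.commute)
      qed
      finally have "eps (E z F) = eps (E u (E x' (sch x) * sch u))" by simp
      also have "\<dots> = eps (E x' (sch x)) * eps (E u (sch u))"
      proof (rule eps_E_mult_leading[OF uW])
        show "eps (E q (sch u)) = 0" if "q \<preceq> u" "q \<noteq> u" for q
          using that bruhat_W[OF that(1)] uW by (simp add: eps_E_sch)
      qed
      also have "\<dots> = sch_norm * (if z = u \<circ> x then sch_norm else 0)"
        using uW xW x'W 3 comp_cancel_left[OF uW, of x' x] by (auto simp: eps_E_sch)
      finally show ?thesis using G 3 by (auto simp: T_def)
    qed
  qed
  then have "G \<in> B" using B by (auto simp: coinv_ideal_eq sym_ideal_def)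
  moreover have "sch z \<in> B" if z: "z \<in> T" for z
  proof -
    have zW: "z \<in> W" using z by (simp add: T_def)
    obtain u' x' where u': "u' \<in> min_reps W S J" "x' \<in> parabolic J" "z = u' \<circ> x'"
      using min_reps_exists[OF J zW] .
    have "u \<preceq> u'"
      using bruhat_min_rep[OF J less.prems(1) u'(1,2)] z u'(3) by (simp add: T_def)
    moreover have "u' \<noteq> u" using z u' by (auto simp: T_def)
    moreover have "len u' \<le> len w0"
      using bruhat_len[OF w0_max[OF min_reps_W[OF u'(1)]]] by auto
    ultimately have "len w0 - len u' < len w0 - len u" "v \<preceq> u'"
      using bruhat_len[of u u'] bruhat_trans[OF less.prems(2)] by auto
    then show ?thesis using less.hyps u' by blast
  qed
  then have "(\<Sum>z\<in>T. const (eps (E z F) / sch_norm) * sch z) \<in> B"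
    using B by (intro sym_ideal_sum) (auto simp: sym_ideal_def)
  moreover have "F \<in> B"
    using gen[OF less.prems(1,2)] B by (auto simp: F_def sym_ideal_def)
  ultimately have "F - G - (\<Sum>z\<in>T. const (eps (E z F) / sch_norm) * sch z) \<in> B"
    using sym_ideal_diff[OF B] by blast
  then have "const (1 / sch_norm) * (F - G - (\<Sum>z\<in>T. const (eps (E z F) / sch_norm) * sch z)) \<in> B"
    using B by (auto simp: sym_ideal_def)
  moreover have "const (1 / sch_norm) * (F - G - (\<Sum>z\<in>T. const (eps (E z F) / sch_norm) * sch z)) = sch (u \<circ> x)"
  proof -
    have "F - G - (\<Sum>z\<in>T. const (eps (E z F) / sch_norm) * sch z) = const sch_norm * sch (u \<circ> x)"
      by (simp add: G_def)
    then show ?thesis using sch_norm_nz by (simp add: const_mult const_one flip: mult.assoc)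
  qed
  ultimately show ?case by simp
qed

section \<open>Generation by the elements sharing descents with essential ones\<close>

definition gen_set :: "('k ^ 'n \<Rightarrow> 'k ^ 'n) \<Rightarrow> ('k ^ 'n \<Rightarrow> 'k ^ 'n) set" where
  "gen_set y = {u \<in> W. \<exists>v\<in>essential_set W S y. v \<preceq> u \<and> descents S u = descents S v}"

definition not_below :: "('k ^ 'n \<Rightarrow> 'k ^ 'n) \<Rightarrow> ('k ^ 'n \<Rightarrow> 'k ^ 'n) set" where
  "not_below y = {u \<in> W. \<not> u \<preceq> y}"

lemma gen_set_not_below: "gen_set y \<subseteq> not_below y"
  using bruhat_trans by (auto simp: gen_set_def not_below_def essential_set_def)

text \<open>An arbitrary \<open>B\<close> is allowed because two are needed: the preimage of an
  ideal of the coinvariant ring, and the polynomials whose multiples have averages in an ideal of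
  the invariant subring.\<close>

lemma generation:
  assumes y: "y \<in> W" and B: "sym_ideal B" and gen: "\<And>u. u \<in> gen_set y \<Longrightarrow> sch u \<in> B"
  shows "Zset (not_below y) \<subseteq> B"
proof (rule sym_ideal_Zset_subset[OF B])
  show "not_below y \<subseteq> W" by (auto simp: not_below_def)
  fix z assume "z \<in> not_below y"
  then have z: "z \<in> W" "\<not> z \<preceq> y" by (auto simp: not_below_def)
  obtain v where v: "v \<in> essential_set W S y" "v \<preceq> z" using essential_exists[OF z] .
  obtain s where s: "s \<in> S" "descents S v = {s}" using essential_descents[OF y v(1)] .
  let ?J = "S - {s}"
  have J: "?J \<subseteq> S" by blast
  have vW: "v \<in> W" "\<not> v \<preceq> y" using v by (auto simp: essential_set_def)
  have vJ: "v \<in> min_reps W S ?J" using s vW by (auto simp: min_reps_def)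
  have "v \<noteq> id" using vW id_bruhat[OF y] by blast
  obtain u x where u: "u \<in> min_reps W S ?J" "x \<in> parabolic ?J" "z = u \<circ> x"
    using min_reps_exists[OF J z(1)] .
  have vu: "v \<preceq> u" using bruhat_min_rep[OF J vJ u(1,2)] v u by simp
  \<comment> \<open>Such \<open>u'\<close> is not the identity and admits no descent besides
    \<open>s\<close>, so its descents are exactly those of \<open>v\<close>.\<close>
  have "sch u' \<in> B" if u': "u' \<in> min_reps W S ?J" "v \<preceq> u'" for u'
  proof (rule gen)
    have u'W: "u' \<in> W" using u' min_reps_W by blast
    have "u' \<noteq> id" using bruhat_len[OF u'(2)] \<open>v \<noteq> id\<close> by auto
    then obtain r where "r \<in> S" "len u' = Suc (len (u' \<circ> r))" using right_descent_exists[OF u'W] by blast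
    then have "r \<in> descents S u'" by (simp add: descents_def)
    moreover have "descents S u' \<subseteq> {s}" using u' by (auto simp: min_reps_def descents_def)
    ultimately have "descents S u' = {s}" by blast
    then show "u' \<in> gen_set y" using v u' u'W s by (auto simp: gen_set_def)
  qed
  from sch_coset_in_ideal[OF B J this u(1) vu u(2)] show "sch z \<in> B" using u(3) by simp
qed

subsection \<open>Translation to the coinvariant ring\<close>

abbreviation cl :: "('k, 'n) sym \<Rightarrow> ('k, 'n) sym set" where
  "cl \<equiv> coinv_class W"

lemma cl_mem: "g \<in> cl f \<longleftrightarrow> g - f \<in> coinv_ideal W"
proof -
  have "g \<in> cl f \<longleftrightarrow> (\<exists>h\<in>coinv_ideal W. g = h + f)"
    by (simp add: coinv_class_def a_r_coset_def')
  also have "\<dots> \<longleftrightarrow> g - f \<in> coinv_ideal W"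
    by (metis add_diff_cancel_right' diff_add_cancel)
  finally show ?thesis .
qed

lemma cl_eq_iff: "cl f = cl g \<longleftrightarrow> f - g \<in> coinv_ideal W"
proof
  show "cl f = cl g \<Longrightarrow> f - g \<in> coinv_ideal W"
    using cl_mem[of f f] cl_mem[of f g] by simp
  assume "f - g \<in> coinv_ideal W"
  then have "h - f \<in> coinv_ideal W \<longleftrightarrow> h - g \<in> coinv_ideal W" for h
    using coinv_ideal_add[of "h - f" W "f - g"] coinv_ideal_diff[of "h - g" W "f - g"] by auto
  then show "cl f = cl g" by (auto simp: cl_mem)
qed

sublocale coinv: cring "coinv_ring W"
  unfolding coinv_ring_def by (rule ideal.quotient_is_cring[OF ideal_coinv cring_sym_ring])

lemma carrier_coinv: "carrier (coinv_ring W) = range cl"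
  by (auto simp: coinv_ring_def FactRing_def A_RCOSETS_def' coinv_class_def)

lemma cl_carrier [simp]: "cl f \<in> carrier (coinv_ring W)"
  by (simp add: carrier_coinv)

lemma cl_add: "cl f \<oplus>\<^bsub>coinv_ring W\<^esub> cl g = cl (f + g)"
  and cl_mult: "cl f \<otimes>\<^bsub>coinv_ring W\<^esub> cl g = cl (f * g)"
  and cl_one: "\<one>\<^bsub>coinv_ring W\<^esub> = cl 1"
  using ideal.rcos_ring_hom[OF ideal_coinv[of W]]
  unfolding coinv_class_def coinv_ring_def by (auto simp: ring_hom_def)

lemma cl_zero: "\<zero>\<^bsub>coinv_ring W\<^esub> = cl 0"
  by (auto simp: coinv_ring_def FactRing_def cl_mem)

lemma cl_uminus: "\<ominus>\<^bsub>coinv_ring W\<^esub> cl f = cl (- f)"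
  by (rule coinv.minus_equality) (simp_all add: cl_add cl_zero)

lemma cl_finsum: "finite A \<Longrightarrow> (\<Oplus>\<^bsub>coinv_ring W\<^esub>x\<in>A. cl (h x)) = cl (\<Sum>x\<in>A. h x)"
  by (induction rule: finite_induct) (simp_all add: cl_zero cl_add Pi_def)

lemma cl_image_Zset: "cl f \<in> cl ` Zset U \<longleftrightarrow> f \<in> Zset U"
  using Zset_saturated by (auto simp: cl_eq_iff)

lemma cl_sch_inj: "inj_on (schubert_class W S P) W"
proof
  fix u u' assume u: "u \<in> W" "u' \<in> W" "schubert_class W S P u = schubert_class W S P u'"
  then have "sch u - sch u' \<in> coinv_ideal W" by (simp add: schubert_class_def cl_eq_iff)
  then have "eps (E u (sch u - sch u')) = 0" using u by (simp add: coinv_ideal_eq)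
  then show "u = u'" using u sch_norm_nz by (auto simp: E_diff eps_E_sch split: if_splits)
qed

text \<open>The coefficients in \<open>coinv_span\<close> are indexed by classes. Injectivity of
  \<open>schubert_class\<close> allows reindexing by group elements, after which the expansion by
  dual functionals applies.\<close>

lemma coinv_span_schubert:
  assumes U: "U \<subseteq> W"
  shows "coinv_span W (schubert_class W S P ` U) = cl ` Zset U"
proof -
  let ?c = "schubert_class W S P"
  have fin: "finite U" using U finite_W by (rule finite_subset)
  have inj: "inj_on ?c U" using cl_sch_inj U by (rule inj_on_subset)
  have eq: "(\<Oplus>\<^bsub>coinv_ring W\<^esub>X\<in>?c ` U. cl (const (c X)) \<otimes>\<^bsub>coinv_ring W\<^esub> X) = cl (\<Sum>u\<in>U. const (c (?c u)) * sch u)" for c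
  proof -
    have "(\<Oplus>\<^bsub>coinv_ring W\<^esub>X\<in>?c ` U. cl (const (c X)) \<otimes>\<^bsub>coinv_ring W\<^esub> X)
        = (\<Oplus>\<^bsub>coinv_ring W\<^esub>u\<in>U. cl (const (c (?c u))) \<otimes>\<^bsub>coinv_ring W\<^esub> ?c u)"
      by (rule coinv.finsum_reindex[OF _ inj]) (auto simp: schubert_class_def)
    also have "\<dots> = (\<Oplus>\<^bsub>coinv_ring W\<^esub>u\<in>U. cl (const (c (?c u)) * sch u))"
      by (simp add: schubert_class_def cl_mult)
    finally show ?thesis using cl_finsum[OF fin] by simp
  qed
  show ?thesis
  proof
    show "coinv_span W (?c ` U) \<subseteq> cl ` Zset U"
    proof
      fix X assume "X \<in> coinv_span W (?c ` U)"
      then obtain c where "X = cl (\<Sum>u\<in>U. const (c (?c u)) * sch u)"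
        unfolding coinv_span_def eq by blast
      then show "X \<in> cl ` Zset U" using schubert_sum_in_Zset[OF U] by simp
    qed
    show "cl ` Zset U \<subseteq> coinv_span W (?c ` U)"
    proof clarify
      fix f assume f: "f \<in> Zset U"
      define c where "c X = eps (E (the_inv_into U ?c X) f) / sch_norm" for X
      have "(\<Sum>u\<in>U. const (c (?c u)) * sch u) = (\<Sum>u\<in>U. const (eps (E u f) / sch_norm) * sch u)"
        by (rule sum.cong) (simp_all add: c_def the_inv_into_f_f[OF inj])
      then have "cl f = cl (\<Sum>u\<in>U. const (c (?c u)) * sch u)"
        using schubert_expansion[OF U f] by (simp add: cl_eq_iff)
      then show "cl f \<in> coinv_span W (?c ` U)"
        unfolding coinv_span_def eq by blast
    qed
  qed
qed

text \<open>Images commute with this intersection because the sets are unions of residue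
  classes.\<close>

lemma cl_Zset_Int: "cl ` Zset U \<inter> cl ` Zset V = cl ` Zset (U \<inter> V)"
proof -
  have Z: "Zset (U \<inter> V) = Zset U \<inter> Zset V" by (auto simp: Zset_def)
  have "cl f \<in> cl ` Zset (U \<inter> V)" if "f \<in> Zset U" "cl f \<in> cl ` Zset V" for f
    unfolding cl_image_Zset Z using that cl_image_Zset[of f V] by simp
  then have "cl ` Zset U \<inter> cl ` Zset V \<subseteq> cl ` Zset (U \<inter> V)" by blast
  moreover have "cl ` Zset (U \<inter> V) \<subseteq> cl ` Zset U \<inter> cl ` Zset V" unfolding Z by blast
  ultimately show ?thesis by (rule equalityI)
qed

text \<open>The preimage of the invariant subring: only the residue class has to be
  invariant.\<close>

definition Inv :: "('k ^ 'n \<Rightarrow> 'k ^ 'n) set \<Rightarrow> ('k, 'n) sym set" where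
  "Inv J = {f. \<forall>w\<in>parabolic J. act w f - f \<in> coinv_ideal W}"

lemma act_image_cl: "w \<in> W \<Longrightarrow> act w ` cl f = cl (act w f)"
proof
  assume w: "w \<in> W"
  show "act w ` cl f \<subseteq> cl (act w f)"
    using coinv_ideal_act[OF _ w] by (auto simp: cl_mem simp flip: act_diff[OF w])
  show "cl (act w f) \<subseteq> act w ` cl f"
  proof
    fix g assume g: "g \<in> cl (act w f)"
    have "act (iv w) (g - act w f) = act (iv w) g - f"
      using w by (simp add: act_diff act_id flip: act_comp)
    moreover have "act (iv w) (g - act w f) \<in> coinv_ideal W"
      using g w by (simp add: cl_mem coinv_ideal_act)
    ultimately have "act (iv w) g \<in> cl f" by (simp add: cl_mem)
    moreover have "act w (act (iv w) g) = g" using w by (simp add: act_id flip: act_comp)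
    ultimately show "g \<in> act w ` cl f" by (metis imageI)
  qed
qed

text \<open>If \<open>s\<close> in \<open>J\<close> is a descent of \<open>z\<close>, then
  \<open>E z\<close> factors through \<open>dd s\<close> and so changes sign when
  \<open>act s\<close> is applied first; invariance makes twice its constant term vanish.
  Conversely, expand in Schubert polynomials fixed by \<open>J\<close>.\<close>

lemma Inv_eq:
  assumes J: "J \<subseteq> S"
  shows "Inv J = Zset (min_reps W S J)"
proof
  show "Inv J \<subseteq> Zset (min_reps W S J)"
  proof
    fix f assume f: "f \<in> Inv J"
    have "eps (E z f) = 0" if z: "z \<in> W" "z \<notin> min_reps W S J" for z
    proof -
      obtain s where s: "s \<in> J" "s \<in> S" "len (z \<circ> s) < len z"
        using z by (auto simp: min_reps_def descents_def)
      have g: "act s f - f \<in> coinv_ideal W"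
        using f parabolic_gen[OF s(1)] by (simp add: Inv_def)
      have Ez: "E z h = E (z \<circ> s) (dd s h)" for h
      proof -
        have "len z = Suc (len (z \<circ> s))"
          using len_comp_simple_cases[OF z(1) s(2)] s(3) by (metis less_Suc_eq not_less_eq)
        then show ?thesis using E_dd[of "z \<circ> s" s h] z s by simp
      qed
      have "lin_form (srt s) * (- dd s f) = act s f - act s (act s f)"
        using dd[OF s(2), of f] s by (simp add: act_id flip: act_comp)
      then have "dd s (act s f) = - dd s f" by (rule ddI[OF s(2)])
      then have "E z (act s f) = - E z f" using Ez z s by (simp add: E_uminus)
      then have "E z (act s f - f) = - E z f - E z f" using z by (simp add: E_diff)
      then have "eps (E z (act s f - f)) = - eps (E z f) - eps (E z f)"
        by (simp only: ev_diff ev_uminus)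
      also have "\<dots> = - (2 * eps (E z f))" by simp
      finally have "eps (E z (act s f - f)) = - (2 * eps (E z f))" .
      then show ?thesis
        using g z two_nz by (auto simp: coinv_ideal_eq)
    qed
    then show "f \<in> Zset (min_reps W S J)" by (auto simp: Zset_def)
  qed
  show "Zset (min_reps W S J) \<subseteq> Inv J"
  proof
    fix f assume f: "f \<in> Zset (min_reps W S J)"
    have sub: "min_reps W S J \<subseteq> W" using min_reps_W by blast
    let ?h = "\<Sum>u\<in>min_reps W S J. const (eps (E u f) / sch_norm) * sch u"
    have i: "f - ?h \<in> coinv_ideal W" by (rule schubert_expansion[OF sub f])
    have "act s f - f \<in> coinv_ideal W" if s: "s \<in> J" for s
    proof -
      have sW: "s \<in> W" using s J by auto
      have "act s ?h = ?h"
        unfolding act_sum[OF sW] by (rule sum.cong) (simp_all add: act_mult[OF sW] act_const[OF sW] act_sch[OF J _ s])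
      then have "act s f - f = act s (f - ?h) - (f - ?h)" using sW by (simp add: act_diff)
      then show ?thesis using coinv_ideal_diff[OF coinv_ideal_act[OF i sW] i] by (simp only:)
    qed
    then show "f \<in> Inv J" using act_word_diff_coinv[OF _ J] by (auto simp: Inv_def)
  qed
qed

lemma carrier_parabolic_coinv:
  assumes J: "J \<subseteq> S"
  shows "carrier (parabolic_coinv_ring W J) = cl ` Inv J"
proof -
  have "act w ` cl f = cl f \<longleftrightarrow> act w f - f \<in> coinv_ideal W" if "w \<in> parabolic J" for w f
    using act_image_cl[of w f] parabolic_W[OF J that] by (simp add: cl_eq_iff)
  then have *: "(\<forall>w\<in>parabolic J. act w ` cl f = cl f) \<longleftrightarrow> f \<in> Inv J" for f
    unfolding Inv_def by blast
  have "carrier (parabolic_coinv_ring W J) = {X \<in> range cl. \<forall>w\<in>parabolic J. act w ` X = X}"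
    by (simp add: parabolic_coinv_ring_def carrier_coinv)
  also have "\<dots> = cl ` {f. \<forall>w\<in>parabolic J. act w ` cl f = cl f}" by blast
  finally show ?thesis unfolding * by simp
qed

lemma Inv_add: "f \<in> Inv J \<Longrightarrow> g \<in> Inv J \<Longrightarrow> J \<subseteq> S \<Longrightarrow> f + g \<in> Inv J"
  unfolding Inv_eq by (auto simp: Zset_def E_add)

lemma Inv_uminus: "f \<in> Inv J \<Longrightarrow> J \<subseteq> S \<Longrightarrow> - f \<in> Inv J"
  unfolding Inv_eq by (auto simp: Zset_def E_uminus)

lemma Inv_mult:
  assumes "f \<in> Inv J" "g \<in> Inv J" "J \<subseteq> S"
  shows "f * g \<in> Inv J"
  unfolding Inv_def
proof clarify
  fix w assume w: "w \<in> parabolic J"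
  then have wW: "w \<in> W" using parabolic_W assms by blast
  have "act w (f * g) - f * g = act w g * (act w f - f) + f * (act w g - g)"
    using wW by (simp add: act_mult algebra_simps)
  moreover have "\<dots> \<in> coinv_ideal W"
    using assms w by (intro coinv_ideal_add coinv_ideal_mult) (auto simp: Inv_def)
  ultimately show "act w (f * g) - f * g \<in> coinv_ideal W" by simp
qed

lemma Inv_const: "J \<subseteq> S \<Longrightarrow> const c \<in> Inv J"
  by (simp add: Inv_def act_const parabolic_W)

lemma cring_parabolic_coinv:
  assumes J: "J \<subseteq> S"
  shows "cring (parabolic_coinv_ring W J)"
proof -
  let ?H = "cl ` Inv J"
  have sub: "?H \<subseteq> carrier (coinv_ring W)" by auto
  have "subring ?H (coinv_ring W)"
  proof (rule coinv.subringI[OF sub])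
    show "\<one>\<^bsub>coinv_ring W\<^esub> \<in> ?H" using Inv_const[OF J, of 1] by (simp add: cl_one const_one)
    show "\<ominus>\<^bsub>coinv_ring W\<^esub> h \<in> ?H" if "h \<in> ?H" for h
      using that Inv_uminus[OF _ J] by (auto simp: cl_uminus)
    show "h1 \<otimes>\<^bsub>coinv_ring W\<^esub> h2 \<in> ?H" if "h1 \<in> ?H" "h2 \<in> ?H" for h1 h2
      using that Inv_mult[OF _ _ J] by (auto simp: cl_mult)
    show "h1 \<oplus>\<^bsub>coinv_ring W\<^esub> h2 \<in> ?H" if "h1 \<in> ?H" "h2 \<in> ?H" for h1 h2
      using that Inv_add[OF _ _ J] by (auto simp: cl_add)
  qed
  then have "cring ((coinv_ring W)\<lparr>carrier := ?H\<rparr>)"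
    using coinv.subcringI' coinv.subcring_iff[OF sub] by blast
  moreover have "parabolic_coinv_ring W J = (coinv_ring W)\<lparr>carrier := ?H\<rparr>"
    using carrier_parabolic_coinv[OF J] by (simp add: parabolic_coinv_ring_def)
  ultimately show ?thesis by simp
qed

lemma parabolic_coinv_simps [simp]:
  "x \<otimes>\<^bsub>parabolic_coinv_ring W J\<^esub> y = x \<otimes>\<^bsub>coinv_ring W\<^esub> y"
  "x \<oplus>\<^bsub>parabolic_coinv_ring W J\<^esub> y = x \<oplus>\<^bsub>coinv_ring W\<^esub> y"
  "\<zero>\<^bsub>parabolic_coinv_ring W J\<^esub> = \<zero>\<^bsub>coinv_ring W\<^esub>"
  by (simp_all add: parabolic_coinv_ring_def)

section \<open>The Schubert ideals in the two quotient rings\<close>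

lemma schubert_ideal_eq: "schubert_ideal W S P y = cl ` Zset (not_below y)"
  unfolding schubert_ideal_def not_below_def[symmetric]
  by (rule coinv_span_schubert) (auto simp: not_below_def)

lemma descent_generators_eq: "descent_generators W S P y = cl ` sch ` gen_set y"
  by (auto simp: descent_generators_def gen_set_def schubert_class_def)

text \<open>Membership is vanishing of the functionals for all \<open>z\<close> below
  \<open>y\<close>, a set closed downwards, which is what the Leibniz argument requires.\<close>

lemma Zset_not_below_mult: "y \<in> W \<Longrightarrow> f \<in> Zset (not_below y) \<Longrightarrow> h * f \<in> Zset (not_below y)"
proof -
  assume y: "y \<in> W" and f: "f \<in> Zset (not_below y)"
  have f0: "eps (E z f) = 0" if "z \<preceq> y" for z
    using f that bruhat_W[OF that] y by (auto simp: Zset_def not_below_def)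
  have "eps (E z (h * f)) = 0" if "z \<in> W" "z \<preceq> y" for z
    by (rule eps_E_mult_eq_0[OF that(1)]) (rule f0, rule bruhat_trans[OF _ that(2)])
  then show ?thesis by (auto simp: Zset_def not_below_def)
qed

lemma Zset_add: "f \<in> Zset U \<Longrightarrow> g \<in> Zset U \<Longrightarrow> f + g \<in> Zset U"
  by (auto simp: Zset_def E_add)

lemma Zset_zero: "0 \<in> Zset U"
  by (auto simp: Zset_def)

lemma ideal_schubert:
  assumes "y \<in> W"
  shows "ideal (schubert_ideal W S P y) (coinv_ring W)"
  unfolding schubert_ideal_eq
proof (rule cring_idealI[OF coinv.is_cring])
  show "r \<otimes>\<^bsub>coinv_ring W\<^esub> x \<in> cl ` Zset (not_below y)"
    if "r \<in> carrier (coinv_ring W)" "x \<in> cl ` Zset (not_below y)" for r x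
    using that Zset_not_below_mult[OF assms] by (auto simp: carrier_coinv cl_mult)
qed (use Zset_zero Zset_add in \<open>auto simp: cl_zero cl_add\<close>)

lemma sch_gen_in: "u \<in> gen_set y \<Longrightarrow> sch u \<in> Zset (not_below y)"
  using gen_set_not_below by (intro sch_in_Zset) (auto simp: gen_set_def)

lemma Idl_descent_generators:
  assumes y: "y \<in> W"
  shows "Idl\<^bsub>coinv_ring W\<^esub> (descent_generators W S P y) = schubert_ideal W S P y"
proof
  let ?G = "descent_generators W S P y"
  have G: "?G \<subseteq> carrier (coinv_ring W)" by (auto simp: descent_generators_eq)
  show "Idl\<^bsub>coinv_ring W\<^esub> ?G \<subseteq> schubert_ideal W S P y"
    by (rule coinv.genideal_minimal[OF ideal_schubert[OF y]])
      (use sch_gen_in in \<open>auto simp: descent_generators_eq schubert_ideal_eq\<close>)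
  have I: "ideal (Idl\<^bsub>coinv_ring W\<^esub> ?G) (coinv_ring W)" by (rule coinv.genideal_ideal[OF G])
  let ?B = "{f. cl f \<in> Idl\<^bsub>coinv_ring W\<^esub> ?G}"
  have "sym_ideal ?B"
    unfolding sym_ideal_def
  proof (intro conjI ballI allI)
    show "coinv_ideal W \<subseteq> ?B"
    proof
      fix f assume "f \<in> coinv_ideal W"
      then have "cl f = cl 0" by (simp add: cl_eq_iff)
      then show "f \<in> ?B" using additive_subgroup.zero_closed[OF ideal.axioms(1)[OF I]] by (simp add: cl_zero)
    qed
    show "f + g \<in> ?B" if "f \<in> ?B" "g \<in> ?B" for f g
      using that additive_subgroup.a_closed[OF ideal.axioms(1)[OF I]] by (simp flip: cl_add)
    show "h * f \<in> ?B" if "f \<in> ?B" for f h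
      using that ideal.I_l_closed[OF I] by (simp flip: cl_mult)
  qed
  moreover have "sch u \<in> ?B" if "u \<in> gen_set y" for u
    using coinv.genideal_self[OF G] that by (auto simp: descent_generators_eq)
  ultimately have "Zset (not_below y) \<subseteq> ?B" by (rule generation[OF y])
  then show "schubert_ideal W S P y \<subseteq> Idl\<^bsub>coinv_ring W\<^esub> ?G"
    by (auto simp: schubert_ideal_eq)
qed

lemma parabolic_finite: "J \<subseteq> S \<Longrightarrow> finite (parabolic J)"
  using parabolic_W finite_W by (meson finite_subset subsetI)

lemma act_parabolic_invariant:
  assumes J: "J \<subseteq> S" and h: "\<And>s. s \<in> J \<Longrightarrow> act s h = h" and w: "w \<in> parabolic J"
  shows "act w h = h"
proof -
  have "act (word_prod ss) h = h" if "ss \<in> lists J" for ss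
    using that
  proof (induction ss)
    case Nil
    have "act (word_prod []) h = h" by (simp add: act_id)
    then show ?case .
  next
    case (Cons s ss)
    have "ss \<in> lists S" using Cons.hyps(2) lists_mono[OF J] by blast
    then have s: "s \<in> W" "word_prod ss \<in> W" using Cons.hyps(1) J by auto
    have IH: "act (word_prod ss) h = h" by (rule Cons.IH)
    have "act (word_prod (s # ss)) h = h"
      using act_comp[OF s, of h] IH h[OF Cons.hyps(1)] by simp
    then show ?case .
  qed
  then show ?thesis using w by (auto simp: parabolic_def)
qed

text \<open>The inclusion from right to left needs invariant coefficients. Averages over the
  parabolic subgroup provide them: invariant generators can be pulled out of an average.\<close>

lemma Idl_parabolic_descent_generators:
  assumes J: "J \<subseteq> S" and y: "y \<in> W" "gen_set y \<subseteq> min_reps W S J"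
  shows "Idl\<^bsub>parabolic_coinv_ring W J\<^esub> (descent_generators W S P y)
    = schubert_ideal W S P y \<inter> carrier (parabolic_coinv_ring W J)"
proof
  let ?G = "descent_generators W S P y" and ?R = "parabolic_coinv_ring W J"
  interpret R: cring ?R by (rule cring_parabolic_coinv[OF J])
  have sub: "carrier ?R \<subseteq> carrier (coinv_ring W)"
    by (auto simp: parabolic_coinv_ring_def)
  have genInv: "sch u \<in> Inv J" if "u \<in> gen_set y" for u
    unfolding Inv_eq[OF J] using that y(2) by (intro sch_in_Zset) (auto simp: gen_set_def)
  have G: "?G \<subseteq> carrier ?R"
    using genInv by (auto simp: descent_generators_eq carrier_parabolic_coinv[OF J])
  interpret SI: ideal "schubert_ideal W S P y" "coinv_ring W" by (rule ideal_schubert[OF y(1)])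
  have "ideal (schubert_ideal W S P y \<inter> carrier ?R) ?R"
  proof (rule cring_idealI[OF R.is_cring])
    show "\<zero>\<^bsub>?R\<^esub> \<in> schubert_ideal W S P y \<inter> carrier ?R"
      using R.zero_closed SI.zero_closed by simp
    show "x1 \<oplus>\<^bsub>?R\<^esub> x2 \<in> schubert_ideal W S P y \<inter> carrier ?R"
      if "x1 \<in> schubert_ideal W S P y \<inter> carrier ?R" "x2 \<in> schubert_ideal W S P y \<inter> carrier ?R" for x1 x2
      using R.a_closed[of x1 x2] SI.a_closed[of x1 x2] that by simp
    show "r \<otimes>\<^bsub>?R\<^esub> x \<in> schubert_ideal W S P y \<inter> carrier ?R"
      if "r \<in> carrier ?R" "x \<in> schubert_ideal W S P y \<inter> carrier ?R" for r x
      using R.m_closed[of r x] SI.I_l_closed[of x r] that sub by auto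
  qed auto
  moreover have "?G \<subseteq> schubert_ideal W S P y \<inter> carrier ?R"
    using G sch_gen_in by (auto simp: descent_generators_eq schubert_ideal_eq)
  ultimately show "Idl\<^bsub>?R\<^esub> ?G \<subseteq> schubert_ideal W S P y \<inter> carrier ?R"
    by (rule R.genideal_minimal)
  interpret Id: ideal "Idl\<^bsub>?R\<^esub> ?G" ?R by (rule R.genideal_ideal[OF G])
  define av where "av g = (\<Sum>w\<in>parabolic J. act w g)" for g
  have avInv: "cl (av g) \<in> carrier ?R" for g
    unfolding carrier_parabolic_coinv[OF J] av_def Inv_def by (simp add: parabolic_average[OF J])
  have Id0: "cl f \<in> Idl\<^bsub>?R\<^esub> ?G" if "f \<in> coinv_ideal W" for f
  proof -
    have "cl f = \<zero>\<^bsub>?R\<^esub>" using that by (simp add: cl_eq_iff cl_zero)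
    then show ?thesis using Id.zero_closed by simp
  qed
  have av_add: "av (f + g) = av f + av g" for f g
    unfolding av_def using parabolic_W[OF J] by (simp add: act_add sum.distrib)
  \<comment> \<open>The average is not linear over all polynomials, so the arbitrary factor
    \<open>h\<close> is what makes \<open>?B\<close> an ideal. The choice \<open>h = 1\<close> is
    used at the end.\<close>
  let ?B = "{f. \<forall>h. cl (av (f * h)) \<in> Idl\<^bsub>?R\<^esub> ?G}"
  have "sym_ideal ?B"
    unfolding sym_ideal_def
  proof (intro conjI ballI allI)
    show "coinv_ideal W \<subseteq> ?B"
    proof clarify
      fix f h assume f: "f \<in> coinv_ideal W"
      have "av (f * h) \<in> coinv_ideal W"
        unfolding av_def
        by (rule coinv_ideal_sum) (simp add: coinv_ideal_act coinv_ideal_mult[OF f] parabolic_W[OF J] mult.commute[of f h])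
      then show "cl (av (f * h)) \<in> Idl\<^bsub>?R\<^esub> ?G" by (rule Id0)
    qed
    show "f + g \<in> ?B" if "f \<in> ?B" "g \<in> ?B" for f g
    proof clarify
      fix h
      have "cl (av (f * h)) \<oplus>\<^bsub>?R\<^esub> cl (av (g * h)) \<in> Idl\<^bsub>?R\<^esub> ?G"
        using that by (intro Id.a_closed) auto
      then show "cl (av ((f + g) * h)) \<in> Idl\<^bsub>?R\<^esub> ?G"
        by (simp add: cl_add distrib_right av_add)
    qed
    show "h * f \<in> ?B" if "f \<in> ?B" for f h
    proof clarify
      fix h'
      have "h * f * h' = f * (h * h')" by (simp only: mult_ac)
      moreover have "cl (av (f * (h * h'))) \<in> Idl\<^bsub>?R\<^esub> ?G" using that by blast
      ultimately show "cl (av (h * f * h')) \<in> Idl\<^bsub>?R\<^esub> ?G" by (simp only:)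
    qed
  qed
  moreover have "sch u \<in> ?B" if u: "u \<in> gen_set y" for u
  proof clarify
    fix h
    have "act w (sch u) = sch u" if "w \<in> parabolic J" for w
      by (rule act_parabolic_invariant[OF J act_sch[OF J] that]) (use u y(2) in auto)
    then have "av (sch u * h) = av h * sch u"
      unfolding av_def sum_distrib_right
      by (intro sum.cong) (simp_all add: act_mult[OF parabolic_W[OF J]] mult.commute)
    then have "cl (av (sch u * h)) = cl (av h) \<otimes>\<^bsub>?R\<^esub> cl (sch u)"
      by (simp add: cl_mult)
    moreover have "cl (sch u) \<in> Idl\<^bsub>?R\<^esub> ?G"
      using R.genideal_self[OF G] u by (auto simp: descent_generators_eq)
    ultimately show "cl (av (sch u * h)) \<in> Idl\<^bsub>?R\<^esub> ?G"
      using Id.I_l_closed avInv by simp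
  qed
  ultimately have B: "Zset (not_below y) \<subseteq> ?B" by (rule generation[OF y(1)])
  show "schubert_ideal W S P y \<inter> carrier ?R \<subseteq> Idl\<^bsub>?R\<^esub> ?G"
  proof
    fix X assume X: "X \<in> schubert_ideal W S P y \<inter> carrier ?R"
    then obtain f where f: "f \<in> Zset (not_below y)" "X = cl f" by (auto simp: schubert_ideal_eq)
    have "f \<in> Inv J"
      using X f cl_image_Zset unfolding carrier_parabolic_coinv[OF J] Inv_eq[OF J] by blast
    then have "(\<Sum>w\<in>parabolic J. act w f - f) \<in> coinv_ideal W"
      by (intro coinv_ideal_sum) (simp add: Inv_def)
    \<comment> \<open>Modulo the coinvariant ideal an element of \<open>Inv J\<close> equals its
      normalized average, so \<open>cl f\<close> is recovered from \<open>cl (av f)\<close>.\<close>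
    then have i: "const (1 / of_nat (card (parabolic J))) * (\<Sum>w\<in>parabolic J. act w f - f) \<in> coinv_ideal W"
      by (rule coinv_ideal_mult)
    have "card (parabolic J) \<noteq> 0" using parabolic_finite[OF J] parabolic_id by (metis card_0_eq empty_iff)
    then have nz: "(of_nat (card (parabolic J)) :: 'k) \<noteq> 0"
      using of_nat_eq_iff'[of "card (parabolic J)" 0] by simp
    have "const (1 / of_nat (card (parabolic J))) * (\<Sum>w\<in>parabolic J. act w f - f)
        = const (1 / of_nat (card (parabolic J))) * av f - f"
      unfolding av_def using nz by (intro sym_eqI) (simp add: sum_subtractf algebra_simps)
    with i have "cl f = cl (const (1 / of_nat (card (parabolic J))) * av f)"
      using coinv_ideal_uminus[of "const (1 / of_nat (card (parabolic J))) * av f - f" W] by (simp add: cl_eq_iff)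
    also have "\<dots> = cl (const (1 / of_nat (card (parabolic J)))) \<otimes>\<^bsub>?R\<^esub> cl (av f)"
      by (simp add: cl_mult)
    also have "\<dots> \<in> Idl\<^bsub>?R\<^esub> ?G"
    proof (rule Id.I_l_closed)
      have "cl (av (f * 1)) \<in> Idl\<^bsub>?R\<^esub> ?G" using B f(1) by blast
      then show "cl (av f) \<in> Idl\<^bsub>?R\<^esub> ?G" by simp
      show "cl (const (1 / of_nat (card (parabolic J)))) \<in> carrier ?R"
        unfolding carrier_parabolic_coinv[OF J] using Inv_const[OF J] by blast
    qed
    finally show "X \<in> Idl\<^bsub>?R\<^esub> ?G" using f(2) by simp
  qed
qed

lemma schubert_ideals_of_coset:
  assumes J: "J \<subseteq> S" and w: "w \<in> W" and y: "y = coset_max S (parabolic_coset J w)"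
  shows "essential_set W S y \<subseteq> min_reps W S J"
    and "Idl\<^bsub>coinv_ring W\<^esub> (schubert_ideal W S P y \<inter> carrier (parabolic_coinv_ring W J)) = schubert_ideal W S P y"
    and "schubert_ideal W S P y \<inter> carrier (parabolic_coinv_ring W J) = coset_schubert_ideal W S P J (parabolic_coset J w)"
    and "Idl\<^bsub>coinv_ring W\<^esub> (descent_generators W S P y) = schubert_ideal W S P y"
    and "Idl\<^bsub>parabolic_coinv_ring W J\<^esub> (descent_generators W S P y) = coset_schubert_ideal W S P J (parabolic_coset J w)"
proof -
  note ymax = coset_max[OF J w y]
  show ess: "essential_set W S y \<subseteq> min_reps W S J"
    by (rule essential_min_reps[OF J ymax(1,3)])
  \<comment> \<open>Membership in \<open>min_reps W S J\<close> depends only on descents, which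
    generators share with essential elements.\<close>
  have gen: "gen_set y \<subseteq> min_reps W S J"
    using ess by (auto simp: gen_set_def min_reps_def)
  obtain x a where x: "x \<in> min_reps W S J" "a \<in> parabolic J" "w = x \<circ> a"
    using min_reps_exists[OF J w] .
  obtain b where b: "b \<in> parabolic J" "y = x \<circ> (a \<circ> b)"
    using ymax(2) x(3) by (auto simp: parabolic_coset_def comp_assoc)
  have ab: "a \<circ> b \<in> parabolic J" by (rule parabolic_comp[OF x(2) b(1)])
  have xy: "x \<preceq> y" unfolding b(2) by (rule min_rep_le[OF J x(1) ab])
  have "coset_le W S J (parabolic_coset J u) (parabolic_coset J w) \<longleftrightarrow> u \<preceq> y"
    if u: "u \<in> min_reps W S J" for u
  proof -
    have "coset_min W S J (parabolic_coset J u) = u"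
      using coset_min_eq[OF J u parabolic_id] by simp
    moreover have "coset_min W S J (parabolic_coset J w) = x"
      unfolding x(3) by (rule coset_min_eq[OF J x(1,2)])
    \<comment> \<open>For minimal representatives, the order on cosets thus becomes the Bruhat order
      below the maximal element.\<close>
    moreover have "u \<preceq> x \<longleftrightarrow> u \<preceq> y"
      using bruhat_trans[OF _ xy] bruhat_min_rep[OF J u x(1) ab] b(2) by blast
    ultimately show ?thesis by (simp add: coset_le_def)
  qed
  then have "{u \<in> min_reps W S J. \<not> coset_le W S J (parabolic_coset J u) (parabolic_coset J w)}
      = not_below y \<inter> min_reps W S J"
    by (auto simp: not_below_def min_reps_W)
  then have "coset_schubert_ideal W S P J (parabolic_coset J w) = cl ` Zset (not_below y \<inter> min_reps W S J)"
    unfolding coset_schubert_ideal_def using coinv_span_schubert[of "not_below y \<inter> min_reps W S J"] min_reps_W by auto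
  then show contr: "schubert_ideal W S P y \<inter> carrier (parabolic_coinv_ring W J)
      = coset_schubert_ideal W S P J (parabolic_coset J w)"
    by (simp add: schubert_ideal_eq carrier_parabolic_coinv[OF J] Inv_eq[OF J] cl_Zset_Int)
  show idl: "Idl\<^bsub>coinv_ring W\<^esub> (descent_generators W S P y) = schubert_ideal W S P y"
    by (rule Idl_descent_generators[OF ymax(1)])
  show idlR: "Idl\<^bsub>parabolic_coinv_ring W J\<^esub> (descent_generators W S P y) = coset_schubert_ideal W S P J (parabolic_coset J w)"
    using Idl_parabolic_descent_generators[OF J ymax(1) gen] contr by simp
  let ?A = "schubert_ideal W S P y \<inter> carrier (parabolic_coinv_ring W J)"
  have A: "?A \<subseteq> carrier (coinv_ring W)" by (auto simp: schubert_ideal_eq)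
  \<comment> \<open>The generators of the whole ideal already lie in the contraction, so the
    contraction generates it as well.\<close>
  have "descent_generators W S P y \<subseteq> ?A"
  proof -
    have "sch u \<in> Zset (min_reps W S J)" if "u \<in> gen_set y" for u
      using that gen by (intro sch_in_Zset) (auto simp: gen_set_def)
    then show ?thesis
      using sch_gen_in
      by (auto simp: descent_generators_eq schubert_ideal_eq carrier_parabolic_coinv[OF J] Inv_eq[OF J])
  qed
  then have "descent_generators W S P y \<subseteq> Idl\<^bsub>coinv_ring W\<^esub> ?A"
    using coinv.genideal_self[OF A] by blast
  then have "schubert_ideal W S P y \<subseteq> Idl\<^bsub>coinv_ring W\<^esub> ?A"
    using coinv.genideal_minimal[OF coinv.genideal_ideal[OF A]] idl by blast
  moreover have "Idl\<^bsub>coinv_ring W\<^esub> ?A \<subseteq> schubert_ideal W S P y"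
    by (rule coinv.genideal_minimal[OF ideal_schubert[OF ymax(1)]]) blast
  ultimately show "Idl\<^bsub>coinv_ring W\<^esub> ?A = schubert_ideal W S P y" by blast
qed

end

theorem theorem3p2:
  fixes \<iota> :: "'k::field \<Rightarrow> real"
    and W S J :: "('k ^ 'n::finite \<Rightarrow> 'k ^ 'n) set"
    and \<Phi> P :: "('k ^ 'n \<Rightarrow> 'k) set"
    and C :: "('k ^ 'n) set"
    and w w_max :: "'k ^ 'n \<Rightarrow> 'k ^ 'n"
  assumes "reflection_datum \<iota> W S \<Phi> C P"
    and "J \<subseteq> S"
    and "w \<in> W"
    and "w_max = coset_max S (parabolic_coset J w)"
  shows
    "essential_set W S w_max \<subseteq> min_reps W S J
     \<and> Idl\<^bsub>coinv_ring W\<^esub>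
          (schubert_ideal W S P w_max \<inter> carrier (parabolic_coinv_ring W J))
        = schubert_ideal W S P w_max
     \<and> schubert_ideal W S P w_max \<inter> carrier (parabolic_coinv_ring W J)
        = coset_schubert_ideal W S P J (parabolic_coset J w)
     \<and> Idl\<^bsub>coinv_ring W\<^esub> (descent_generators W S P w_max)
        = schubert_ideal W S P w_max
     \<and> Idl\<^bsub>parabolic_coinv_ring W J\<^esub> (descent_generators W S P w_max)
        = coset_schubert_ideal W S P J (parabolic_coset J w)"
proof -
  interpret reflection_group \<iota> W S \<Phi> C P
    by unfold_locales (rule assms(1))
  from schubert_ideals_of_coset[OF assms(2-4)] show ?thesis by blast
qed

end
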